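(* Let $X$ be a compact metric space which is an AANR and whose covering dimension satisfies $\dim(X)>1$. Let $\mathbb{D}^2=\{z\in\mathbb{C}:|z|\leq 1\}$. Then there exist continuous maps $f:\mathbb{D}^2\rightarrow X$ and $g:X\rightarrow\mathbb{D}^2$ such that $\|g\circ f-\mathrm{id}_{\mathbb{D}^2}\|_{\infty}=\sup_{z\in\mathbb{D}^2}|g(f(z))-z|<1$.
   Context: A compact metric space $X$ is an AANR (approximative absolute neighbourhood retract, in the sense of Clapp) if for every compact metric space $Y$ and every topological embedding $\iota:X\to Y$, and for every $\epsilon>0$, there exist a closed neighbourhood $U$ of $\iota(X)$ in $Y$ and a continuous map $r:U\to X$ with $d(x,r(\iota(x)))<\epsilon$ for all $x\in X$. $\dim$ denotes covering dimension. *)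

theory Defs
  imports "HOL-Analysis.Analysis" "HOL-Library.Extended_Nat"
begin

definition covering_dim_le :: "'a topology \<Rightarrow> nat \<Rightarrow> bool" where
  "covering_dim_le T n \<longleftrightarrow>
     (\<forall>\<U>. finite \<U> \<and> (\<forall>U\<in>\<U>. openin T U) \<and> \<Union>\<U> = topspace T \<longrightarrow>
        (\<exists>\<V>. finite \<V> \<and> (\<forall>V\<in>\<V>. openin T V) \<and> \<Union>\<V> = topspace T \<and>
             (\<forall>V\<in>\<V>. \<exists>U\<in>\<U>. V \<subseteq> U) \<and>
             (\<forall>x\<in>topspace T. card {V\<in>\<V>. x \<in> V} \<le> n + 1)))"

definition covering_dim :: "'a topology \<Rightarrow> enat" where
  "covering_dim T = (INF n\<in>{n. covering_dim_le T n}. enat n)"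

(* AANR in the sense of Clapp.  Every compact metric space has cardinality at most
   the continuum, hence is isometric to a metric space whose carrier lies in the type
   nat \<Rightarrow> real; so quantifying over compact metric spaces Y on that type is the same
   as quantifying over all compact metric spaces. *)
definition AANR :: "'a metric \<Rightarrow> bool" where
  "AANR X \<longleftrightarrow>
     (\<forall>(Y :: (nat \<Rightarrow> real) metric) \<iota> \<epsilon>.
        compact_space (mtopology_of Y) \<and>
        embedding_map (mtopology_of X) (mtopology_of Y) \<iota> \<and> \<epsilon> > 0 \<longrightarrow>
        (\<exists>U r. closedin (mtopology_of Y) U \<and>
               \<iota> ` mspace X \<subseteq> (mtopology_of Y) interior_of U \<and>
               continuous_map (subtopology (mtopology_of Y) U) (mtopology_of X) r \<and>
               (\<forall>x\<in>mspace X. mdist X x (r (\<iota> x)) < \<epsilon>)))"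

end

theory Submission
  imports Defs
begin

text \<open>
  Embed \<open>X\<close> as a compact subset \<open>K\<close> of the Hilbert cube. It suffices to find a square \<open>\<Psi>\<close> in \<open>K\<close> and real functions
  \<open>u\<close>, \<open>v\<close> on \<open>K\<close> such that \<open>u\<close> separates the left side of \<open>\<Psi>\<close> from the right one and \<open>v\<close> the bottom from the top:
  clamping \<open>(u, v)\<close> gives \<open>g\<close>, and the square, reached by clamping \<open>10 z\<close>, gives \<open>f\<close>.

  If the dimension exceeds 1, then some pair \<open>(u, v)\<close> cannot be deformed to avoid the origin: otherwise, in a family of
  nonnegative functions subordinate to a finite cover, triples could be eliminated one after the other, by subtracting the
  minimum of three functions that are never all equal. Let \<open>r : U \<rightarrow> K\<close> be an approximate retraction of a neighbourhood
  and \<open>V\<close> a finite net of \<open>K\<close>. An integer cocycle on the edges of \<open>V\<close> that counts, for edges to the right of the origin,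
  the crossings of a level \<open>v = m\<close>, and vanishes for edges to the left, yields such a deformation as a map to the circle.
  To construct it, look at the components of a thin slab around \<open>v = m\<close> in the universal cover of \<open>U\<close> (discretised: homotopy
  classes of fine walks). The crossings of edges through one component are linked by triangles of \<open>V\<close>, and an edge counts
  its crossings that are linked to a right edge. This fails only if a right edge is linked to a left edge. Each triangle
  can branch inside at most one of many disjoint slabs, so for a suitable slab linked edges cross the same
  components of every thinner slab inside it. Two such thinner slabs and the two edges bound a null-homotopic rectangle in \<open>U\<close>,
  whose filling composed with \<open>r\<close> is the required square.
\<close>

section \<open>Walks and their homotopy classes\<close>

text \<open>Two obstacles shape the construction. The neighbourhood \<open>U\<close> need not be
  simply connected, hence the lifts: in the universal cover the signed crossing number of a slab
  component depends only on homotopy classes, so it obeys the cocycle identity on every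
  null-homotopic triangle. Moreover, linking preserves the component of the whole slab but may
  change the thin components near its bottom and top, and without a common pair of these no
  rectangle closes up. If a triangle lost a thin component in two disjoint slabs, its two edges
  would still run together through the farther slab, which forces them to agree in the nearer one.
  So the number of spoilt slabs is bounded in terms of the net alone. This dictates the order of
  scales: the net, then the thickness 7 \<open>\<kappa>\<close> of a slab, small enough for more
  slabs than there are points and triples of the net, and only then the mesh \<open>s\<close> of the
  walks, which must not jump over a slab. All homotopies take place in \<open>U\<close>; the
  approximate retraction brings the final square back to \<open>K\<close>.\<close>

locale walk_complex =
  fixes W :: "'p set" and R :: "'p \<Rightarrow> 'p \<Rightarrow> bool"
  assumes R_refl: "x \<in> W \<Longrightarrow> R x x"
    and R_sym: "R x y \<Longrightarrow> R y x"
    and R_in: "R x y \<Longrightarrow> x \<in> W"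
begin

definition walk :: "'p list \<Rightarrow> bool" where
  "walk p \<longleftrightarrow> p \<noteq> [] \<and> set p \<subseteq> W \<and> successively R p"

text \<open>Edge-path moves in the Vietoris-Rips complex of \<open>R\<close>. The case
  \<open>a = c\<close> of \<open>tri\<close> is backtracking, since \<open>R\<close> is reflexive on
  \<open>W\<close>.\<close>

inductive step :: "'p list \<Rightarrow> 'p list \<Rightarrow> bool" where
  dup: "a \<in> W \<Longrightarrow> step (xs @ [a, a] @ ys) (xs @ [a] @ ys)"
| tri: "R a b \<Longrightarrow> R b c \<Longrightarrow> R a c \<Longrightarrow> step (xs @ [a, b, c] @ ys) (xs @ [a, c] @ ys)"

definition hmt :: "'p list \<Rightarrow> 'p list \<Rightarrow> bool" where "hmt = equivclp step"

lemma hmt_refl [simp]: "hmt p p" by (simp add: hmt_def)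

lemma hmt_sym: "hmt p q \<Longrightarrow> hmt q p" by (simp add: hmt_def equivclp_sym)

lemma hmt_trans [trans]: "hmt p q \<Longrightarrow> hmt q r \<Longrightarrow> hmt p r"
  unfolding hmt_def by (rule equivclp_trans)

lemma step_imp_hmt: "step p q \<Longrightarrow> hmt p q"
  unfolding hmt_def by (rule r_into_equivclp)

lemma hmt_invariant:
  assumes "hmt p q" and "\<And>p q. step p q \<Longrightarrow> F p = F q"
  shows "F p = F q"
  using assms(1) unfolding hmt_def
  by (induction rule: equivclp_induct) (use assms(2) in \<open>auto\<close>)

lemma step_context: "step p q \<Longrightarrow> step (us @ p @ vs) (us @ q @ vs)"
proof (induction rule: step.induct)
  case (dup a xs ys)
  then show ?case using step.dup[of a "us @ xs" "ys @ vs"] by simp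
next
  case (tri a b c xs ys)
  then show ?case using step.tri[of a b c "us @ xs" "ys @ vs"] by simp
qed

lemma hmt_context: "hmt p q \<Longrightarrow> hmt (us @ p @ vs) (us @ q @ vs)"
  unfolding hmt_def
proof (induction rule: equivclp_induct)
  case base
  then show ?case by simp
next
  case (step y z)
  then have "equivclp step (us @ y @ vs) (us @ z @ vs)"
    by (metis step_context equivclp_sym r_into_equivclp)
  with step show ?case by (blast intro: equivclp_trans)
qed

lemma hmt_append: "hmt p p' \<Longrightarrow> hmt q q' \<Longrightarrow> hmt (p @ q) (p' @ q')"
  using hmt_context[of p p' "[]" q] hmt_context[of q q' p' "[]"] hmt_trans by fastforce

lemma step_walk: "step p q \<Longrightarrow> walk p = walk q"
  by (induction rule: step.induct)
    (auto simp: walk_def successively_append_iff successively_Cons R_refl dest: R_in R_sym)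

lemma step_hd: "step p q \<Longrightarrow> hd p = hd q"
  by (induction rule: step.induct) (auto simp: hd_append)

lemma step_last: "step p q \<Longrightarrow> last p = last q"
  by (induction rule: step.induct) (auto simp: last_append)

lemma hmt_walk: "hmt p q \<Longrightarrow> walk p = walk q"
  and hmt_hd: "hmt p q \<Longrightarrow> hd p = hd q"
  and hmt_last: "hmt p q \<Longrightarrow> last p = last q"
  by (erule hmt_invariant; simp add: step_walk step_hd step_last)+

text \<open>Concatenation is plain \<open>@\<close>, so the common vertex is written twice;
  reflexivity makes this a legal step, and \<open>dup\<close> removes it.\<close>

lemma walk_append: "walk p \<Longrightarrow> walk q \<Longrightarrow> last p = hd q \<Longrightarrow> walk (p @ q)"
  by (auto simp: walk_def successively_append_iff intro!: R_refl)

lemma walk_snoc: "walk p \<Longrightarrow> R (last p) x \<Longrightarrow> walk (p @ [x])"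
  by (auto simp: walk_def successively_append_iff dest: R_in R_sym)

lemma walk_snocD: "walk (p @ [x]) \<Longrightarrow> p \<noteq> [] \<Longrightarrow> walk p \<and> R (last p) x"
  by (auto simp: walk_def successively_append_iff)

lemma walk_single: "x \<in> W \<Longrightarrow> walk [x]"
  by (simp add: walk_def)

lemma walk_not_Nil: "walk p \<Longrightarrow> p \<noteq> []"
  by (simp add: walk_def)

lemma walk_take: "walk p \<Longrightarrow> 0 < n \<Longrightarrow> walk (take n p)"
  unfolding walk_def
  by (metis append_take_drop_id le_zero_eq not_less successively_append_iff take_eq_Nil set_take_subset subset_trans)

lemma walk_rev: "walk p \<Longrightarrow> walk (rev p)"
  by (auto simp: walk_def elim!: successively_mono intro: R_sym)

lemma walk_hd_in: "walk p \<Longrightarrow> hd p \<in> W"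
  and walk_last_in: "walk p \<Longrightarrow> last p \<in> W"
  by (auto simp: walk_def)

lemma hmt_dup_last: "walk p \<Longrightarrow> hmt (p @ [last p]) p"
proof -
  assume "walk p"
  then obtain xs where "p = xs @ [last p]" "last p \<in> W"
    by (metis append_butlast_last_id walk_last_in walk_def)
  then show ?thesis using step.dup[of "last p" xs "[]"]
    by (metis append.assoc append_Cons append_Nil append_Nil2 step_imp_hmt)
qed

lemma hmt_dup_hd: "walk p \<Longrightarrow> hmt (hd p # p) p"
proof -
  assume "walk p"
  then obtain xs where "p = hd p # xs" "hd p \<in> W"
    by (metis list.collapse walk_hd_in walk_def)
  then show ?thesis using step.dup[of "hd p" "[]" xs]
    by (metis append_Cons append_Nil step_imp_hmt)
qed

lemma hmt_rev_right: "walk p \<Longrightarrow> hmt (p @ rev p) [hd p]"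
proof (induction p rule: induct_list012)
  case (2 x)
  then show ?case using hmt_dup_last[of "[x]"] by simp
next
  case (3 x y zs)
  then have xy: "R x y" "x \<in> W" and w: "walk (y # zs)" by (auto simp: walk_def)
  have "hmt ([x] @ ((y # zs) @ rev (y # zs)) @ [x]) ([x] @ [y] @ [x])"
    using hmt_context[OF 3(2)[OF w], of "[x]" "[x]"] unfolding list.sel .
  also have "hmt ([x] @ [y] @ [x]) [x, x]"
    using step.tri[of x y x "[]" "[]"] xy R_refl R_sym step_imp_hmt by simp
  also have "hmt [x, x] [x]" using hmt_dup_last[of "[x]"] xy walk_single by simp
  finally show ?case by simp
qed (auto simp: walk_def)

lemma hmt_rev_left: "walk p \<Longrightarrow> hmt (rev p @ p) [last p]"
  using hmt_rev_right[OF walk_rev, of p] by (simp add: hd_rev)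

lemma hmt_cancel_left: "walk p \<Longrightarrow> walk q \<Longrightarrow> last p = hd q \<Longrightarrow> hmt (rev p @ p @ q) q"
  using hmt_append[OF hmt_rev_left[of p] hmt_refl[of q]] hmt_dup_hd[of q] hmt_trans by fastforce

lemma hmt_cancel_right: "walk p \<Longrightarrow> walk q \<Longrightarrow> last q = hd p \<Longrightarrow> hmt (q @ p @ rev p) q"
  using hmt_append[OF hmt_refl[of q] hmt_rev_right[of p]] hmt_dup_last[of q] hmt_trans by fastforce

lemma hmt_cancel_mid: "walk p \<Longrightarrow> walk q \<Longrightarrow> hd p = hd q \<Longrightarrow> hmt (p @ rev p @ q) q"
  using hmt_cancel_left[of "rev p" q] walk_rev[of p] by (simp add: last_rev)

text \<open>The strip between the walks is cut into triangles by the rungs \<open>xs ! i\<close>,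
  \<open>ys ! i\<close> and the diagonals \<open>xs ! i\<close>, \<open>ys ! Suc i\<close>. The
  extra \<open>hd xs\<close> on the right is the first rung.\<close>

lemma fellow_travellers:
  assumes "length xs = length ys" and "xs \<noteq> []" and "last xs = last ys"
    and "\<And>i. i < length xs \<Longrightarrow> R (xs ! i) (ys ! i)"
    and "\<And>i. Suc i < length xs \<Longrightarrow>
      R (xs ! i) (xs ! Suc i) \<and> R (ys ! i) (ys ! Suc i) \<and> R (xs ! i) (ys ! Suc i)"
  shows "hmt xs (hd xs # ys)"
  using assms
proof (induction xs ys rule: list_induct2)
  case (Cons x xs y ys)
  have xy: "R x y" using Cons.prems(3)[of 0] by simp
  show ?case
  proof (cases xs)
    case Nil
    then have "ys = []" "x = y" using Cons by auto
    then show ?thesis using Nil xy hmt_sym[OF hmt_dup_last[of "[x]"]] walk_single R_in by simp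
  next
    case (Cons x' xs')
    then obtain y' ys' where ys: "ys = y' # ys'" using Cons.hyps by (cases ys) auto
    have "hmt xs (hd xs # ys)"
      using Cons.prems Cons.hyps ys \<open>xs = x' # xs'\<close>
      by (intro Cons.IH) fastforce+
    then have "hmt (x # xs) (x # x' # ys)"
      using hmt_context[of xs "hd xs # ys" "[x]" "[]"] Cons by simp
    moreover have "R x x'" "R y y'" "R x y'" "R x' y'"
      using Cons.prems(4)[of 0] Cons.prems(3)[of 1] ys Cons by simp_all
    ultimately have "hmt (x # xs) (x # ys)" "hmt (x # y # ys) (x # ys)"
      using step.tri[of x x' y' "[]" ys'] step.tri[of x y y' "[]" ys'] xy ys
      by (auto intro: hmt_trans step_imp_hmt)
    then show ?thesis by (metis hmt_sym hmt_trans list.sel(1))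
  qed
qed simp

lemma fellow_travellers_same_ends:
  assumes "length xs = length ys" and "xs \<noteq> []" and "hd xs = hd ys" and "last xs = last ys"
    and "\<And>i. i < length xs \<Longrightarrow> R (xs ! i) (ys ! i)"
    and "\<And>i. Suc i < length xs \<Longrightarrow>
      R (xs ! i) (xs ! Suc i) \<and> R (ys ! i) (ys ! Suc i) \<and> R (xs ! i) (ys ! Suc i)"
  shows "hmt xs ys"
proof -
  have ne: "ys \<noteq> []" using assms(1,2) by auto
  have "successively R ys"
    using assms(1,6) by (auto simp: successively_conv_nth)
  moreover have "set ys \<subseteq> W"
  proof
    fix y assume "y \<in> set ys"
    then obtain i where "i < length ys" "y = ys ! i" by (metis in_set_conv_nth)
    then show "y \<in> W" using assms(1,5) R_in R_sym by metis
  qed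
  ultimately have "walk ys" using ne by (simp add: walk_def)
  then show ?thesis
    using fellow_travellers[of xs ys] assms hmt_dup_hd[of ys] hmt_trans by metis
qed

end

section \<open>Slab components and signed crossing numbers\<close>

text \<open>By \<open>osc\<close> every step that changes sides of a level, and every triangle
  containing such a step, stays within \<open>\<kappa>\<close> of that level. This is the source of
  the margins \<open>l + \<kappa> \<le> m\<close> and \<open>m + \<kappa> \<le> h\<close>
  below.\<close>

locale height_complex = walk_complex W R for W :: "'p set" and R +
  fixes v :: "'p \<Rightarrow> real" and \<kappa> :: real
  assumes osc: "R x y \<Longrightarrow> \<bar>v x - v y\<bar> < \<kappa>"
begin

definition slab_walk :: "real \<Rightarrow> real \<Rightarrow> 'p list \<Rightarrow> bool" where
  "slab_walk l h w \<longleftrightarrow> walk w \<and> (\<forall>x\<in>set w. l < v x \<and> v x < h)"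

text \<open>A walk stands for the endpoint of its lift to the universal cover based at its head. For
  \<open>last p\<close> in the slab this is the component of the lifted slab through that point,
  kept as a union of homotopy classes of walks, so that no quotient is formed.\<close>

definition comp :: "real \<Rightarrow> real \<Rightarrow> 'p list \<Rightarrow> 'p list set" where
  "comp l h p = {q. walk q \<and> hd q = hd p \<and>
     (\<exists>w. slab_walk l h w \<and> hd w = last p \<and> last w = last q \<and> hmt (p @ w) q)}"

definition comps :: "real \<Rightarrow> real \<Rightarrow> 'p \<Rightarrow> 'p list set set" where
  "comps l h a = {comp l h p | p. walk p \<and> hd p = a \<and> l < v (last p) \<and> v (last p) < h}"

definition above :: "real \<Rightarrow> 'p \<Rightarrow> int" where
  "above m x = (if v x > m then 1 else 0)"

text \<open>The prefixes \<open>take i p\<close> are the vertices of the lift of \<open>p\<close>,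
  and only lifted steps with both ends in \<open>Z\<close> count: an intersection number of the lift
  with the part of the level \<open>v = m\<close> in \<open>Z\<close>.\<close>

definition crossing :: "'p list set \<Rightarrow> real \<Rightarrow> 'p list \<Rightarrow> int" where
  "crossing Z m p = (\<Sum>i = 1..<length p.
     if take i p \<in> Z \<and> take (Suc i) p \<in> Z then above m (p ! i) - above m (p ! (i - 1)) else 0)"

text \<open>Change of base point from \<open>hd w\<close> to \<open>last w\<close>: prefixing by
  \<open>w\<close> turns walks from the new base point into walks from the old one.\<close>

definition transport :: "'p list \<Rightarrow> 'p list set \<Rightarrow> 'p list set" where
  "transport w Z = {p. walk p \<and> hd p = last w \<and> w @ p \<in> Z}"

lemma slab_walk_append:
  "slab_walk l h p \<Longrightarrow> slab_walk l h q \<Longrightarrow> last p = hd q \<Longrightarrow> slab_walk l h (p @ q)"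
  using walk_append by (auto simp: slab_walk_def)

lemma slab_walk_rev: "slab_walk l h p \<Longrightarrow> slab_walk l h (rev p)"
  using walk_rev by (auto simp: slab_walk_def)

lemma slab_walk_mono: "slab_walk l' h' p \<Longrightarrow> l \<le> l' \<Longrightarrow> h' \<le> h \<Longrightarrow> slab_walk l h p"
  by (fastforce simp: slab_walk_def)

lemma comp_self:
  assumes "walk p" "l < v (last p)" "v (last p) < h" shows "p \<in> comp l h p"
proof -
  have "slab_walk l h [last p]" using assms walk_last_in by (auto simp: slab_walk_def walk_single)
  then show ?thesis
    using assms hmt_dup_last[of p] unfolding comp_def by fastforce
qed

lemma comp_sym:
  assumes "walk p" "q \<in> comp l h p" shows "p \<in> comp l h q"
proof -
  obtain w where w: "slab_walk l h w" "hd w = last p" "last w = last q" "hmt (p @ w) q"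
    and q: "walk q" "hd q = hd p"
    using assms(2) by (auto simp: comp_def)
  have "hmt (q @ rev w) (p @ w @ rev w)"
    using hmt_append[OF hmt_sym[OF w(4)] hmt_refl] by simp
  also have "hmt (p @ w @ rev w) p"
    using w assms(1) by (intro hmt_cancel_right) (auto simp: slab_walk_def)
  finally have "hmt (q @ rev w) p" .
  moreover have "w \<noteq> []" using w(1) by (auto simp: slab_walk_def walk_def)
  ultimately show ?thesis
    using w q assms(1) slab_walk_rev[OF w(1)] unfolding comp_def
    by (auto simp: hd_rev last_rev intro!: exI[of _ "rev w"])
qed

lemma comp_trans:
  assumes "q \<in> comp l h p" "r \<in> comp l h q" shows "r \<in> comp l h p"
proof -
  obtain w where w: "slab_walk l h w" "hd w = last p" "last w = last q" "hmt (p @ w) q"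
    and q: "walk q" "hd q = hd p"
    using assms(1) by (auto simp: comp_def)
  obtain w' where w': "slab_walk l h w'" "hd w' = last q" "last w' = last r" "hmt (q @ w') r"
    and r: "walk r" "hd r = hd q"
    using assms(2) by (auto simp: comp_def)
  have ne: "w \<noteq> []" "w' \<noteq> []" using w(1) w'(1) by (auto simp: slab_walk_def walk_def)
  have "hmt (p @ w @ w') r"
    using hmt_append[OF w(4) hmt_refl[of w']] w'(4) hmt_trans by fastforce
  then show ?thesis
    using slab_walk_append[OF w(1) w'(1)] w w' q r ne unfolding comp_def
    by (auto intro!: exI[of _ "w @ w'"])
qed

lemma comp_eq:
  assumes "walk p" "q \<in> comp l h p" shows "comp l h q = comp l h p"
  using comp_sym[OF assms] comp_trans assms(2) by blast

lemma comp_last: "q \<in> comp l h p \<Longrightarrow> walk q \<and> l < v (last q) \<and> v (last q) < h"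
  by (auto simp: comp_def slab_walk_def walk_def) (metis last_in_set)+

lemma comps_mem_eq:
  assumes "Z \<in> comps l h a" "q \<in> Z" shows "Z = comp l h q"
  using assms comp_eq unfolding comps_def by blast

lemma comps_memD:
  assumes "Z \<in> comps l h a" "q \<in> Z"
  shows "walk q" "hd q = a" "l < v (last q)" "v (last q) < h"
proof -
  obtain p where p: "Z = comp l h p" "hd p = a" using assms(1) by (auto simp: comps_def)
  then show "walk q" "l < v (last q)" "v (last q) < h" using comp_last assms(2) by blast+
  show "hd q = a" using p assms(2) by (simp add: comp_def)
qed

lemma comp_hmt:
  assumes "walk q" "l < v (last q)" "v (last q) < h" "hmt q q'" shows "q' \<in> comp l h q"
proof -
  have "slab_walk l h [last q]" using assms walk_last_in by (auto simp: slab_walk_def walk_single)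
  moreover have "hmt (q @ [last q]) q'" using hmt_dup_last assms hmt_trans by blast
  ultimately show ?thesis
    using assms hmt_walk[OF assms(4)] hmt_hd[OF assms(4)] hmt_last[OF assms(4)]
    unfolding comp_def by fastforce
qed

lemma comps_saturated: "Z \<in> comps l h a \<Longrightarrow> hmt q q' \<Longrightarrow> q \<in> Z \<longleftrightarrow> q' \<in> Z"
  by (metis comp_hmt comps_memD(1,3,4) comps_mem_eq hmt_sym)

lemma comp_snoc:
  assumes "walk (p @ [x])" "p \<noteq> []" "l < v (last p)" "v (last p) < h" "l < v x" "v x < h"
  shows "p @ [x] \<in> comp l h p"
proof -
  have p: "walk p" "R (last p) x" using walk_snocD assms by auto
  then have "slab_walk l h [last p, x]"
    using assms R_in R_sym by (auto simp: slab_walk_def walk_def)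
  moreover have "hmt (p @ [last p, x]) (p @ [x])"
    using hmt_append[OF hmt_dup_last[OF p(1)] hmt_refl[of "[x]"]] by simp
  ultimately show ?thesis using assms unfolding comp_def
    by (auto intro!: exI[of _ "[last p, x]"])
qed

lemma comps_snoc:
  assumes "Z \<in> comps l h a" "walk (p @ [x])" "p \<noteq> []" "l < v (last p)" "v (last p) < h" "l < v x" "v x < h"
  shows "p @ [x] \<in> Z \<longleftrightarrow> p \<in> Z"
proof -
  have "comp l h (p @ [x]) = comp l h p"
    using comp_snoc[OF assms(2-)] comp_eq assms(2,3) walk_snocD by blast
  then show ?thesis
    by (metis assms comps_mem_eq comp_self last_snoc walk_snocD)
qed

lemma crossing_single [simp]: "crossing Z m [x] = 0"
  by (simp add: crossing_def)

lemma crossing_snoc: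
  assumes "p \<noteq> []"
  shows "crossing Z m (p @ [x]) = crossing Z m p +
    (if p \<in> Z \<and> p @ [x] \<in> Z then above m x - above m (last p) else 0)"
proof -
  have "length p \<ge> 1" using assms by (cases p) auto
  then show ?thesis using assms
    by (auto simp: crossing_def nth_append last_conv_nth intro!: sum.cong)
qed

lemma above_ne_imp_near: "above m x \<noteq> above m y \<Longrightarrow> R x y \<Longrightarrow> \<bar>v x - m\<bar> < \<kappa>"
  using osc[of x y] by (auto simp: above_def split: if_splits)

text \<open>A triangle whose vertices are not all on one side of the level lies within
  \<open>\<kappa>\<close> of it, hence in the slab. Its lift is then entirely in \<open>Z\<close> or
  entirely outside, and the two short differences telescope to the long one.\<close>

lemma crossing_step:
  assumes Z: "Z \<in> comps l h a" and m: "l + \<kappa> \<le> m" "m + \<kappa> \<le> h"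
    and "step p q" and "walk p"
  shows "crossing Z m p = crossing Z m q"
  using assms(4,5)
proof (induction rule: step.induct)
  case (dup x xs ys)
  \<comment> \<open>Steps after the move contribute equally: corresponding prefixes are homotopic,
    and \<open>Z\<close> is saturated.\<close>
  from dup(2) show ?case
  proof (induction ys rule: rev_induct)
    case Nil
    have "crossing Z m ((xs @ [x]) @ [x]) = crossing Z m (xs @ [x])"
      by (subst crossing_snoc) auto
    then show ?case by simp
  next
    case (snoc y ys)
    have w: "walk (xs @ [x, x] @ ys)"
      using walk_snocD[of "xs @ [x, x] @ ys" y] snoc(2) by simp
    have "hmt (xs @ [x, x] @ zs) (xs @ [x] @ zs)" for zs
      using step.dup[of x xs] dup(1) step_imp_hmt by blast
    then have "xs @ [x, x] @ zs \<in> Z \<longleftrightarrow> xs @ [x] @ zs \<in> Z" for zs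
      using comps_saturated[OF Z] by blast
    then show ?case
      using snoc.IH[OF w] crossing_snoc[of "xs @ [x, x] @ ys" Z m y]
        crossing_snoc[of "xs @ [x] @ ys" Z m y] by simp
  qed
next
  case (tri x b c xs ys)
  from tri(4) show ?case
  proof (induction ys rule: rev_induct)
    case Nil
    define P where "P = xs @ [x]"
    have w: "walk (P @ [b] @ [c])" using Nil by (simp add: P_def)
    have wb: "walk (P @ [b])" using walk_snocD[of "P @ [b]" c] w by simp
    have wP: "walk P" using walk_snocD[OF wb] by (simp add: P_def)
    have wc: "walk (P @ [c])" using wP tri(3) by (intro walk_snoc) (auto simp: P_def)
    have "hmt (P @ [b, c]) (P @ [c])"
      using step.tri[OF tri(1-3), of xs "[]"] by (simp add: step_imp_hmt P_def)
    then have eq: "P @ [b, c] \<in> Z \<longleftrightarrow> P @ [c] \<in> Z" using comps_saturated[OF Z] by blast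
    have cb: "crossing Z m (P @ [b, c]) = crossing Z m P +
        (if P \<in> Z \<and> P @ [b] \<in> Z then above m b - above m x else 0) +
        (if P @ [b] \<in> Z \<and> P @ [b, c] \<in> Z then above m c - above m b else 0)"
      using crossing_snoc[of "P @ [b]" Z m c] crossing_snoc[of P Z m b] by (simp add: P_def)
    have cc: "crossing Z m (P @ [c]) = crossing Z m P +
        (if P \<in> Z \<and> P @ [c] \<in> Z then above m c - above m x else 0)"
      using crossing_snoc[of P Z m c] by (simp add: P_def)
    show ?case
    proof (cases "above m x = above m b \<and> above m b = above m c")
      case True
      then show ?thesis using cb cc by (simp add: P_def)
    next
      case False
      then have near: "\<bar>v x - m\<bar> < \<kappa>" "\<bar>v b - m\<bar> < \<kappa>" "\<bar>v c - m\<bar> < \<kappa>"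
        using tri(1-3) R_sym by (metis above_ne_imp_near)+
      have "P @ [b] \<in> Z \<longleftrightarrow> P \<in> Z" "P @ [c] \<in> Z \<longleftrightarrow> P \<in> Z"
        using comps_snoc[OF Z wb] comps_snoc[OF Z wc] near m by (auto simp: P_def)
      then show ?thesis using cb cc eq by (simp add: P_def)
    qed
  next
    case (snoc y ys)
    have w: "walk (xs @ [x, b, c] @ ys)"
      using walk_snocD[of "xs @ [x, b, c] @ ys" y] snoc(2) by simp
    have "hmt (xs @ [x, b, c] @ zs) (xs @ [x, c] @ zs)" for zs
      using step.tri[OF tri(1-3)] step_imp_hmt by blast
    then have "xs @ [x, b, c] @ zs \<in> Z \<longleftrightarrow> xs @ [x, c] @ zs \<in> Z" for zs
      using comps_saturated[OF Z] by blast
    then show ?case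
      using snoc.IH[OF w] crossing_snoc[of "xs @ [x, b, c] @ ys" Z m y]
        crossing_snoc[of "xs @ [x, c] @ ys" Z m y] by simp
  qed
qed

lemma crossing_hmt:
  assumes Z: "Z \<in> comps l h a" and m: "l + \<kappa> \<le> m" "m + \<kappa> \<le> h"
    and "hmt p q" and "walk p"
  shows "crossing Z m p = crossing Z m q"
proof -
  \<comment> \<open>\<open>crossing_step\<close> speaks of walks only, whereas
    \<open>hmt_invariant\<close> wants a function on all lists; so the invariant records the number
    under the premise of being a walk.\<close>
  have "(walk p, walk p \<longrightarrow> crossing Z m p = c) = (walk q, walk q \<longrightarrow> crossing Z m q = c)" for c
    using crossing_step[OF Z m] step_walk by (intro hmt_invariant[OF assms(4)]) auto
  then show ?thesis using assms(5) by auto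
qed

section \<open>Change of base point in the universal cover\<close>

lemma transport_comp:
  assumes "walk w" "walk p" "hd p = hd w" "l < v (last p)" "v (last p) < h"
  shows "transport w (comp l h p) = comp l h (rev w @ p)"
proof -
  have ne: "w \<noteq> []" "p \<noteq> []" using assms by (auto simp: walk_def)
  show ?thesis
  proof (intro set_eqI iffI)
    fix q assume "q \<in> transport w (comp l h p)"
    then obtain u where q: "walk q" "hd q = last w" and u: "slab_walk l h u" "hd u = last p"
      "last u = last (w @ q)" "hmt (p @ u) (w @ q)"
      by (auto simp: transport_def comp_def)
    have "hmt (rev w @ p @ u) (rev w @ w @ q)" using u(4) hmt_append hmt_refl by blast
    also have "hmt (rev w @ w @ q) q" using q assms by (intro hmt_cancel_left) auto
    finally show "q \<in> comp l h (rev w @ p)"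
      using q u ne by (auto simp: comp_def hd_rev walk_def)
  next
    fix q assume "q \<in> comp l h (rev w @ p)"
    then obtain u where q: "walk q" "hd q = last w" and u: "slab_walk l h u" "hd u = last p"
      "last u = last q" "hmt (rev w @ p @ u) q"
      using ne by (auto simp: comp_def hd_rev)
    have "hmt (p @ u) (w @ rev w @ p @ u)"
      using u assms ne by (intro hmt_sym[OF hmt_cancel_mid] walk_append) (auto simp: slab_walk_def)
    also have "hmt (w @ rev w @ p @ u) (w @ q)" using u(4) hmt_append hmt_refl by blast
    finally have "hmt (p @ u) (w @ q)" .
    then show "q \<in> transport w (comp l h p)"
      using q u ne assms walk_append by (auto simp: comp_def transport_def walk_def)
  qed
qed

lemma transport_comps:
  assumes "Z \<in> comps l h (hd w)" "walk w"
  shows "transport w Z \<in> comps l h (last w)"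
proof -
  obtain p where p: "walk p" "hd p = hd w" "l < v (last p)" "v (last p) < h" "Z = comp l h p"
    using assms by (auto simp: comps_def)
  have ne: "w \<noteq> []" "p \<noteq> []" using assms p by (auto simp: walk_def)
  then have "walk (rev w @ p)" using p assms walk_rev by (intro walk_append) (auto simp: last_rev)
  then show ?thesis using transport_comp p assms ne unfolding comps_def by (auto simp: hd_rev)
qed

lemma transport_transport:
  assumes "walk w" "walk w'" "last w = hd w'"
  shows "transport w' (transport w Z) = transport (w @ w') Z"
  using assms walk_append by (auto simp: transport_def walk_def)

lemma transport_hmt:
  assumes "Z \<in> comps l h a" "hmt w w'" shows "transport w Z = transport w' Z"
  using comps_saturated[OF assms(1)] hmt_append[OF assms(2) hmt_refl] hmt_last[OF assms(2)]
  by (auto simp: transport_def)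

lemma transport_single:
  assumes "Z \<in> comps l h a" shows "transport [a] Z = Z"
proof -
  have "[a] @ p \<in> Z \<longleftrightarrow> p \<in> Z" if "walk p" "hd p = a" for p
    using hmt_dup_hd[of p] comps_saturated[OF assms] that by auto
  then show ?thesis using comps_memD[OF assms] by (auto simp: transport_def)
qed

lemma transport_rev:
  assumes "Z \<in> comps l h (hd w)" "walk w"
  shows "transport (rev w) (transport w Z) = Z"
proof -
  have "w \<noteq> []" using assms by (auto simp: walk_def)
  then have "transport (rev w) (transport w Z) = transport (w @ rev w) Z"
    using assms walk_rev by (intro transport_transport) (auto simp: hd_rev)
  also have "\<dots> = transport [hd w] Z"
    using hmt_rev_right transport_hmt assms by blast
  finally show ?thesis using transport_single assms by simp
qed

text \<open>A prefix of \<open>p\<close> lies in \<open>transport w Z\<close> exactly when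
  \<open>w\<close> followed by it lies in \<open>Z\<close>. The joining step repeats a vertex, so it
  adds nothing.\<close>

lemma crossing_append:
  assumes "walk w" "walk p" "last w = hd p"
  shows "crossing Z m (w @ p) = crossing Z m w + crossing (transport w Z) m p"
  using assms(2,3)
proof (induction p rule: rev_induct)
  case (snoc x p)
  show ?case
  proof (cases "p = []")
    case True
    then show ?thesis using snoc assms crossing_snoc[of w Z m x] by (auto simp: walk_def)
  next
    case False
    then have p: "walk p" "last w = hd p" using snoc walk_snocD by auto
    have "p \<in> transport w Z \<longleftrightarrow> w @ p \<in> Z" "p @ [x] \<in> transport w Z \<longleftrightarrow> w @ p @ [x] \<in> Z"
      using p snoc by (auto simp: transport_def)
    then show ?thesis
      using snoc.IH[OF p] crossing_snoc[of "w @ p" Z m x] crossing_snoc[of p "transport w Z" m x] False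
      by simp
  qed
qed (simp add: walk_def)

text \<open>By \<open>crossing_append\<close> the two numbers add up to that of the null-homotopic
  walk \<open>w @ rev w\<close>.\<close>

lemma crossing_rev:
  assumes "Z \<in> comps l h (hd w)" "l + \<kappa> \<le> m" "m + \<kappa> \<le> h" "walk w"
  shows "crossing (transport w Z) m (rev w) = - crossing Z m w"
proof -
  have ne: "w \<noteq> []" using assms(4) by (simp add: walk_def)
  have "walk (w @ rev w)" using assms(4) walk_rev ne by (intro walk_append) (auto simp: hd_rev)
  then have "crossing Z m (w @ rev w) = 0"
    using crossing_hmt[OF assms(1-3) hmt_rev_right[OF assms(4)]] by simp
  then show ?thesis
    using crossing_append[of w "rev w" Z m] assms(4) walk_rev ne by (simp add: hd_rev)
qed

lemma crossing_nonzero_meets: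
  assumes "crossing Z m p \<noteq> 0" obtains i where "0 < i" "i < length p" "take i p \<in> Z"
proof -
  obtain i where "i \<in> {1..<length p}" "take i p \<in> Z"
    using assms unfolding crossing_def
    by (rule sum.not_neutral_contains_not_neutral) (auto split: if_splits)
  then show thesis using that[of i] by simp
qed

lemma finite_crossed_comps: "finite {Z \<in> comps l h a. crossing Z m p \<noteq> 0}"
proof (rule finite_subset)
  show "{Z \<in> comps l h a. crossing Z m p \<noteq> 0} \<subseteq> (\<lambda>i. comp l h (take i p)) ` {..<length p}"
  proof safe
    fix Z assume Z: "Z \<in> comps l h a" "crossing Z m p \<noteq> 0"
    obtain i where "i < length p" "take i p \<in> Z" using crossing_nonzero_meets[OF Z(2)] .
    moreover from this have "Z = comp l h (take i p)" using comps_mem_eq Z by blast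
    ultimately show "Z \<in> (\<lambda>i. comp l h (take i p)) ` {..<length p}" by blast
  qed
qed auto

text \<open>\<open>A\<close> is either the set of all walks or a component of a larger slab.\<close>

lemma crossing_sum_comps:
  assumes p: "walk p" "hd p = a" and m: "l + \<kappa> \<le> m" "m + \<kappa> \<le> h"
    and A: "\<And>q x. walk (q @ [x]) \<Longrightarrow> q \<noteq> [] \<Longrightarrow> l < v (last q) \<Longrightarrow> v (last q) < h \<Longrightarrow>
       l < v x \<Longrightarrow> v x < h \<Longrightarrow> q @ [x] \<in> A \<longleftrightarrow> q \<in> A"
    and sub: "\<And>q. q \<in> A \<Longrightarrow> walk q \<Longrightarrow> l < v (last q) \<Longrightarrow> v (last q) < h \<Longrightarrow> comp l h q \<subseteq> A"
  shows "crossing A m p =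
    (\<Sum>Z \<in> {Z \<in> comps l h a. Z \<subseteq> A \<and> crossing Z m p \<noteq> 0}. crossing Z m p)"
proof -
  define C where "C = {Z \<in> comps l h a. Z \<subseteq> A}"
  \<comment> \<open>The second part contains the component of every prefix whose component lies in
    \<open>A\<close>, even if its contributions cancel over the whole walk: after
    \<open>sum.swap\<close> the sums are compared step by step.\<close>
  define F where "F = {Z \<in> C. crossing Z m p \<noteq> 0} \<union>
    (\<lambda>i. comp l h (take i p)) ` {i. i < length p \<and> comp l h (take i p) \<in> C}"
  have finF: "finite F"
    unfolding F_def C_def
    by (auto intro: finite_subset[OF _ finite_crossed_comps[of l h a m p]])
  have FC: "F \<subseteq> C" by (auto simp: F_def)
  have "(\<Sum>Z \<in> {Z \<in> comps l h a. Z \<subseteq> A \<and> crossing Z m p \<noteq> 0}. crossing Z m p) = (\<Sum>Z\<in>F. crossing Z m p)"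
    using finF by (intro sum.mono_neutral_left) (auto simp: F_def C_def)
  also have "\<dots> = (\<Sum>i = 1..<length p. \<Sum>Z\<in>F.
      if take i p \<in> Z \<and> take (Suc i) p \<in> Z then above m (p ! i) - above m (p ! (i - 1)) else 0)"
    unfolding crossing_def by (rule sum.swap)
  also have "\<dots> = crossing A m p"
    unfolding crossing_def
  proof (rule sum.cong[OF refl])
    fix i assume "i \<in> {1..<length p}"
    then have i: "0 < i" "i < length p" by auto
    define q where "q = take i p"
    define x where "x = p ! i"
    define y where "y = p ! (i - 1)"
    have q: "walk q" "q \<noteq> []" "hd q = a" "last q = y"
      using p i walk_take by (auto simp: q_def y_def last_conv_nth walk_def hd_take)
    have qx: "take (Suc i) p = q @ [x]" using i by (simp add: q_def x_def take_Suc_conv_app_nth)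
    have wqx: "walk (q @ [x])" using walk_take[OF p(1), of "Suc i"] qx by simp
    show "(\<Sum>Z\<in>F. if take i p \<in> Z \<and> take (Suc i) p \<in> Z then above m (p ! i) - above m (p ! (i - 1)) else 0)
      = (if take i p \<in> A \<and> take (Suc i) p \<in> A then above m (p ! i) - above m (p ! (i - 1)) else 0)"
    proof (cases "above m x = above m y")
      case True
      then have "above m (p ! i) - above m (p ! (i - 1)) = 0" by (simp add: x_def y_def)
      then show ?thesis by (simp only: if_cancel sum.neutral_const)
    next
      case False
      have "R y x" using walk_snocD[OF wqx q(2)] q by simp
      then have near: "\<bar>v y - m\<bar> < \<kappa>" "\<bar>v x - m\<bar> < \<kappa>"
        using False above_ne_imp_near R_sym by metis+
      then have sl: "l < v y" "v y < h" "l < v x" "v x < h" using m by auto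
      let ?d = "above m x - above m y"
      have mem: "q @ [x] \<in> Z \<longleftrightarrow> q \<in> Z" if "Z \<in> F" for Z
        using comps_snoc[of Z l h a q x] that FC wqx q sl by (auto simp: C_def)
      have memA: "q @ [x] \<in> A \<longleftrightarrow> q \<in> A" using A[OF wqx q(2)] q sl by simp
      have qq: "q \<in> comp l h q" using comp_self q sl by simp
      have "(\<Sum>Z\<in>F. if q \<in> Z \<and> q @ [x] \<in> Z then ?d else 0) = (\<Sum>Z\<in>F. if q \<in> Z then ?d else 0)"
        by (rule sum.cong) (auto simp: mem)
      also have "\<dots> = (if q \<in> A then ?d else 0)"
      proof (cases "q \<in> A")
        case True
        then have "comp l h q \<in> C"
          using sub q sl by (auto simp: C_def comps_def)
        then have cF: "comp l h q \<in> F" using i by (auto simp: F_def q_def)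
        have "q \<in> Z \<longleftrightarrow> Z = comp l h q" if "Z \<in> F" for Z
          using that FC comps_mem_eq qq by (auto simp: C_def)
        then have "(\<Sum>Z\<in>F. if q \<in> Z then ?d else 0) = (\<Sum>Z\<in>F. if Z = comp l h q then ?d else 0)"
          by (intro sum.cong) auto
        then show ?thesis using cF finF True by simp
      next
        case False
        then have "q \<notin> Z" if "Z \<in> F" for Z using that FC by (auto simp: C_def)
        then show ?thesis using False by simp
      qed
      finally show ?thesis unfolding q_def[symmetric] qx x_def[symmetric] y_def[symmetric] memA by simp
    qed
  qed
  finally show ?thesis by simp
qed

lemma crossing_walks: "walk p \<Longrightarrow> crossing {q. walk q} m p = above m (last p) - above m (hd p)"
proof (induction p rule: rev_induct)
  case (snoc x p)
  show ?case
  proof (cases "p = []")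
    case False
    then show ?thesis using snoc walk_snocD[OF snoc.prems False] crossing_snoc[OF False, of "{q. walk q}" m x]
      by simp
  qed simp
qed (simp add: walk_def)

lemma crossing_sum_all:
  assumes "walk p" "hd p = a" "l + \<kappa> \<le> m" "m + \<kappa> \<le> h"
  shows "(\<Sum>Z \<in> {Z \<in> comps l h a. crossing Z m p \<noteq> 0}. crossing Z m p) = above m (last p) - above m (hd p)"
proof -
  have "Z \<subseteq> {q. walk q}" if "Z \<in> comps l h a" for Z using comps_memD that by blast
  then have "{Z \<in> comps l h a. Z \<subseteq> {q. walk q} \<and> crossing Z m p \<noteq> 0} = {Z \<in> comps l h a. crossing Z m p \<noteq> 0}"
    by blast
  moreover have "crossing {q. walk q} m p =
    (\<Sum>Z \<in> {Z \<in> comps l h a. Z \<subseteq> {q. walk q} \<and> crossing Z m p \<noteq> 0}. crossing Z m p)"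
  proof (rule crossing_sum_comps[OF assms])
    show "q @ [x] \<in> {q. walk q} \<longleftrightarrow> q \<in> {q. walk q}" if "walk (q @ [x])" "q \<noteq> []" for q x
      using walk_snocD that by blast
    show "comp l h q \<subseteq> {q. walk q}" for q using comp_last by blast
  qed
  ultimately show ?thesis using crossing_walks[OF assms(1)] by simp
qed

text \<open>The counts at two levels differ by the coboundary of \<open>D\<close>, which vanishes
  outside \<open>Z\<close>. A walk that starts and ends outside the slab therefore sees no
  difference.\<close>

lemma crossing_change_level:
  assumes Z: "Z \<in> comps l h a" and m: "l + \<kappa> \<le> m" "m + \<kappa> \<le> h" and m': "l + \<kappa> \<le> m'" "m' + \<kappa> \<le> h"
    and p: "walk p" "\<not> (l < v (hd p) \<and> v (hd p) < h)" "\<not> (l < v (last p) \<and> v (last p) < h)"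
  shows "crossing Z m p = crossing Z m' p"
proof -
  define D where "D q = (if q \<in> Z then above m (last q) - above m' (last q) else 0)" for q
  have *: "crossing Z m q - crossing Z m' q = D q - D [hd q]" if "walk q" for q
    using that
  proof (induction q rule: rev_induct)
    case (snoc x q)
    show ?case
    proof (cases "q = []")
      case False
      have q: "walk q" "R (last q) x" using walk_snocD[OF snoc.prems False] by auto
      have o: "\<bar>v (last q) - v x\<bar> < \<kappa>" using osc q(2) .
      have 1: "D q = 0" if "q @ [x] \<notin> Z"
      proof (cases "q \<in> Z")
        case True
        then have "\<not> (l < v x \<and> v x < h)"
          using comps_snoc[OF Z snoc.prems False] comps_memD[OF Z True] that by blast
        then show ?thesis using o m m' by (auto simp: D_def above_def)
      qed (simp add: D_def)
      have 2: "D (q @ [x]) = 0" if "q \<notin> Z"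
      proof (cases "q @ [x] \<in> Z")
        case True
        then have "\<not> (l < v (last q) \<and> v (last q) < h)"
          using comps_snoc[OF Z snoc.prems False] comps_memD[OF Z True] that by auto
        then show ?thesis using o m m' by (auto simp: D_def above_def)
      qed (simp add: D_def)
      have "hd (q @ [x]) = hd q" using False by simp
      then show ?thesis
        using snoc.IH[OF q(1)] crossing_snoc[OF False, of Z m x] crossing_snoc[OF False, of Z m' x] 1 2
        by (cases "q \<in> Z"; cases "q @ [x] \<in> Z") (auto simp: D_def)
    qed simp
  qed (simp add: walk_def)
  have "p \<notin> Z" "[hd p] \<notin> Z" using comps_memD[OF Z] p by fastforce+
  then show ?thesis using *[OF p(1)] by (simp add: D_def)
qed

end

section \<open>Integer cocycles from crossings\<close>

context height_complex
begin

lemma comp_mono: "l \<le> l' \<Longrightarrow> h' \<le> h \<Longrightarrow> comp l' h' q \<subseteq> comp l h q"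
  unfolding comp_def using slab_walk_mono by blast

lemma crossing_stable:
  assumes "0 < i" "i \<le> k" "k \<le> length p" "\<And>j. i < j \<Longrightarrow> j \<le> length p \<Longrightarrow> take j p \<notin> Z"
  shows "crossing Z m (take k p) = crossing Z m (take i p)"
  using assms(2,3)
proof (induction k rule: dec_induct)
  case (step k)
  have "take (Suc k) p = take k p @ [p ! k]" using step by (simp add: take_Suc_conv_app_nth)
  moreover have "take k p \<noteq> []" using step assms(1) by auto
  ultimately show ?case
    using step assms(4)[of "Suc k"] crossing_snoc[of "take k p" Z m "p ! k"] by auto
qed simp

lemma crossing_zero_before:
  assumes "n \<le> length p" "\<And>k. 0 < k \<Longrightarrow> k \<le> n \<Longrightarrow> take k p \<notin> Z"
  shows "crossing Z m (take n p) = 0"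
  by (rule ccontr) (use assms in \<open>auto elim!: crossing_nonzero_meets simp: min_def split: if_splits\<close>)

lemma crossing_avoid:
  assumes "Z \<in> comps l h a" "\<And>x. x \<in> set p \<Longrightarrow> \<not> (l < v x \<and> v x < h)"
  shows "crossing Z m p = 0"
proof (rule ccontr)
  assume "crossing Z m p \<noteq> 0"
  then obtain i where i: "0 < i" "i < length p" "take i p \<in> Z" by (rule crossing_nonzero_meets)
  then have "take i p \<noteq> []" by auto
  then have "last (take i p) \<in> set p" using last_in_set in_set_takeD by metis
  then show False using assms(2) comps_memD[OF assms(1) i(3)] by blast
qed

text \<open>Any two walks in \<open>Z1\<close> differ, up to homotopy, by a walk inside the slab of
  \<open>Z1\<close>, which is disjoint from that of \<open>Z\<close> and adds no crossing. So
  \<open>Z1\<close> lies as a whole on one side of the wall \<open>Z\<close>, and the crossing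
  number is a side function.\<close>

lemma crossing_constant_on_comp:
  assumes Z: "Z \<in> comps l h a" and m: "l + \<kappa> \<le> m" "m + \<kappa> \<le> h"
    and Z1: "Z1 \<in> comps l1 h1 a" and disj: "h \<le> l1 \<or> h1 \<le> l" and q: "q \<in> Z1" "q' \<in> Z1"
  shows "crossing Z m q = crossing Z m q'"
proof -
  have wq: "walk q" "hd q = a" using comps_memD[OF Z1 q(1)] by auto
  have "q' \<in> comp l1 h1 q" using comps_mem_eq[OF Z1 q(1)] q(2) by simp
  then obtain u where u: "slab_walk l1 h1 u" "hd u = last q" "hmt (q @ u) q'"
    by (auto simp: comp_def)
  have wu: "walk u" using u(1) by (simp add: slab_walk_def)
  have "transport q Z \<in> comps l h (last q)" using transport_comps[of Z l h q] Z wq by simp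
  then have "crossing (transport q Z) m u = 0"
    using u(1) disj by (intro crossing_avoid) (auto simp: slab_walk_def)
  then have "crossing Z m (q @ u) = crossing Z m q"
    using crossing_append[OF wq(1) wu] u(2) by simp
  moreover have "crossing Z m (q @ u) = crossing Z m q'"
    using crossing_hmt[OF Z m u(3)] walk_append[OF wq(1) wu] u(2) by simp
  ultimately show ?thesis by simp
qed

text \<open>View \<open>Z2\<close> as a wall. The walk \<open>p\<close> ends beyond it, whereas
  \<open>Z1\<close> lies on the starting side by \<open>near\<close>. After its last visit to
  \<open>Z2\<close> the walk stays beyond and cannot meet \<open>Z1\<close> again, so its crossings
  of \<open>Z'\<close> are already complete at that visit.\<close>

lemma crossing_after_far_comp:
  assumes Z1: "Z1 \<in> comps l1 h1 a" and Z2: "Z2 \<in> comps l2 h2 a" and m2: "l2 + \<kappa> \<le> m2" "m2 + \<kappa> \<le> h2"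
    and disj: "h1 \<le> l2 \<or> h2 \<le> l1"
    and sub: "Z' \<subseteq> Z1" and near: "q0 \<in> Z1" "crossing Z2 m2 q0 = 0"
    and p: "crossing Z2 m2 p \<noteq> 0"
  obtains z where "z \<in> Z2" "crossing Z' m' p = crossing Z' m' z"
proof -
  let ?I = "{i. 0 < i \<and> i \<le> length p \<and> take i p \<in> Z2}"
  have fin: "finite ?I" by (rule finite_subset[of _ "{..length p}"]) auto
  obtain i0 where "0 < i0" "i0 < length p" "take i0 p \<in> Z2" using p by (rule crossing_nonzero_meets)
  then have "i0 \<in> ?I" by simp
  then have ne: "?I \<noteq> {}" by blast
  define i where "i = Max ?I"
  have i: "0 < i" "i \<le> length p" "take i p \<in> Z2" using Max_in[OF fin ne] by (auto simp: i_def)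
  have after: "take j p \<notin> Z2" if "i < j" "j \<le> length p" for j
  proof
    assume "take j p \<in> Z2"
    then have "j \<in> ?I" using that by simp
    then have "j \<le> i" unfolding i_def by (rule Max_ge[OF fin])
    then show False using that(1) by simp
  qed
  have "take j p \<notin> Z'" if "i < j" "j \<le> length p" for j
  proof
    assume "take j p \<in> Z'"
    then have "take j p \<in> Z1" using sub by blast
    then have "crossing Z2 m2 (take j p) = 0"
      using crossing_constant_on_comp[OF Z2 m2 Z1 _ _ near(1)] disj near(2) by auto
    moreover have "crossing Z2 m2 (take j p) = crossing Z2 m2 (take (length p) p)"
      using crossing_stable[of i j p Z2 m2] crossing_stable[of i "length p" p Z2 m2] i after that by simp
    ultimately show False using p by simp
  qed
  then have "crossing Z' m' (take (length p) p) = crossing Z' m' (take i p)"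
    using i by (intro crossing_stable) auto
  then show thesis using that[of "take i p"] i by simp
qed

lemma crossing_same_beyond:
  assumes Z1: "Z1 \<in> comps l1 h1 a" and Z2: "Z2 \<in> comps l2 h2 a" and m2: "l2 + \<kappa> \<le> m2" "m2 + \<kappa> \<le> h2"
    and disj: "h1 \<le> l2 \<or> h2 \<le> l1"
    and Z': "Z' \<in> comps l' h' a" "Z' \<subseteq> Z1" "l1 \<le> l'" "h' \<le> h1" "l' + \<kappa> \<le> m'" "m' + \<kappa> \<le> h'"
    and near: "q0 \<in> Z1" "crossing Z2 m2 q0 = 0"
    and p: "crossing Z2 m2 p \<noteq> 0" "crossing Z2 m2 p' \<noteq> 0"
  shows "crossing Z' m' p = crossing Z' m' p'"
proof -
  obtain z where z: "z \<in> Z2" "crossing Z' m' p = crossing Z' m' z"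
    using crossing_after_far_comp[OF Z1 Z2 m2 disj Z'(2) near p(1)] by blast
  obtain z' where z': "z' \<in> Z2" "crossing Z' m' p' = crossing Z' m' z'"
    using crossing_after_far_comp[OF Z1 Z2 m2 disj Z'(2) near p(2)] by blast
  have "crossing Z' m' z = crossing Z' m' z'"
    using Z'(3,4) disj by (intro crossing_constant_on_comp[OF Z'(1,5,6) Z2 _ z(1) z'(1)]) auto
  then show ?thesis using z z' by simp
qed

text \<open>At the first visit to either component the walk has crossed neither, so the component
  just reached lies on the starting side of the other.\<close>

lemma first_hit:
  assumes Z1: "Z1 \<in> comps l1 h1 a" and Z2: "Z2 \<in> comps l2 h2 a" and disj: "h1 \<le> l2 \<or> h2 \<le> l1"
    and p: "crossing Z1 m1 p \<noteq> 0" "crossing Z2 m2 p \<noteq> 0"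
  shows "(\<exists>q\<in>Z1. crossing Z2 m2 q = 0) \<or> (\<exists>q\<in>Z2. crossing Z1 m1 q = 0)"
proof -
  let ?P = "\<lambda>i. 0 < i \<and> i \<le> length p \<and> take i p \<in> Z1 \<union> Z2"
  obtain i0 where "0 < i0" "i0 < length p" "take i0 p \<in> Z1" using p(1) by (rule crossing_nonzero_meets)
  then have ex: "?P i0" by auto
  define i where "i = (LEAST i. ?P i)"
  have i: "?P i" unfolding i_def using ex by (rule LeastI)
  have before: "take k p \<notin> Z1 \<union> Z2" if "0 < k" "k < i" for k
    using not_less_Least[of k ?P] that i unfolding i_def[symmetric] by auto
  have excl: "take i p \<notin> Z1 \<or> take i p \<notin> Z2"
    using comps_memD[OF Z1, of "take i p"] comps_memD[OF Z2, of "take i p"] disj by linarith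
  have zero: "crossing Z m (take i p) = 0" if "take i p \<notin> Z" "Z \<subseteq> Z1 \<union> Z2" for Z m
  proof (rule crossing_zero_before)
    show "i \<le> length p" using i by simp
    show "take k p \<notin> Z" if "0 < k" "k \<le> i" for k
      using before[of k] \<open>take i p \<notin> Z\<close> \<open>Z \<subseteq> Z1 \<union> Z2\<close> that by (cases "k = i") auto
  qed
  show ?thesis using i excl zero[of Z1 m1] zero[of Z2 m2] by blast
qed

end

text \<open>\<open>V\<close> with the edges \<open>E\<close> is the net, and \<open>w\<close>
  realises its edges by fine walks. \<open>w_refl\<close> and \<open>w_tri\<close> say that every
  triangle of the net, degenerate ones included, bounds in the fine complex.\<close>

locale coarse_complex = height_complex W R v \<kappa>
  for W :: "'p set" and R and v and \<kappa> +
  fixes V :: "'p set" and E :: "'p \<Rightarrow> 'p \<Rightarrow> bool" and w :: "'p \<Rightarrow> 'p \<Rightarrow> 'p list"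
    and Rt Lf :: "'p \<Rightarrow> bool"
  assumes finite_V: "finite V" and E_in: "E a b \<Longrightarrow> a \<in> V" and E_sym: "E a b \<Longrightarrow> E b a"
    and E_refl: "a \<in> V \<Longrightarrow> E a a"
    and w_walk: "E a b \<Longrightarrow> walk (w a b)" and w_hd: "E a b \<Longrightarrow> hd (w a b) = a"
    and w_last: "E a b \<Longrightarrow> last (w a b) = b"
    and w_refl: "a \<in> V \<Longrightarrow> hmt (w a a) [a]"
    and w_tri: "E a b \<Longrightarrow> E b d \<Longrightarrow> E a d \<Longrightarrow> hmt (w a b @ w b d) (w a d)"
    and \<kappa>_pos: "0 < \<kappa>"
begin

text \<open>The degenerate triangle \<open>a\<close>, \<open>b\<close>, \<open>a\<close> is an
  instance of \<open>w_tri\<close>.\<close>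

lemma w_rev: assumes "E a b" shows "hmt (w b a) (rev (w a b))"
proof -
  have ab: "walk (w a b)" "walk (w b a)" "hd (w b a) = b" "last (w a b) = b" "hd (w a b) = a"
    using assms E_sym w_walk w_hd w_last by auto
  have "hmt (w b a) (rev (w a b) @ w a b @ w b a)"
    using ab by (intro hmt_sym[OF hmt_cancel_left]) auto
  also have "hmt (rev (w a b) @ w a b @ w b a) (rev (w a b) @ [a])"
    using w_tri[OF assms E_sym[OF assms]] w_refl E_refl E_in[OF assms] hmt_trans hmt_append hmt_refl by meson
  also have "hmt (rev (w a b) @ [a]) (rev (w a b))"
    using hmt_dup_last[OF walk_rev[OF ab(1)]] ab walk_not_Nil[OF ab(1)] by (simp add: last_rev)
  finally show ?thesis .
qed

text \<open>Bottom and top layer of a slab of height 7 \<open>\<kappa>\<close>, each with its middle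
  level at distance \<open>\<kappa>\<close> from its boundary. The gap of height 3
  \<open>\<kappa>\<close> still leaves \<open>\<kappa>\<close> between the two sides of the final
  square after each has moved by less than \<open>\<kappa>\<close>.\<close>

definition subslab :: "real \<Rightarrow> real \<Rightarrow> real \<Rightarrow> real \<Rightarrow> bool" where
  "subslab c l h m \<longleftrightarrow> (l = c \<and> h = c + 2 * \<kappa> \<and> m = c + \<kappa>) \<or>
     (l = c + 5 * \<kappa> \<and> h = c + 7 * \<kappa> \<and> m = c + 6 * \<kappa>)"

abbreviation "slabs c a \<equiv> comps c (c + 7 * \<kappa>) a"
abbreviation "cross c Z p \<equiv> crossing Z (c + 3 * \<kappa>) p"

lemma subslabD:
  assumes "subslab c l h m"
  shows "c \<le> l" "h \<le> c + 7 * \<kappa>" "l + \<kappa> \<le> m" "m + \<kappa> \<le> h" "c + \<kappa> \<le> m" "m + \<kappa> \<le> c + 7 * \<kappa>"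
  using assms \<kappa>_pos by (auto simp: subslab_def)

lemma level_in_slab: "c + \<kappa> \<le> c + 3 * \<kappa>" "c + 3 * \<kappa> + \<kappa> \<le> c + 7 * \<kappa>"
  using \<kappa>_pos by auto

text \<open>Branching at \<open>a\<close>: two edges cross the same component \<open>Z\<close> of
  the slab, but only one of them crosses the thin component \<open>Z'\<close> inside it.\<close>

definition bad :: "real \<Rightarrow> 'p \<Rightarrow> 'p \<Rightarrow> 'p \<Rightarrow> bool" where
  "bad c a b b' \<longleftrightarrow> (\<exists>Z\<in>slabs c a. cross c Z (w a b) \<noteq> 0 \<and> cross c Z (w a b') \<noteq> 0 \<and>
     (\<exists>l h m. subslab c l h m \<and> (\<exists>Z'\<in>comps l h a. Z' \<subseteq> Z \<and>
        crossing Z' m (w a b) \<noteq> 0 \<and> crossing Z' m (w a b') = 0)))"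

text \<open>By \<open>first_hit\<close> one of the two slab components lies on the near side of the
  other. Both edges cross the farther one, so by \<open>crossing_same_beyond\<close> they cross each
  thin component inside the nearer one equally, contrary to branching there.\<close>

lemma bad_unique:
  assumes "bad c a b b'" "bad d a b b'" shows "\<not> (c + 7 * \<kappa> \<le> d \<or> d + 7 * \<kappa> \<le> c)"
proof
  assume disj: "c + 7 * \<kappa> \<le> d \<or> d + 7 * \<kappa> \<le> c"
  obtain Z l h m Z' where Z: "Z \<in> slabs c a" "cross c Z (w a b) \<noteq> 0" "cross c Z (w a b') \<noteq> 0"
    "subslab c l h m" "Z' \<in> comps l h a" "Z' \<subseteq> Z" "crossing Z' m (w a b) \<noteq> 0" "crossing Z' m (w a b') = 0"
    using assms(1) by (auto simp: bad_def)
  obtain Y l1 h1 m1 Y' where Y: "Y \<in> slabs d a" "cross d Y (w a b) \<noteq> 0" "cross d Y (w a b') \<noteq> 0"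
    "subslab d l1 h1 m1" "Y' \<in> comps l1 h1 a" "Y' \<subseteq> Y" "crossing Y' m1 (w a b) \<noteq> 0" "crossing Y' m1 (w a b') = 0"
    using assms(2) by (auto simp: bad_def)
  consider q where "q \<in> Z" "cross d Y q = 0" | q where "q \<in> Y" "cross c Z q = 0"
    using first_hit[OF Z(1) Y(1) _ Z(2) Y(2)] disj by blast
  then show False
  proof cases
    case 1
    show ?thesis
      using crossing_same_beyond[OF Z(1) Y(1) level_in_slab _ Z(5,6) subslabD(1-4)[OF Z(4)] 1 Y(2,3)] disj Z(7,8)
      by auto
  next
    case 2
    show ?thesis
      using crossing_same_beyond[OF Y(1) Z(1) level_in_slab _ Y(5,6) subslabD(1-4)[OF Y(4)] 2 Z(2,3)] disj Y(7,8)
      by auto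
  qed
qed

definition good :: "real \<Rightarrow> bool" where
  "good c \<longleftrightarrow> (\<forall>a\<in>V. \<not> (c < v a \<and> v a < c + 7 * \<kappa>)) \<and> (\<forall>a\<in>V. \<forall>b\<in>V. \<forall>b'\<in>V. \<not> bad c a b b')"

text \<open>Pigeonhole over disjoint slabs stacked upwards from \<open>- e\<close>: each point of
  \<open>V\<close> lies in at most one of them, and each triple branches in at most one. So at most
  \<open>card V ^ 3 + card V\<close> slabs are spoilt, and one more suffices.\<close>

lemma good_exists:
  assumes e: "7 * \<kappa> * real (card V ^ 3 + card V + 1) \<le> 2 * e"
  obtains c where "good c" "- e \<le> c" "c + 7 * \<kappa> \<le> e"
proof -
  let ?N = "card V ^ 3 + card V + 1"
  define c where "c i = - e + 7 * \<kappa> * real i" for i :: nat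
  have disj: "c i + 7 * \<kappa> \<le> c j" if "i < j" for i j
  proof -
    have "real i + 1 \<le> real j" using that by linarith
    then have "7 * \<kappa> * (real i + 1) \<le> 7 * \<kappa> * real j" using \<kappa>_pos by (intro mult_left_mono) auto
    then show ?thesis by (simp add: c_def algebra_simps)
  qed
  define B1 where "B1 a = {i. c i < v a \<and> v a < c i + 7 * \<kappa>}" for a
  define B2 where "B2 = (\<lambda>(a, b, b'). {i. bad (c i) a b b'})"
  have one: "card (S :: nat set) \<le> 1" if "\<And>i j. i \<in> S \<Longrightarrow> j \<in> S \<Longrightarrow> i < j \<Longrightarrow> False" for S
    using that by (metis card.infinite card_le_Suc0_iff_eq One_nat_def linorder_neqE_nat zero_le)
  have fin: "finite (S :: nat set)" if "\<And>i j. i \<in> S \<Longrightarrow> j \<in> S \<Longrightarrow> i < j \<Longrightarrow> False" for S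
    using that by (metis finite_subset finite.emptyI finite_insert insertI1 linorder_neqE_nat subsetI)
  have B1: "False" if "i \<in> B1 a" "j \<in> B1 a" "i < j" for a i j
    using disj[OF that(3)] that by (auto simp: B1_def)
  have B2: "False" if "i \<in> B2 t" "j \<in> B2 t" "i < j" for t i j
    using disj[OF that(3)] that bad_unique by (auto simp: B2_def split: prod.splits)
  let ?B = "(\<Union>a\<in>V. B1 a) \<union> (\<Union>t\<in>V \<times> V \<times> V. B2 t)"
  have "card ?B \<le> card (\<Union>a\<in>V. B1 a) + card (\<Union>t\<in>V \<times> V \<times> V. B2 t)" by (rule card_Un_le)
  also have "card (\<Union>a\<in>V. B1 a) \<le> (\<Sum>a\<in>V. card (B1 a))" using finite_V by (rule card_UN_le)
  also have "\<dots> \<le> (\<Sum>a\<in>V. 1)" by (intro sum_mono one) (use B1 in blast)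
  also have "card (\<Union>t\<in>V \<times> V \<times> V. B2 t) \<le> (\<Sum>t\<in>V \<times> V \<times> V. card (B2 t))"
    using finite_V by (intro card_UN_le) auto
  also have "\<dots> \<le> (\<Sum>t\<in>V \<times> V \<times> V. 1)" by (intro sum_mono one) (use B2 in blast)
  finally have "card ?B < card {..<?N}" by (simp add: card_cartesian_product power3_eq_cube)
  moreover have "finite ?B" using finite_V fin B1 B2 by (intro finite_UnI finite_UN_I finite_cartesian_product) blast+
  ultimately have "\<not> {..<?N} \<subseteq> ?B" using card_mono leD by blast
  then obtain i where i: "i < ?N" "i \<notin> ?B" by blast
  show thesis
  proof
    show "good (c i)" using i(2) by (auto simp: good_def B1_def B2_def)
    show "- e \<le> c i" using \<kappa>_pos by (simp add: c_def)
    have "real i + 1 \<le> real ?N" using i(1) by linarith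
    then have "7 * \<kappa> * (real i + 1) \<le> 7 * \<kappa> * real ?N" using \<kappa>_pos by (intro mult_left_mono) auto
    then show "c i + 7 * \<kappa> \<le> e" using e by (simp add: c_def algebra_simps)
  qed
qed

text \<open>Both ends of the edge avoid a good slab, so the level can be moved to \<open>m\<close>
  without changing the crossing number; there it is a sum over thin components, one of which must
  contribute.\<close>

lemma subslab_crossed:
  assumes "good c" "E a b" and Z: "Z \<in> slabs c a" "cross c Z (w a b) \<noteq> 0" and s: "subslab c l h m"
  obtains Z' where "Z' \<in> comps l h a" "Z' \<subseteq> Z" "crossing Z' m (w a b) \<noteq> 0"
proof -
  note sD = subslabD[OF s]
  have ab: "walk (w a b)" "hd (w a b) = a" "last (w a b) = b" using assms w_walk w_hd w_last by auto
  have "a \<in> V" "b \<in> V" using assms E_in E_sym by blast+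
  then have out: "\<not> (c < v (hd (w a b)) \<and> v (hd (w a b)) < c + 7 * \<kappa>)"
    "\<not> (c < v (last (w a b)) \<and> v (last (w a b)) < c + 7 * \<kappa>)"
    using assms(1) ab by (auto simp: good_def)
  have "crossing Z m (w a b) \<noteq> 0"
    using crossing_change_level[OF Z(1) level_in_slab sD(5,6) ab(1) out] Z(2) by simp
  moreover have "crossing Z m (w a b) =
    (\<Sum>Z' \<in> {Z' \<in> comps l h a. Z' \<subseteq> Z \<and> crossing Z' m (w a b) \<noteq> 0}. crossing Z' m (w a b))"
  proof (rule crossing_sum_comps[OF ab(1,2) sD(3,4)])
    show "q @ [x] \<in> Z \<longleftrightarrow> q \<in> Z" if "walk (q @ [x])" "q \<noteq> []" "l < v (last q)" "v (last q) < h" "l < v x" "v x < h" for q x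
      using that sD(1,2) by (intro comps_snoc[OF Z(1)]) auto
    show "comp l h q \<subseteq> Z" if "q \<in> Z" for q
      using comp_mono[OF sD(1,2)] comps_mem_eq[OF Z(1) that] by blast
  qed
  ultimately have "{Z' \<in> comps l h a. Z' \<subseteq> Z \<and> crossing Z' m (w a b) \<noteq> 0} \<noteq> {}" by (metis sum.empty)
  then show thesis using that by blast
qed

text \<open>The linking relation, on pairs of an edge and a component that it crosses.
  \<open>turn\<close> passes along a triangle of the net to another edge at \<open>a\<close>,
  \<open>flip\<close> takes the other end of the edge as base point. Both are reversible, so linked
  pairs are reached together or not at all.\<close>

inductive reach :: "real \<Rightarrow> 'p \<Rightarrow> 'p \<Rightarrow> 'p list set \<Rightarrow> bool" for c where
  start: "E a b \<Longrightarrow> Rt a \<Longrightarrow> Rt b \<Longrightarrow> Z \<in> slabs c a \<Longrightarrow> cross c Z (w a b) \<noteq> 0 \<Longrightarrow> reach c a b Z"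
| turn: "reach c a b Z \<Longrightarrow> E b b' \<Longrightarrow> E a b' \<Longrightarrow> cross c Z (w a b') \<noteq> 0 \<Longrightarrow> reach c a b' Z"
| flip: "reach c a b Z \<Longrightarrow> reach c b a (transport (w a b) Z)"

lemma transport_w_comps: "E a b \<Longrightarrow> Z \<in> comps l h a \<Longrightarrow> transport (w a b) Z \<in> comps l h b"
  using transport_comps[of Z l h "w a b"] w_walk w_hd w_last by simp

lemma transport_w_back: "E a b \<Longrightarrow> Z \<in> comps l h a \<Longrightarrow> transport (w b a) (transport (w a b) Z) = Z"
  using transport_hmt[OF transport_w_comps w_rev, of a b Z l h a b] transport_rev[of Z l h "w a b"] w_walk w_hd
  by simp

lemma crossing_w_back:
  assumes "E a b" "Z \<in> comps l h a" "l + \<kappa> \<le> m" "m + \<kappa> \<le> h"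
  shows "crossing (transport (w a b) Z) m (w b a) = - crossing Z m (w a b)"
  using crossing_hmt[OF transport_w_comps[OF assms(1,2)] assms(3,4) w_rev[OF assms(1)]]
    crossing_rev[of Z l h "w a b" m] assms w_walk w_hd E_sym by simp

lemma crossing_w_tri:
  assumes "E a b" "E b d" "E a d" "Z \<in> comps l h a" "l + \<kappa> \<le> m" "m + \<kappa> \<le> h"
  shows "crossing Z m (w a b) + crossing (transport (w a b) Z) m (w b d) = crossing Z m (w a d)"
proof -
  have "walk (w a b)" "walk (w b d)" "last (w a b) = hd (w b d)"
    using assms w_walk w_hd w_last by auto
  then show ?thesis
    using crossing_append[of "w a b" "w b d" Z m] crossing_hmt[OF assms(4-6) w_tri[OF assms(1-3)]] walk_append
    by simp
qed

lemma transport_w_tri: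
  assumes "E a b" "E b d" "E a d" "Z \<in> comps l h a"
  shows "transport (w b d) (transport (w a b) Z) = transport (w a d) Z"
  using transport_transport[of "w a b" "w b d" Z] transport_hmt[OF assms(4) w_tri[OF assms(1-3)]]
    assms w_walk w_hd w_last by simp

lemma reachD:
  assumes "reach c a b Z" shows "E a b" "Z \<in> slabs c a" "cross c Z (w a b) \<noteq> 0"
proof -
  have "E a b \<and> Z \<in> slabs c a \<and> cross c Z (w a b) \<noteq> 0"
    using assms
  proof (induction rule: reach.induct)
    case (flip a b Z)
    then show ?case
      using E_sym transport_w_comps[of a b Z] crossing_w_back[of a b Z c "c + 7 * \<kappa>" "c + 3 * \<kappa>"]
        level_in_slab[of c] by simp
  qed auto
  then show "E a b" "Z \<in> slabs c a" "cross c Z (w a b) \<noteq> 0" by auto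
qed

lemma reach_flip_iff:
  assumes "E a b" "Z \<in> slabs c a" shows "reach c b a (transport (w a b) Z) \<longleftrightarrow> reach c a b Z"
  using reach.flip transport_w_back[OF assms] by metis

lemma reach_turn_iff:
  assumes "E a b" "E b b'" "E a b'" "cross c Z (w a b) \<noteq> 0" "cross c Z (w a b') \<noteq> 0"
  shows "reach c a b Z \<longleftrightarrow> reach c a b' Z"
  using reach.turn assms E_sym by metis

text \<open>In a good slab, everything reached from a right edge is crossed together with a fixed lower and a
  fixed upper component at that right edge, carried along by the walk \<open>P\<close>.\<close>

definition carried :: "real \<Rightarrow> real \<Rightarrow> real \<Rightarrow> 'p \<Rightarrow> 'p list \<Rightarrow> 'p list set \<Rightarrow> 'p \<Rightarrow> 'p \<Rightarrow> 'p list set \<Rightarrow> bool" where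
  "carried l h m a0 P Y a b Z \<longleftrightarrow> Y \<in> comps l h a0 \<and> transport P Y \<subseteq> Z \<and> crossing (transport P Y) m (w a b) \<noteq> 0"

text \<open>Losing the thin component in the passage from \<open>b\<close> to \<open>b'\<close> is
  exactly what \<open>bad c a b b'\<close> describes.\<close>

lemma carried_turn:
  assumes "good c" "subslab c l h m" "carried l h m a0 P Y a b Z" "walk P" "hd P = a0" "last P = a"
    "E a b" "E a b'" "Z \<in> slabs c a" "cross c Z (w a b) \<noteq> 0" "cross c Z (w a b') \<noteq> 0"
  shows "carried l h m a0 P Y a b' Z"
proof -
  have "transport P Y \<in> comps l h a"
    using transport_comps[of Y l h P] assms by (auto simp: carried_def)
  moreover have "\<not> bad c a b b'" using assms E_in E_sym by (metis good_def)
  ultimately show ?thesis using assms unfolding bad_def carried_def by blast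
qed

lemma carried_flip:
  assumes "subslab c l h m" "carried l h m a0 P Y a b Z" "walk P" "hd P = a0" "last P = a" "E a b"
  shows "carried l h m a0 (P @ w a b) Y b a (transport (w a b) Z)"
proof -
  have T: "transport P Y \<in> comps l h a"
    using transport_comps[of Y l h P] assms by (auto simp: carried_def)
  have eq: "transport (P @ w a b) Y = transport (w a b) (transport P Y)"
    using transport_transport[of P "w a b" Y] assms w_walk w_hd by simp
  have "transport (w a b) (transport P Y) \<subseteq> transport (w a b) Z"
    using assms(2) by (auto simp: carried_def transport_def)
  then show ?thesis
    using assms(2) crossing_w_back[OF assms(6) T subslabD(3,4)[OF assms(1)]] unfolding carried_def eq by simp
qed

text \<open>The lower and the upper thin component are chosen at the same right edge and carried
  along the linking chain by one and the same \<open>P\<close>, so that \<open>P\<close> cancels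
  when the rectangle is closed.\<close>

lemma reach_carried:
  assumes "good c" "reach c a b Z" and s: "subslab c l1 h1 m1" "subslab c l2 h2 m2"
  shows "\<exists>a0 b0 P Y1 Y2. E a0 b0 \<and> Rt a0 \<and> Rt b0 \<and> walk P \<and> hd P = a0 \<and> last P = a \<and>
    carried l1 h1 m1 a0 P Y1 a b Z \<and> carried l2 h2 m2 a0 P Y2 a b Z \<and>
    crossing Y1 m1 (w a0 b0) \<noteq> 0 \<and> crossing Y2 m2 (w a0 b0) \<noteq> 0"
  using assms(2)
proof (induction rule: reach.induct)
  case (start a b Z)
  obtain Y1 where Y1: "Y1 \<in> comps l1 h1 a" "Y1 \<subseteq> Z" "crossing Y1 m1 (w a b) \<noteq> 0"
    using subslab_crossed[OF assms(1) start(1,4,5) s(1)] .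
  obtain Y2 where Y2: "Y2 \<in> comps l2 h2 a" "Y2 \<subseteq> Z" "crossing Y2 m2 (w a b) \<noteq> 0"
    using subslab_crossed[OF assms(1) start(1,4,5) s(2)] .
  have "a \<in> W" using w_walk[OF start(1)] w_hd[OF start(1)] walk_hd_in by metis
  then show ?case
    using start Y1 Y2 transport_single[OF Y1(1)] transport_single[OF Y2(1)]
    by (intro exI[of _ a] exI[of _ b] exI[of _ "[a]"] exI[of _ Y1] exI[of _ Y2])
      (simp add: walk_single carried_def)
next
  case (turn a b Z b')
  then show ?case
    using carried_turn[OF assms(1) s(1)] carried_turn[OF assms(1) s(2)] reachD[OF turn(1)] by metis
next
  case (flip a b Z)
  note r = reachD[OF flip(1)]
  obtain a0 b0 P Y1 Y2 where o: "E a0 b0" "Rt a0" "Rt b0" "walk P" "hd P = a0" "last P = a"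
    "carried l1 h1 m1 a0 P Y1 a b Z" "carried l2 h2 m2 a0 P Y2 a b Z"
    "crossing Y1 m1 (w a0 b0) \<noteq> 0" "crossing Y2 m2 (w a0 b0) \<noteq> 0"
    using flip.IH by blast
  have wab: "walk (w a b)" "hd (w a b) = a" "last (w a b) = b" "w a b \<noteq> []" "P \<noteq> []"
    using r(1) w_walk w_hd w_last walk_not_Nil o(4) by auto
  have "walk (P @ w a b)" "hd (P @ w a b) = a0" "last (P @ w a b) = b"
    using wab o by (auto intro: walk_append)
  then show ?case
    using o carried_flip[OF s(1) o(7) o(4-6) r(1)] carried_flip[OF s(2) o(8) o(4-6) r(1)] by blast
qed

section \<open>Rectangles joining a right edge to a left edge\<close>

definition rectangle :: "real \<Rightarrow> bool" where
  "rectangle c \<longleftrightarrow> (\<exists>a b a' b' S P Q T. E a b \<and> Rt a \<and> Rt b \<and> E a' b' \<and> Lf a' \<and> Lf b' \<and>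
     slab_walk c (c + 2 * \<kappa>) S \<and> slab_walk (c + 5 * \<kappa>) (c + 7 * \<kappa>) T \<and> walk P \<and> walk Q \<and>
     set P \<subseteq> set (w a b) \<and> set Q \<subseteq> set (w a' b') \<and>
     hd S = hd P \<and> last S = hd Q \<and> last P = hd T \<and> last Q = last T \<and> hmt (S @ Q) (P @ T))"

text \<open>A thin component met by both edges supplies a walk within its layer from the right edge
  to the left one: \<open>S\<close> for the lower component, \<open>T\<close> for the upper. Both
  come with a homotopy through the same \<open>P\<close>, which cancels and leaves a rectangle whose
  other two sides lie on the edges.\<close>

lemma reach_left_imp_rectangle:
  assumes "good c" "reach c a b Z" "Lf a" "Lf b" shows "rectangle c"
proof -
  have s: "subslab c c (c + 2 * \<kappa>) (c + \<kappa>)" "subslab c (c + 5 * \<kappa>) (c + 7 * \<kappa>) (c + 6 * \<kappa>)"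
    by (auto simp: subslab_def)
  obtain a0 b0 P Y1 Y2 where o: "E a0 b0" "Rt a0" "Rt b0" "walk P" "hd P = a0" "last P = a"
    and Y1: "Y1 \<in> comps c (c + 2 * \<kappa>) a0" "crossing (transport P Y1) (c + \<kappa>) (w a b) \<noteq> 0"
      "crossing Y1 (c + \<kappa>) (w a0 b0) \<noteq> 0"
    and Y2: "Y2 \<in> comps (c + 5 * \<kappa>) (c + 7 * \<kappa>) a0" "crossing (transport P Y2) (c + 6 * \<kappa>) (w a b) \<noteq> 0"
      "crossing Y2 (c + 6 * \<kappa>) (w a0 b0) \<noteq> 0"
    using reach_carried[OF assms(1,2) s] unfolding carried_def by blast
  have Eab: "E a b" using reachD[OF assms(2)] by simp
  obtain i1 where i1: "0 < i1" "take i1 (w a0 b0) \<in> Y1" using Y1(3) by (rule crossing_nonzero_meets)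
  obtain i2 where i2: "0 < i2" "take i2 (w a0 b0) \<in> Y2" using Y2(3) by (rule crossing_nonzero_meets)
  obtain j1 where j1: "0 < j1" "take j1 (w a b) \<in> transport P Y1" using Y1(2) by (rule crossing_nonzero_meets)
  obtain j2 where j2: "0 < j2" "take j2 (w a b) \<in> transport P Y2" using Y2(2) by (rule crossing_nonzero_meets)
  define p1 where "p1 = take i1 (w a0 b0)"
  define p2 where "p2 = take i2 (w a0 b0)"
  define q1 where "q1 = take j1 (w a b)"
  define q2 where "q2 = take j2 (w a b)"
  have pw: "walk p1" "walk p2" "hd p1 = a0" "hd p2 = a0" "p1 \<noteq> []" "p2 \<noteq> []"
    using w_walk[OF o(1)] w_hd[OF o(1)] i1(1) i2(1) walk_take walk_not_Nil
    by (auto simp: p1_def p2_def hd_take)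
  have qw: "walk q1" "walk q2" "hd q1 = a" "hd q2 = a" "q1 \<noteq> []" "q2 \<noteq> []"
    using w_walk[OF Eab] w_hd[OF Eab] j1(1) j2(1) walk_take walk_not_Nil
    by (auto simp: q1_def q2_def hd_take)
  have "P @ q1 \<in> comp c (c + 2 * \<kappa>) p1"
    using comps_mem_eq[OF Y1(1) i1(2)] j1(2) by (simp add: p1_def q1_def transport_def)
  then obtain S where S: "slab_walk c (c + 2 * \<kappa>) S" "hd S = last p1" "last S = last q1" "hmt (p1 @ S) (P @ q1)"
    using qw(5) by (auto simp: comp_def)
  have "P @ q2 \<in> comp (c + 5 * \<kappa>) (c + 7 * \<kappa>) p2"
    using comps_mem_eq[OF Y2(1) i2(2)] j2(2) by (simp add: p2_def q2_def transport_def)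
  then obtain T where T: "slab_walk (c + 5 * \<kappa>) (c + 7 * \<kappa>) T" "hd T = last p2" "last T = last q2"
    "hmt (p2 @ T) (P @ q2)"
    using qw(6) by (auto simp: comp_def)
  have wST: "walk S" "walk T" using S(1) T(1) by (auto simp: slab_walk_def)
  \<comment> \<open>From the point on the lower component back to the start of the right edge and
    out to the point on the upper one; this stays on the edge whatever the order of the two
    points.\<close>
  define A where "A = rev p1 @ p2"
  define B where "B = rev q1 @ q2"
  have "walk A" "walk B"
    unfolding A_def B_def using pw qw by (auto intro!: walk_append walk_rev simp: last_rev)
  have "hmt S (rev p1 @ p1 @ S)" using pw wST S by (intro hmt_sym[OF hmt_cancel_left]) auto
  also have "hmt (rev p1 @ p1 @ S) (rev p1 @ P @ q1)" using S(4) hmt_append hmt_refl by blast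
  finally have "hmt (S @ B) ((rev p1 @ P) @ (q1 @ rev q1 @ q2))"
    using hmt_append[of S "rev p1 @ P @ q1" B B] by (simp add: B_def)
  also have "hmt ((rev p1 @ P) @ (q1 @ rev q1 @ q2)) ((rev p1 @ P) @ q2)"
    using qw by (intro hmt_append hmt_refl hmt_cancel_mid) auto
  also have "hmt ((rev p1 @ P) @ q2) (rev p1 @ p2 @ T)"
    using hmt_append[OF hmt_refl[of "rev p1"] hmt_sym[OF T(4)]] by simp
  finally have main: "hmt (S @ B) (A @ T)" by (simp add: A_def)
  have "set A \<subseteq> set (w a0 b0)" "set B \<subseteq> set (w a b)"
    unfolding A_def B_def p1_def p2_def q1_def q2_def by (auto dest: in_set_takeD)
  moreover have "hd S = hd A" "last S = hd B" "last A = hd T" "last B = last T"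
    using S T pw qw by (auto simp: A_def B_def hd_rev)
  ultimately show ?thesis
    unfolding rectangle_def using o Eab assms S(1) T(1) \<open>walk A\<close> \<open>walk B\<close> main by blast
qed

section \<open>The cocycle of reached crossings\<close>

definition flow :: "real \<Rightarrow> 'p \<Rightarrow> 'p \<Rightarrow> int" where
  "flow c a b = (\<Sum>Z \<in> {Z \<in> slabs c a. cross c Z (w a b) \<noteq> 0}. if reach c a b Z then cross c Z (w a b) else 0)"

lemma flow_superset:
  assumes "finite F" "F \<subseteq> slabs c a" "{Z \<in> slabs c a. cross c Z (w a b) \<noteq> 0} \<subseteq> F"
  shows "flow c a b = (\<Sum>Z\<in>F. if reach c a b Z then cross c Z (w a b) else 0)"
  unfolding flow_def using assms by (intro sum.mono_neutral_left) auto

text \<open>The three sums are moved to the base point \<open>a\<close> and compared component by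
  component. There the crossing numbers obey the triangle relation, and any two edges with nonzero
  numbers are linked, so they are kept or dropped together.\<close>

lemma flow_additive:
  assumes E: "E a b" "E b d" "E a d" shows "flow c a b + flow c b d = flow c a d"
proof -
  let ?T = "transport (w a b)"
  \<comment> \<open>Every component that contributes to one of the three sums, those seen from
    \<open>b\<close> being carried back to \<open>a\<close>.\<close>
  define F where "F = {Z \<in> slabs c a. cross c Z (w a b) \<noteq> 0} \<union> {Z \<in> slabs c a. cross c Z (w a d) \<noteq> 0}
    \<union> transport (w b a) ` {Z \<in> slabs c b. cross c Z (w b d) \<noteq> 0}"
  have F: "finite F" "F \<subseteq> slabs c a"
    using finite_crossed_comps transport_w_comps[OF E_sym[OF E(1)]] by (auto simp: F_def)
  have inj: "inj_on ?T F"
    using F(2) transport_w_back[OF E(1)] by (metis inj_on_def subsetD)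
  have "flow c b d = (\<Sum>Z\<in>?T ` F. if reach c b d Z then cross c Z (w b d) else 0)"
  proof (rule flow_superset)
    show "?T ` F \<subseteq> slabs c b" using F(2) transport_w_comps[OF E(1)] by blast
    show "{Z \<in> slabs c b. cross c Z (w b d) \<noteq> 0} \<subseteq> ?T ` F"
      using transport_w_back[OF E_sym[OF E(1)]] by (fastforce simp: F_def image_iff)
  qed (use F in auto)
  also have "\<dots> = (\<Sum>Z\<in>F. if reach c b d (?T Z) then cross c (?T Z) (w b d) else 0)"
    using inj by (simp add: sum.reindex)
  finally have bd: "flow c b d = \<dots>" .
  have ab: "flow c a b = (\<Sum>Z\<in>F. if reach c a b Z then cross c Z (w a b) else 0)"
    and ad: "flow c a d = (\<Sum>Z\<in>F. if reach c a d Z then cross c Z (w a d) else 0)"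
    by (rule flow_superset; use F in \<open>auto simp: F_def\<close>)+
  have "(if reach c a b Z then cross c Z (w a b) else 0) + (if reach c b d (?T Z) then cross c (?T Z) (w b d) else 0)
      = (if reach c a d Z then cross c Z (w a d) else 0)" if "Z \<in> F" for Z
  proof -
    have Z: "Z \<in> slabs c a" using that F by blast
    have TZ: "?T Z \<in> slabs c b" using transport_w_comps[OF E(1) Z] .
    have sum: "cross c Z (w a b) + cross c (?T Z) (w b d) = cross c Z (w a d)"
      using crossing_w_tri[OF E Z level_in_slab] .
    have 1: "reach c a b Z \<longleftrightarrow> reach c a d Z" if "cross c Z (w a b) \<noteq> 0" "cross c Z (w a d) \<noteq> 0"
      using reach_turn_iff[OF E that] .
    have 2: "reach c a b Z \<longleftrightarrow> reach c b d (?T Z)" if "cross c Z (w a b) \<noteq> 0" "cross c (?T Z) (w b d) \<noteq> 0"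
    proof -
      have "cross c (?T Z) (w b a) \<noteq> 0" using crossing_w_back[OF E(1) Z level_in_slab] that by simp
      then show ?thesis
        using reach_turn_iff[OF E_sym[OF E(1)] E(3,2)] reach_flip_iff[OF E(1) Z] that by blast
    qed
    have 3: "reach c a d Z \<longleftrightarrow> reach c b d (?T Z)" if "cross c Z (w a d) \<noteq> 0" "cross c (?T Z) (w b d) \<noteq> 0"
    proof -
      let ?D = "transport (w a d) Z"
      have D: "transport (w b d) (?T Z) = ?D" using transport_w_tri[OF E Z] .
      have "cross c ?D (w d a) \<noteq> 0" "cross c ?D (w d b) \<noteq> 0"
        using crossing_w_back[OF E(3) Z level_in_slab] crossing_w_back[OF E(2) TZ level_in_slab] that D by auto
      then have "reach c d a ?D \<longleftrightarrow> reach c d b ?D"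
        using reach_turn_iff[OF E_sym[OF E(3)] E(1) E_sym[OF E(2)]] by blast
      then show ?thesis using reach_flip_iff[OF E(3) Z] reach_flip_iff[OF E(2) TZ] D by simp
    qed
    \<comment> \<open>With \<open>x + y = z\<close> it cannot happen that exactly one of the three
      is nonzero, so the common truth value of the nonzero ones factors out.\<close>
    have "(if A then x else 0) + (if B then y else 0) = (if D then z else 0)"
      if "x + y = z" "x \<noteq> 0 \<Longrightarrow> z \<noteq> 0 \<Longrightarrow> A = D" "x \<noteq> 0 \<Longrightarrow> y \<noteq> 0 \<Longrightarrow> A = B" "z \<noteq> 0 \<Longrightarrow> y \<noteq> 0 \<Longrightarrow> D = B"
      for x y z :: int and A B D
      using that by (cases A; cases B; cases D; cases "x = 0"; cases "y = 0"; cases "z = 0") simp_all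
    from this[OF sum 1 2 3] show ?thesis .
  qed
  then show ?thesis unfolding ab bd ad by (simp add: sum.distrib[symmetric])
qed

text \<open>By \<open>start\<close> every crossing of a right edge is reached, so the flow is the
  total crossing number of the level.\<close>

lemma flow_right:
  assumes "E a b" "Rt a" "Rt b" shows "flow c a b = above (c + 3 * \<kappa>) b - above (c + 3 * \<kappa>) a"
proof -
  have "flow c a b = (\<Sum>Z \<in> {Z \<in> slabs c a. cross c Z (w a b) \<noteq> 0}. cross c Z (w a b))"
    unfolding flow_def using reach.start assms by (intro sum.cong) auto
  also have "\<dots> = above (c + 3 * \<kappa>) b - above (c + 3 * \<kappa>) a"
    using crossing_sum_all[OF w_walk[OF assms(1)] w_hd[OF assms(1)] level_in_slab] w_hd[OF assms(1)] w_last[OF assms(1)]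
    by simp
  finally show ?thesis .
qed

lemma flow_avoid:
  assumes "\<And>x. x \<in> set (w a b) \<Longrightarrow> \<not> (c < v x \<and> v x < c + 7 * \<kappa>)" shows "flow c a b = 0"
  unfolding flow_def using crossing_avoid[OF _ assms] by (auto intro: sum.neutral)

theorem flow_or_rectangle:
  assumes "7 * \<kappa> * real (card V ^ 3 + card V + 1) \<le> 2 * e"
  shows "\<exists>c. - e \<le> c \<and> c + 7 * \<kappa> \<le> e \<and> (rectangle c \<or>
    (\<forall>a b. E a b \<longrightarrow> Lf a \<longrightarrow> Lf b \<longrightarrow> flow c a b = 0))"
proof -
  obtain c where c: "good c" "- e \<le> c" "c + 7 * \<kappa> \<le> e" using good_exists[OF assms] .
  have "rectangle c \<or> flow c a b = 0" if "Lf a" "Lf b" for a b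
    using reach_left_imp_rectangle[OF c(1) _ that] by (auto simp: flow_def intro!: sum.neutral)
  then show ?thesis using c by blast
qed

end

section \<open>Unstable pairs of functions and covering dimension\<close>

text \<open>The origin is not a stable value of any pair, in a weak form: \<open>(u', v')\<close>
  need not be close to \<open>(u, v)\<close> and only keeps signs where \<open>u\<close> or
  \<open>v\<close> is large. This is what an angle built on a net can guarantee, and what
  elimination of triples consumes.\<close>

definition unstable_pairs :: "'b::topological_space set \<Rightarrow> bool" where
  "unstable_pairs K \<longleftrightarrow> (\<forall>u v e. continuous_on K u \<and> continuous_on K v \<and> 0 < (e::real) \<longrightarrow>
     (\<exists>u' v'. continuous_on K u' \<and> continuous_on K v' \<and> (\<forall>x\<in>K. u' x \<noteq> (0::real) \<or> v' x \<noteq> (0::real)) \<and>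
       (\<forall>x\<in>K. (u x \<ge> e \<longrightarrow> u' x > 0) \<and> (u x \<le> - e \<longrightarrow> u' x < 0) \<and>
               (v x \<ge> e \<longrightarrow> v' x > 0) \<and> (v x \<le> - e \<longrightarrow> v' x < 0))))"

text \<open>An unnormalised partition of unity; subtracting minima would destroy a
  normalisation.\<close>

definition positive_family :: "'b::topological_space set \<Rightarrow> 'i set \<Rightarrow> ('i \<Rightarrow> 'b \<Rightarrow> real) \<Rightarrow> bool" where
  "positive_family K I \<phi> \<longleftrightarrow> (\<forall>i\<in>I. continuous_on K (\<phi> i) \<and> (\<forall>x\<in>K. 0 \<le> \<phi> i x)) \<and> (\<forall>x\<in>K. \<exists>i\<in>I. 0 < \<phi> i x)"

lemma positive_family_bound:
  fixes K :: "'b::metric_space set"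
  assumes "compact K" "finite I" "positive_family K I \<phi>"
  obtains \<mu> where "0 < \<mu>" "\<And>x. x \<in> K \<Longrightarrow> \<exists>i\<in>I. \<mu> \<le> \<phi> i x"
proof (cases "K = {}")
  case True
  then show ?thesis using that[of 1] by auto
next
  case False
  have "continuous_on K (\<lambda>x. \<Sum>i\<in>I. \<phi> i x)"
    using assms(3) by (auto simp: positive_family_def intro!: continuous_on_sum)
  then obtain x0 where x0: "x0 \<in> K" "\<And>x. x \<in> K \<Longrightarrow> (\<Sum>i\<in>I. \<phi> i x0) \<le> (\<Sum>i\<in>I. \<phi> i x)"
    using continuous_attains_inf[OF assms(1) False] by blast
  define s where "s = (\<Sum>i\<in>I. \<phi> i x0)"
  obtain i where "i \<in> I" "0 < \<phi> i x0" using assms(3) x0(1) by (auto simp: positive_family_def)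
  then have "0 < s" unfolding s_def
    using assms(2,3) x0(1) by (intro sum_pos2) (auto simp: positive_family_def)
  have I: "I \<noteq> {}" using assms(3) x0(1) by (auto simp: positive_family_def)
  then have cI: "0 < real (card I)" using assms(2) by (simp add: card_gt_0_iff)
  show ?thesis
  proof (rule that[of "s / card I"])
    show "0 < s / card I" using \<open>0 < s\<close> cI by simp
    fix x assume x: "x \<in> K"
    show "\<exists>i\<in>I. s / card I \<le> \<phi> i x"
    proof (rule ccontr)
      assume "\<not> ?thesis"
      then have "(\<Sum>i\<in>I. \<phi> i x) < (\<Sum>i\<in>I. s / card I)"
        using I assms(2) by (intro sum_strict_mono) auto
      also have "\<dots> = s" using cI by simp
      finally show False using x0(2)[OF x] by (simp add: s_def)
    qed
  qed
qed

text \<open>The differences \<open>a\<close> and \<open>b\<close> vanish together exactly where the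
  three functions agree. Once they are deformed to have no common zero where one of the three is at
  least \<open>\<mu>\<close>, the numbers \<open>q1\<close>, \<open>q2\<close> and 0 are not all
  equal there; subtracting their minimum makes one of them zero and leaves another positive.\<close>

lemma eliminate_triple:
  fixes K :: "'b::metric_space set"
  assumes K: "compact K" and P: "unstable_pairs K" and I: "finite I" and \<phi>: "positive_family K I \<phi>"
    and ijk: "i \<in> I" "j \<in> I" "k \<in> I" "i \<noteq> j" "j \<noteq> k" "i \<noteq> k"
  obtains \<psi> where "positive_family K I \<psi>"
    and "\<And>l x. l \<in> I \<Longrightarrow> x \<in> K \<Longrightarrow> 0 < \<psi> l x \<Longrightarrow> 0 < \<phi> l x"
    and "\<And>x. x \<in> K \<Longrightarrow> \<not> (0 < \<psi> i x \<and> 0 < \<psi> j x \<and> 0 < \<psi> k x)"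
proof -
  obtain \<mu> where \<mu>: "0 < \<mu>" "\<And>x. x \<in> K \<Longrightarrow> \<exists>i\<in>I. \<mu> \<le> \<phi> i x"
    using positive_family_bound[OF K I \<phi>] by blast
  \<comment> \<open>If one of the three functions is at least \<open>\<mu> = 2 * \<delta>\<close>
    and the smallest is below \<open>\<delta>\<close>, then \<open>a\<close> or \<open>b\<close> has
    absolute value at least \<open>\<delta> / 2\<close>; half is lost because the functions of
    \<open>i\<close> and \<open>j\<close> are compared through that of \<open>k\<close>.\<close>
  define \<delta> where "\<delta> = \<mu> / 2"
  have \<delta>: "0 < \<delta>" using \<mu> by (simp add: \<delta>_def)
  have cont: "continuous_on K (\<phi> l)" and nn: "\<And>x. x \<in> K \<Longrightarrow> 0 \<le> \<phi> l x" if "l \<in> I" for l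
    using \<phi> that by (auto simp: positive_family_def)
  define a where "a x = \<phi> i x - \<phi> k x" for x
  define b where "b x = \<phi> j x - \<phi> k x" for x
  have cab: "continuous_on K a" "continuous_on K b"
    unfolding a_def b_def using cont ijk by (auto intro!: continuous_intros)
  have "continuous_on K a \<and> continuous_on K b \<and> 0 < \<delta> / 2" using cab \<delta> by simp
  from P[unfolded unstable_pairs_def, THEN spec, THEN spec, THEN spec, THEN mp, OF this]
  obtain a' b' :: "'b \<Rightarrow> real" where ab0: "continuous_on K a'" "continuous_on K b'" "\<forall>x\<in>K. a' x \<noteq> 0 \<or> b' x \<noteq> 0"
    "\<forall>x\<in>K. (a x \<ge> \<delta> / 2 \<longrightarrow> a' x > 0) \<and> (a x \<le> - (\<delta> / 2) \<longrightarrow> a' x < 0) \<and>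
       (b x \<ge> \<delta> / 2 \<longrightarrow> b' x > 0) \<and> (b x \<le> - (\<delta> / 2) \<longrightarrow> b' x < 0)"
    by (elim exE conjE) blast
  note ab' = ab0(1,2) bspec[OF ab0(3)] bspec[OF ab0(4)]
  define m where "m x = min (\<phi> i x) (min (\<phi> j x) (\<phi> k x))" for x
  \<comment> \<open>Cut-off, 0 for \<open>m x \<le> \<delta> / 2\<close> and 1 for
    \<open>m x \<ge> \<delta>\<close>. Where one of the three functions vanishes, the triple stays
    unchanged, so no support grows.\<close>
  define \<theta> where "\<theta> x = max 0 (min 1 (2 * m x / \<delta> - 1))" for x
  define q1 where "q1 x = (1 - \<theta> x) * a x + \<theta> x * a' x" for x
  define q2 where "q2 x = (1 - \<theta> x) * b x + \<theta> x * b' x" for x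
  define \<nu> where "\<nu> x = min (q1 x) (min (q2 x) 0)" for x
  define \<psi> where "\<psi> l x = (if l = i then q1 x - \<nu> x else if l = j then q2 x - \<nu> x else if l = k then - \<nu> x else \<phi> l x)" for l x
  have cm: "continuous_on K m" unfolding m_def using cont ijk by (auto intro!: continuous_intros)
  have c\<theta>: "continuous_on K \<theta>" unfolding \<theta>_def using cm \<delta> by (auto intro!: continuous_intros)
  have cq: "continuous_on K q1" "continuous_on K q2"
    unfolding q1_def q2_def using cab ab' c\<theta> by (auto intro!: continuous_intros)
  have c\<nu>: "continuous_on K \<nu>" unfolding \<nu>_def using cq by (auto intro!: continuous_intros)
  have c\<psi>: "continuous_on K (\<psi> l)" if "l \<in> I" for l
  proof -
    consider "l = i" | "l = j" | "l = k" | "l \<noteq> i" "l \<noteq> j" "l \<noteq> k" by blast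
    then show ?thesis
      by cases (use cq c\<nu> cont[OF that] ijk in \<open>auto simp: \<psi>_def[abs_def] intro!: continuous_intros\<close>)
  qed
  have nn\<psi>: "0 \<le> \<psi> l x" if "l \<in> I" "x \<in> K" for l x
    using nn[OF that] by (auto simp: \<psi>_def \<nu>_def)
  have \<theta>01: "0 \<le> \<theta> x" "\<theta> x \<le> 1" for x by (auto simp: \<theta>_def)
  have dom: "0 < \<phi> l x" if l: "l \<in> I" "x \<in> K" "0 < \<psi> l x" for l x
  proof (rule ccontr)
    assume "\<not> ?thesis"
    then have z: "\<phi> l x = 0" using nn[OF l(1,2)] by simp
    have n3: "0 \<le> \<phi> i x" "0 \<le> \<phi> j x" "0 \<le> \<phi> k x" using nn ijk l(2) by auto
    show False
    proof (cases "l = i \<or> l = j \<or> l = k")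
      case True
      then have "m x = 0" using z n3 by (auto simp: m_def)
      then have "\<theta> x = 0" by (simp add: \<theta>_def)
      then have "q1 x = a x" "q2 x = b x" by (auto simp: q1_def q2_def)
      then show False using True z n3 l(3) ijk by (auto simp: \<psi>_def \<nu>_def a_def b_def split: if_splits)
    next
      case False
      then show False using z l(3) by (auto simp: \<psi>_def)
    qed
  qed
  have convex_pos: "0 < (1 - t) * x + t * y" if "0 \<le> t" "t \<le> 1" "0 < x" "0 < y" for t x y :: real
    using that by (cases "t = 0") (auto intro!: add_nonneg_pos)
  have convex_neg: "(1 - t) * x + t * y < 0" if "0 \<le> t" "t \<le> 1" "x < 0" "y < 0" for t x y :: real
    using convex_pos[of t "- x" "- y"] that by simp
  have pos: "\<exists>l\<in>I. 0 < \<psi> l x" if x: "x \<in> K" for x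
  proof -
    obtain l where l: "l \<in> I" "\<mu> \<le> \<phi> l x" using \<mu> x by blast
    show ?thesis
    proof (cases "l = i \<or> l = j \<or> l = k")
      case True
      have "q1 x \<noteq> 0 \<or> q2 x \<noteq> 0"
      proof (cases "m x \<ge> \<delta>")
        case True
        then have "2 * m x / \<delta> - 1 \<ge> 1" using \<delta> by (simp add: field_simps)
        then have "\<theta> x = 1" by (simp add: \<theta>_def)
        then show ?thesis using ab'(3)[OF x] by (simp add: q1_def q2_def)
      next
        case False
        have "a x \<ge> \<delta> / 2 \<or> a x \<le> - (\<delta> / 2) \<or> b x \<ge> \<delta> / 2 \<or> b x \<le> - (\<delta> / 2)"
          using False True l(2) by (auto simp: a_def b_def m_def \<delta>_def min_def split: if_splits)
        \<comment> \<open>In a coordinate that is large, the old and the new pair have the same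
          strict sign, and so has every convex combination.\<close>
        then consider "a x > 0" "a' x > 0" | "a x < 0" "a' x < 0" | "b x > 0" "b' x > 0" | "b x < 0" "b' x < 0"
          using ab'(4)[OF x] \<delta> by linarith
        then show ?thesis
          by cases (use convex_pos[OF \<theta>01] convex_neg[OF \<theta>01] in \<open>auto simp: q1_def q2_def less_le\<close>)
      qed
      then have "0 < \<psi> i x \<or> 0 < \<psi> j x \<or> 0 < \<psi> k x" using ijk by (auto simp: \<psi>_def \<nu>_def)
      then show ?thesis using ijk by blast
    next
      case False
      then show ?thesis using l \<mu>(1) by (auto simp: \<psi>_def intro!: bexI[of _ l])
    qed
  qed
  show thesis
  proof (rule that)
    show "positive_family K I \<psi>" using c\<psi> nn\<psi> pos by (auto simp: positive_family_def)
    show "\<not> (0 < \<psi> i x \<and> 0 < \<psi> j x \<and> 0 < \<psi> k x)" for x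
      using ijk by (auto simp: \<psi>_def \<nu>_def min_def)
  qed (use dom in auto)
qed

text \<open>Supports never grow, so a triple once eliminated stays eliminated.\<close>

lemma eliminate_all_triples:
  fixes K :: "'b::metric_space set"
  assumes K: "compact K" and P: "unstable_pairs K" and I: "finite I" and \<phi>: "positive_family K I \<phi>"
  obtains \<psi> where "positive_family K I \<psi>"
    and "\<And>l x. l \<in> I \<Longrightarrow> x \<in> K \<Longrightarrow> 0 < \<psi> l x \<Longrightarrow> 0 < \<phi> l x"
    and "\<And>i j k x. i \<in> I \<Longrightarrow> j \<in> I \<Longrightarrow> k \<in> I \<Longrightarrow> i \<noteq> j \<Longrightarrow> j \<noteq> k \<Longrightarrow> i \<noteq> k \<Longrightarrow> x \<in> K \<Longrightarrow>
      \<not> (0 < \<psi> i x \<and> 0 < \<psi> j x \<and> 0 < \<psi> k x)"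
proof -
  define D where "D = {(i, j, k). i \<in> I \<and> j \<in> I \<and> k \<in> I \<and> i \<noteq> j \<and> j \<noteq> k \<and> i \<noteq> k}"
  have finD: "finite D" by (rule finite_subset[of _ "I \<times> I \<times> I"]) (auto simp: D_def I)
  have *: "\<exists>\<psi>. positive_family K I \<psi> \<and> (\<forall>l\<in>I. \<forall>x\<in>K. 0 < \<psi> l x \<longrightarrow> 0 < \<phi> l x) \<and>
    (\<forall>(i, j, k)\<in>S. \<forall>x\<in>K. \<not> (0 < \<psi> i x \<and> 0 < \<psi> j x \<and> 0 < \<psi> k x))" if "finite S" "S \<subseteq> D" for S
    using that
  proof (induction S rule: finite_induct)
    case empty
    then show ?case using \<phi> by auto
  next
    case (insert t S)
    obtain i j k where t: "t = (i, j, k)" by (cases t)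
    then have ijk: "i \<in> I" "j \<in> I" "k \<in> I" "i \<noteq> j" "j \<noteq> k" "i \<noteq> k"
      using insert.prems by (auto simp: D_def)
    obtain \<psi> where \<psi>: "positive_family K I \<psi>" "\<forall>l\<in>I. \<forall>x\<in>K. 0 < \<psi> l x \<longrightarrow> 0 < \<phi> l x"
      "\<forall>(i, j, k)\<in>S. \<forall>x\<in>K. \<not> (0 < \<psi> i x \<and> 0 < \<psi> j x \<and> 0 < \<psi> k x)"
      using insert by auto
    obtain \<eta> where \<eta>: "positive_family K I \<eta>"
      "\<And>l x. l \<in> I \<Longrightarrow> x \<in> K \<Longrightarrow> 0 < \<eta> l x \<Longrightarrow> 0 < \<psi> l x"
      "\<And>x. x \<in> K \<Longrightarrow> \<not> (0 < \<eta> i x \<and> 0 < \<eta> j x \<and> 0 < \<eta> k x)"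
      using eliminate_triple[OF K P I \<psi>(1) ijk] by blast
    have "\<not> (0 < \<eta> i' x \<and> 0 < \<eta> j' x \<and> 0 < \<eta> k' x)" if "(i', j', k') \<in> S" "x \<in> K" for i' j' k' x
    proof -
      have "i' \<in> I" "j' \<in> I" "k' \<in> I" using insert.prems that(1) by (auto simp: D_def)
      then show ?thesis using \<eta>(2) \<psi>(3) that by fastforce
    qed
    then show ?case using \<eta> \<psi>(2) t by (intro exI[of _ \<eta>]) auto
  qed
  obtain \<psi> where \<psi>: "positive_family K I \<psi>" "\<forall>l\<in>I. \<forall>x\<in>K. 0 < \<psi> l x \<longrightarrow> 0 < \<phi> l x"
    "\<forall>(i, j, k)\<in>D. \<forall>x\<in>K. \<not> (0 < \<psi> i x \<and> 0 < \<psi> j x \<and> 0 < \<psi> k x)"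
    using *[OF finD order_refl] by (elim exE conjE)
  show thesis by (rule that[OF \<psi>(1)]) (use \<psi> in \<open>auto simp: D_def\<close>)
qed

lemma unstable_pairs_imp_dim_le_1:
  fixes K :: "'b::metric_space set"
  assumes K: "compact K" and P: "unstable_pairs K"
  shows "covering_dim_le (top_of_set K) 1"
  unfolding covering_dim_le_def
proof (intro allI impI, elim conjE)
  fix \<U> assume \<U>: "finite \<U>" "\<forall>U\<in>\<U>. openin (top_of_set K) U" "\<Union>\<U> = topspace (top_of_set K)"
  \<comment> \<open>The separate value for \<open>U = K\<close> is due to \<open>infdist\<close>
    being 0 for the empty set.\<close>
  define \<phi> where "\<phi> U x = (if U = K then 1 else infdist x (K - U))" for U x
  have clo: "closed (K - U)" if "U \<in> \<U>" for U
    using \<U>(2) K that by (metis closedin_closed_trans closedin_def compact_imp_closed double_diff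
        openin_closedin_eq topspace_euclidean_subtopology)
  have pos: "0 < \<phi> U x \<longleftrightarrow> x \<in> U" if "U \<in> \<U>" "x \<in> K" for U x
  proof -
    have "U \<subseteq> K" using \<U>(2) that openin_imp_subset by blast
    then show ?thesis
      using clo[OF that(1)] that infdist_pos_not_in_closed[of "K - U" x] infdist_zero[of x "K - U"]
      by (cases "x \<in> U"; cases "U = K") (auto simp: \<phi>_def)
  qed
  have "positive_family K \<U> \<phi>"
    unfolding positive_family_def
  proof (intro conjI ballI)
    show "continuous_on K (\<phi> U)" for U unfolding \<phi>_def[abs_def]
      by (cases "U = K") (auto intro!: continuous_intros)
    show "0 \<le> \<phi> U x" for U x by (simp add: \<phi>_def infdist_nonneg)
    show "\<exists>U\<in>\<U>. 0 < \<phi> U x" if "x \<in> K" for x using \<U>(3) pos that by auto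
  qed
  then obtain \<psi> where \<psi>: "positive_family K \<U> \<psi>" "\<And>l x. l \<in> \<U> \<Longrightarrow> x \<in> K \<Longrightarrow> 0 < \<psi> l x \<Longrightarrow> 0 < \<phi> l x"
    "\<And>i j k x. i \<in> \<U> \<Longrightarrow> j \<in> \<U> \<Longrightarrow> k \<in> \<U> \<Longrightarrow> i \<noteq> j \<Longrightarrow> j \<noteq> k \<Longrightarrow> i \<noteq> k \<Longrightarrow> x \<in> K \<Longrightarrow>
      \<not> (0 < \<psi> i x \<and> 0 < \<psi> j x \<and> 0 < \<psi> k x)"
    using eliminate_all_triples[OF K P \<U>(1)] by blast
  define V where "V U = {x \<in> K. 0 < \<psi> U x}" for U
  have "openin (top_of_set K) (V U)" if "U \<in> \<U>" for U
    using continuous_openin_preimage_gen[of K "\<psi> U" "{0<..}"] \<psi>(1) that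
    by (simp add: V_def positive_family_def Int_def vimage_def)
  moreover have "\<Union> (V ` \<U>) = topspace (top_of_set K)"
    using \<psi>(1) by (auto simp: V_def positive_family_def)
  moreover have "V U \<subseteq> U" if "U \<in> \<U>" for U using \<psi>(2) pos that by (auto simp: V_def)
  moreover have "card {S \<in> V ` \<U>. x \<in> S} \<le> 1 + 1" if "x \<in> topspace (top_of_set K)" for x
  proof (rule ccontr)
    assume "\<not> ?thesis"
    then have "3 \<le> card {S \<in> V ` \<U>. x \<in> S}" by simp
    then obtain T where "T \<subseteq> {S \<in> V ` \<U>. x \<in> S}" "card T = 3" by (meson obtain_subset_with_card_n)
    then obtain A B C where "A \<noteq> B" "B \<noteq> C" "A \<noteq> C" "{A, B, C} \<subseteq> {S \<in> V ` \<U>. x \<in> S}"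
      by (metis card_3_iff)
    then obtain i j k where "i \<in> \<U>" "j \<in> \<U>" "k \<in> \<U>" "V i \<noteq> V j" "V j \<noteq> V k" "V i \<noteq> V k"
      "x \<in> V i" "x \<in> V j" "x \<in> V k" by auto
    then show False using \<psi>(3)[of i j k x] by (auto simp: V_def)
  qed
  ultimately show "\<exists>\<V>. finite \<V> \<and> (\<forall>V\<in>\<V>. openin (top_of_set K) V) \<and> \<Union>\<V> = topspace (top_of_set K) \<and>
      (\<forall>V\<in>\<V>. \<exists>U\<in>\<U>. V \<subseteq> U) \<and> (\<forall>x\<in>topspace (top_of_set K). card {V \<in> \<V>. x \<in> V} \<le> 1 + 1)"
    using \<U>(1) by (intro exI[of _ "V ` \<U>"]) auto
qed

lemma covering_dim_le_homeomorphic: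
  assumes f: "homeomorphic_maps S T f g" and T: "covering_dim_le T n"
  shows "covering_dim_le S n"
  unfolding covering_dim_le_def
proof (intro allI impI, elim conjE)
  fix \<U> assume \<U>: "finite \<U>" "\<forall>U\<in>\<U>. openin S U" "\<Union>\<U> = topspace S"
  have fg: "continuous_map S T f" "continuous_map T S g" "\<And>x. x \<in> topspace S \<Longrightarrow> g (f x) = x"
    "\<And>y. y \<in> topspace T \<Longrightarrow> f (g y) = y"
    using f by (auto simp: homeomorphic_maps_def)
  have fS: "f x \<in> topspace T" if "x \<in> topspace S" for x
    using fg(1) that by (auto simp: continuous_map_def)
  have gT: "g y \<in> topspace S" if "y \<in> topspace T" for y
    using fg(2) that by (auto simp: continuous_map_def)
  define G where "G U = {y \<in> topspace T. g y \<in> U}" for U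
  have "\<forall>U\<in>G ` \<U>. openin T U" using \<U>(2) fg(2) by (auto simp: G_def openin_continuous_map_preimage)
  moreover have "\<Union> (G ` \<U>) = topspace T" using \<U>(3) gT by (auto simp: G_def)
  ultimately have "finite (G ` \<U>) \<and> (\<forall>U\<in>G ` \<U>. openin T U) \<and> \<Union> (G ` \<U>) = topspace T"
    using \<U>(1) by blast
  from T[unfolded covering_dim_le_def, THEN spec, THEN mp, OF this]
  obtain \<V> where \<V>: "finite \<V>" "\<forall>V\<in>\<V>. openin T V" "\<Union>\<V> = topspace T"
    "\<forall>V\<in>\<V>. \<exists>U\<in>G ` \<U>. V \<subseteq> U" "\<forall>x\<in>topspace T. card {V \<in> \<V>. x \<in> V} \<le> n + 1"
    by (elim exE conjE)
  define F where "F V = {x \<in> topspace S. f x \<in> V}" for V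
  have "\<forall>V\<in>F ` \<V>. openin S V" using \<V>(2) fg(1) by (auto simp: F_def openin_continuous_map_preimage)
  moreover have "\<Union> (F ` \<V>) = topspace S" using \<V>(3) fS by (auto simp: F_def)
  moreover have "\<forall>V\<in>F ` \<V>. \<exists>U\<in>\<U>. V \<subseteq> U"
  proof
    fix A assume "A \<in> F ` \<V>"
    then obtain V where V: "V \<in> \<V>" "A = F V" by blast
    then obtain U where U: "U \<in> \<U>" "V \<subseteq> G U" using \<V>(4) by blast
    have "x \<in> U" if "x \<in> A" for x
    proof -
      have "x \<in> topspace S" "f x \<in> G U" using that V(2) U(2) by (auto simp: F_def)
      then show ?thesis using fg(3) by (simp add: G_def)
    qed
    then show "\<exists>U\<in>\<U>. A \<subseteq> U" using U(1) by blast
  qed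
  moreover have "card {V \<in> F ` \<V>. x \<in> V} \<le> n + 1" if x: "x \<in> topspace S" for x
  proof -
    have "{V \<in> F ` \<V>. x \<in> V} = F ` {V \<in> \<V>. f x \<in> V}" using x by (auto simp: F_def)
    then have "card {V \<in> F ` \<V>. x \<in> V} \<le> card {V \<in> \<V>. f x \<in> V}"
      using \<V>(1) by (simp add: card_image_le)
    then show ?thesis using \<V>(5) fS[OF x] by force
  qed
  ultimately show "\<exists>\<V>. finite \<V> \<and> (\<forall>V\<in>\<V>. openin S V) \<and> \<Union>\<V> = topspace S \<and>
      (\<forall>V\<in>\<V>. \<exists>U\<in>\<U>. V \<subseteq> U) \<and> (\<forall>x\<in>topspace S. card {V \<in> \<V>. x \<in> V} \<le> n + 1)"
    using \<V>(1) by (intro exI[of _ "F ` \<V>"] conjI ballI) auto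
qed

section \<open>Walks in the Hilbert cube as paths\<close>

definition hcube :: "(nat \<Rightarrow> real) set" where
  "hcube = {y. \<forall>n. 0 \<le> y n \<and> y n \<le> 1}"

definition seg :: "(nat \<Rightarrow> real) \<Rightarrow> (nat \<Rightarrow> real) \<Rightarrow> real \<Rightarrow> nat \<Rightarrow> real" where
  "seg x y t = (\<lambda>n. (1 - t) * x n + t * y n)"

lemma seg_0 [simp]: "seg x y 0 = x" and seg_1 [simp]: "seg x y 1 = y" and seg_same [simp]: "seg x x t = x"
  by (auto simp: seg_def algebra_simps)

lemma seg_in_hcube: "x \<in> hcube \<Longrightarrow> y \<in> hcube \<Longrightarrow> 0 \<le> t \<Longrightarrow> t \<le> 1 \<Longrightarrow> seg x y t \<in> hcube"
  by (auto simp: hcube_def seg_def intro!: convex_bound_le)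

lemma continuous_on_seg:
  assumes "continuous_on S f" "continuous_on S g" "continuous_on S h"
  shows "continuous_on S (\<lambda>x. seg (f x) (g x) (h x))"
proof (rule continuous_on_coordinatewise_then_product)
  fix i
  show "continuous_on S (\<lambda>x. seg (f x) (g x) (h x) i)"
    unfolding seg_def
    by (intro continuous_on_add continuous_on_mult continuous_on_diff continuous_on_const assms(3)
        continuous_on_product_then_coordinatewise[OF assms(1)] continuous_on_product_then_coordinatewise[OF assms(2)])
qed

section \<open>Convexity of the product metric on the cube\<close>

lemma summable_dist_fun:
  "summable (\<lambda>n. (1/2)^n * min (dist ((x::nat \<Rightarrow> real) (from_nat n)) (y (from_nat n))) 1)"
  by (rule summable_comparison_test'[of "\<lambda>n. (1/2)^n"]) (auto simp: summable_geometric_iff)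

text \<open>The weights \<open>(1/2)^n\<close> sum to 2, hence the factor.\<close>

lemma dist_fun_le:
  fixes x y :: "nat \<Rightarrow> real"
  assumes "\<And>n. \<bar>x n - y n\<bar> \<le> d"
  shows "dist x y \<le> 2 * d"
proof -
  have "dist x y \<le> (\<Sum>n. d * (1/2)^n)"
    unfolding dist_fun_def
  proof (rule suminf_le[OF _ summable_dist_fun])
    show "(1/2)^n * min (dist (x (from_nat n)) (y (from_nat n))) 1 \<le> d * (1/2)^n" for n
      using assms[of "from_nat n"] by (auto simp: dist_real_def mult.commute intro!: mult_right_mono)
    show "summable (\<lambda>n. d * (1/2)^n)" by (intro summable_mult summable_geometric) simp
  qed
  also have "\<dots> = 2 * d" using suminf_mult[of "\<lambda>n. (1/2::real)^n" d] suminf_geometric[of "1/2::real"]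
    by (simp add: summable_geometric_iff)
  finally show ?thesis .
qed

text \<open>In the cube coordinates differ by at most 1, so the truncation in the product metric is
  inactive and the metric is a weighted sum of coordinate distances. This makes balls in the cube
  convex.\<close>

lemma dist_seg_le:
  assumes "x \<in> hcube" "y \<in> hcube" "z \<in> hcube" "0 \<le> t" "t \<le> 1"
  shows "dist (seg x y t) z \<le> (1 - t) * dist x z + t * dist y z"
proof -
  have le: "min (dist (seg x y t n) (z n)) 1 \<le> (1 - t) * min (dist (x n) (z n)) 1 + t * min (dist (y n) (z n)) 1" for n
  proof -
    have b: "\<bar>x n - z n\<bar> \<le> 1" "\<bar>y n - z n\<bar> \<le> 1"
      using assms(1-3) unfolding hcube_def by (smt (verit) mem_Collect_eq)+
    have "seg x y t n - z n = (1 - t) * (x n - z n) + t * (y n - z n)" by (simp add: seg_def algebra_simps)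
    then have "\<bar>seg x y t n - z n\<bar> \<le> (1 - t) * \<bar>x n - z n\<bar> + t * \<bar>y n - z n\<bar>"
      using abs_triangle_ineq[of "(1 - t) * (x n - z n)" "t * (y n - z n)"] assms(4,5) by (simp add: abs_mult)
    then show ?thesis using b by (simp add: dist_real_def)
  qed
  have "dist (seg x y t) z \<le> (\<Sum>n. (1 - t) * ((1/2)^n * min (dist (x (from_nat n)) (z (from_nat n))) 1) +
      t * ((1/2)^n * min (dist (y (from_nat n)) (z (from_nat n))) 1))"
    unfolding dist_fun_def
  proof (rule suminf_le[OF _ summable_dist_fun])
    fix n
    show "(1/2)^n * min (dist (seg x y t (from_nat n)) (z (from_nat n))) 1 \<le>
      (1 - t) * ((1/2)^n * min (dist (x (from_nat n)) (z (from_nat n))) 1) +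
      t * ((1/2)^n * min (dist (y (from_nat n)) (z (from_nat n))) 1)"
      using mult_left_mono[OF le[of "from_nat n"], of "(1/2)^n"] by (simp add: algebra_simps)
  qed (intro summable_add summable_mult summable_dist_fun)
  also have "\<dots> = (1 - t) * dist x z + t * dist y z"
    unfolding dist_fun_def
    by (simp add: suminf_add[symmetric] suminf_mult[symmetric] summable_mult summable_dist_fun)
  finally show ?thesis .
qed

lemma dist_seg_less:
  assumes "x \<in> hcube" "y \<in> hcube" "z \<in> hcube" "0 \<le> t" "t \<le> 1" "dist x z < d" "dist y z < d"
  shows "dist (seg x y t) z < d"
proof -
  have "(1 - t) * dist x z + t * dist y z < d"
    using convex_bound_lt[of "dist x z" d "dist y z" "1 - t" t] assms by simp
  then show ?thesis using dist_seg_le[OF assms(1-5)] by simp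
qed

lemma homotopic_paths_seg:
  assumes "path p" "path q" "pathstart p = pathstart q" "pathfinish p = pathfinish q"
    and "\<And>s t. s \<in> {0..1} \<Longrightarrow> t \<in> {0..1} \<Longrightarrow> seg (p t) (q t) s \<in> U"
  shows "homotopic_paths U p q"
  unfolding homotopic_paths
proof (intro exI conjI)
  let ?h = "\<lambda>z. seg (p (snd z)) (q (snd z)) (fst z)"
  have "continuous_on ({0..1} \<times> {0..1}) (\<lambda>z. f (snd z))" if "path f" for f :: "real \<Rightarrow> nat \<Rightarrow> real"
    using that unfolding path_def
    by (rule continuous_on_compose2) (auto intro!: continuous_intros)
  then show "continuous_on ({0..1} \<times> {0..1}) ?h"
    using assms(1,2) by (intro continuous_on_seg continuous_on_fst continuous_on_id) auto
  show "?h \<in> {0..1} \<times> {0..1} \<rightarrow> U" using assms(5) by auto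
  show "\<forall>t\<in>{0..1}. pathstart (?h \<circ> Pair t) = pathstart p \<and> pathfinish (?h \<circ> Pair t) = pathfinish p"
    using assms(3,4) by (auto simp: pathstart_def pathfinish_def)
qed auto

lemma homotopic_paths_const_join:
  assumes "path q" "path_image q \<subseteq> U"
  shows "homotopic_paths U ((\<lambda>t. pathstart q) +++ q) q"
proof (rule homotopic_paths_sym[OF homotopic_paths_reparametrize[OF assms, of "\<lambda>t. max 0 (2 * t - 1)"]])
  show "continuous_on {0..1} (\<lambda>t::real. max 0 (2 * t - 1))" by (intro continuous_intros)
  show "((\<lambda>t. pathstart q) +++ q) t = q (max 0 (2 * t - 1))" for t
  proof (cases "t \<le> 1/2")
    case True
    then have "max 0 (2 * t - 1) = 0" by simp
    then show ?thesis using True by (simp only: joinpaths_def pathstart_def if_True)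
  next
    case False
    then have "max 0 (2 * t - 1) = 2 * t - 1" by simp
    then show ?thesis using False by (simp only: joinpaths_def pathstart_def if_False)
  qed
qed auto

section \<open>Piecewise linear paths of walks\<close>

fun pl :: "(nat \<Rightarrow> real) list \<Rightarrow> real \<Rightarrow> nat \<Rightarrow> real" where
  "pl [] = undefined"
| "pl [x] = (\<lambda>t. x)"
| "pl (x # y # zs) = seg x y +++ pl (y # zs)"

lemma path_seg: "path (seg x y)" and pathstart_seg [simp]: "pathstart (seg x y) = x"
  and pathfinish_seg [simp]: "pathfinish (seg x y) = y"
  unfolding path_def pathstart_def pathfinish_def
  by (auto intro!: continuous_on_seg continuous_on_const continuous_on_id)

lemma seg_const: "seg x x = (\<lambda>t. x)" by (rule ext) simp

lemma pathstart_pl [simp]: "p \<noteq> [] \<Longrightarrow> pathstart (pl p) = hd p"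
  by (induction p rule: pl.induct) (auto simp: pathstart_def joinpaths_def)

lemma pathfinish_pl [simp]: "p \<noteq> [] \<Longrightarrow> pathfinish (pl p) = last p"
  by (induction p rule: pl.induct) (auto simp: pathfinish_def joinpaths_def)

lemma path_pl: "p \<noteq> [] \<Longrightarrow> path (pl p)"
proof (induction p rule: pl.induct)
  case (2 x)
  then show ?case by (simp add: path_def)
next
  case (3 x y zs)
  then show ?case using path_seg[of x y] by simp
qed simp

text \<open>Balls in the cube being convex, \<open>W_thick\<close> puts the convex hull of each
  simplex of \<open>R\<close> into \<open>U\<close>, while the vertices stay deeper, in
  \<open>W\<close>.\<close>

locale cube_complex =
  fixes W U :: "(nat \<Rightarrow> real) set" and s :: real
  assumes W_cube: "W \<subseteq> hcube" and s_pos: "0 < s"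
    and W_thick: "\<And>x z. x \<in> W \<Longrightarrow> z \<in> hcube \<Longrightarrow> dist z x < s \<Longrightarrow> z \<in> U"
begin

definition R :: "(nat \<Rightarrow> real) \<Rightarrow> (nat \<Rightarrow> real) \<Rightarrow> bool" where
  "R x y \<longleftrightarrow> x \<in> W \<and> y \<in> W \<and> dist x y < s"

sublocale walk_complex W R
  by unfold_locales (auto simp: R_def s_pos dist_commute)

lemma W_sub_U: "W \<subseteq> U" using W_thick W_cube s_pos by fastforce

lemma seg_close: "R x y \<Longrightarrow> 0 \<le> t \<Longrightarrow> t \<le> 1 \<Longrightarrow> seg x y t \<in> U \<and> dist (seg x y t) x < s"
  using dist_seg_less[of x y x t s] seg_in_hcube[of x y t] W_cube s_pos W_thick
  by (auto simp: R_def dist_commute subset_iff)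

lemma path_image_pl: "walk p \<Longrightarrow> z \<in> path_image (pl p) \<Longrightarrow> z \<in> U \<and> (\<exists>x\<in>set p. dist z x < s)"
proof (induction p rule: pl.induct)
  case (2 x)
  then show ?case using W_sub_U s_pos by (auto simp: walk_def path_image_def)
next
  case (3 x y zs)
  then have "R x y" "walk (y # zs)" by (auto simp: walk_def)
  moreover have "z \<in> path_image (seg x y) \<or> z \<in> path_image (pl (y # zs))"
    using 3(3) path_image_join_subset by fastforce
  ultimately show ?case using 3(1) seg_close by (auto simp: path_image_def)
qed (simp add: walk_def)

lemma path_image_pl_sub: "walk p \<Longrightarrow> path_image (pl p) \<subseteq> U"
  using path_image_pl by blast

lemma walk_Cons: "walk (x # p) \<Longrightarrow> p \<noteq> [] \<Longrightarrow> R x (hd p) \<and> walk p"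
  by (cases p) (auto simp: walk_def)

lemma pl_Cons: "p \<noteq> [] \<Longrightarrow> pl (x # p) = seg x (hd p) +++ pl p"
  by (cases p) auto

lemma path_image_seg: "R x y \<Longrightarrow> path_image (seg x y) \<subseteq> U"
  using seg_close by (auto simp: path_image_def)

text \<open>Both paths lie in the ball of radius \<open>s\<close> about \<open>a\<close> in the
  cube, which is convex and contained in \<open>U\<close>, so the straight-line homotopy
  works.\<close>

lemma triangle_homotopic:
  assumes "R a b" "R b c" "R a c"
  shows "homotopic_paths U (seg a b +++ seg b c) (seg a c)"
proof (rule homotopic_paths_seg)
  show "path (seg a b +++ seg b c)" "path (seg a c)" by (auto simp: path_seg)
  show "pathstart (seg a b +++ seg b c) = pathstart (seg a c)"
    "pathfinish (seg a b +++ seg b c) = pathfinish (seg a c)" by auto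
  have cube: "a \<in> hcube" "b \<in> hcube" "c \<in> hcube" using assms W_cube by (auto simp: R_def)
  have d: "dist a a < s" "dist b a < s" "dist c a < s" using assms s_pos by (auto simp: R_def dist_commute)
  fix r t :: real assume r: "r \<in> {0..1}" and t: "t \<in> {0..1}"
  have 1: "(seg a b +++ seg b c) t \<in> hcube \<and> dist ((seg a b +++ seg b c) t) a < s"
    using t cube d by (auto simp: joinpaths_def intro!: seg_in_hcube dist_seg_less)
  have 2: "seg a c t \<in> hcube \<and> dist (seg a c t) a < s"
    using t cube d by (auto intro!: seg_in_hcube dist_seg_less)
  show "seg ((seg a b +++ seg b c) t) (seg a c t) r \<in> U"
    using W_thick[of a "seg ((seg a b +++ seg b c) t) (seg a c t) r"] assms(1) r cube 1 2
      seg_in_hcube[of "(seg a b +++ seg b c) t" "seg a c t" r]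
      dist_seg_less[of "(seg a b +++ seg b c) t" "seg a c t" a r s] by (simp add: R_def)
qed

lemma pl_Cons_homotopic:
  assumes "homotopic_paths U (pl p) (pl q)" "R x (hd p)" "p \<noteq> []" "q \<noteq> []"
  shows "homotopic_paths U (pl (x # p)) (pl (x # q))"
proof -
  have "hd p = hd q" using homotopic_paths_imp_pathstart[OF assms(1)] assms(3,4) by simp
  moreover have "homotopic_paths U (seg x (hd p)) (seg x (hd p))"
    using path_seg path_image_seg[OF assms(2)] by simp
  ultimately show ?thesis
    using homotopic_paths_join[OF _ assms(1), of "seg x (hd p)" "seg x (hd p)"] assms(3,4)
    by (simp add: pl_Cons)
qed

text \<open>The common beginning \<open>xs\<close> is peeled off by
  \<open>pl_Cons_homotopic\<close>; there remains a constant path to drop or a triangle to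
  fill.\<close>

lemma pl_step: "step p q \<Longrightarrow> walk p \<Longrightarrow> homotopic_paths U (pl p) (pl q)"
proof (induction rule: step.induct)
  case (dup a xs ys)
  from dup(2) show ?case
  proof (induction xs)
    case Nil
    then have w: "walk (a # ys)" using walk_Cons[of a "a # ys"] by simp
    then show ?case
      using homotopic_paths_const_join[of "pl (a # ys)" U] path_pl path_image_pl_sub by (simp add: seg_const)
  next
    case (Cons x xs)
    have w: "R x (hd (xs @ [a, a] @ ys))" "walk (xs @ [a, a] @ ys)" using walk_Cons[of x "xs @ [a, a] @ ys"] Cons(2) by auto
    show ?case using pl_Cons_homotopic[OF Cons.IH[OF w(2)] w(1)] by simp
  qed
next
  case (tri a b c xs ys)
  from tri(4) show ?case
  proof (induction xs)
    case Nil
    have wc: "walk (c # ys)" using walk_Cons[of a "b # c # ys"] walk_Cons[of b "c # ys"] Nil by simp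
    note pc = path_pl[of "c # ys"] path_image_pl_sub[OF wc]
    have "homotopic_paths U (seg a b +++ (seg b c +++ pl (c # ys))) ((seg a b +++ seg b c) +++ pl (c # ys))"
      using tri(1-3) path_image_seg pc path_seg by (intro homotopic_paths_assoc) auto
    also have "homotopic_paths U ((seg a b +++ seg b c) +++ pl (c # ys)) (seg a c +++ pl (c # ys))"
      using triangle_homotopic[OF tri(1-3)] pc by (intro homotopic_paths_join) auto
    finally show ?case by simp
  next
    case (Cons x xs)
    have w: "R x (hd (xs @ [a, b, c] @ ys))" "walk (xs @ [a, b, c] @ ys)" using walk_Cons[of x "xs @ [a, b, c] @ ys"] Cons(2) by auto
    show ?case using pl_Cons_homotopic[OF Cons.IH[OF w(2)] w(1)] by simp
  qed
qed

lemma pl_hmt: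
  assumes "hmt p q" "walk p" shows "homotopic_paths U (pl p) (pl q)"
proof -
  have "equivclp step p q" using assms(1) by (simp add: hmt_def)
  then show ?thesis
  proof (induction rule: equivclp_induct)
    case base
    then show ?case using assms(2) path_pl walk_not_Nil path_image_pl_sub by simp
  next
    case (step y z)
    have "hmt p y" "hmt p z" using step(1,2) by (metis equivclp_into_equivclp hmt_def)+
    then have "walk y" "walk z" using hmt_walk assms(2) by blast+
    then have "homotopic_paths U (pl y) (pl z)" using step(2) pl_step homotopic_paths_sym by blast
    then show ?case using step(3) homotopic_paths_trans by blast
  qed
qed

lemma pl_append:
  "walk p \<Longrightarrow> walk q \<Longrightarrow> last p = hd q \<Longrightarrow> homotopic_paths U (pl (p @ q)) (pl p +++ pl q)"
proof (induction p rule: pl.induct)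
  case (2 x)
  then have "q \<noteq> []" "hd q = x" using walk_not_Nil by auto
  then have "pl ([x] @ q) = pl [x] +++ pl q" by (simp add: pl_Cons seg_const)
  moreover have "path_image (pl [x]) \<subseteq> U" using path_image_pl_sub 2 by blast
  ultimately show ?case
    using 2 path_pl[of "[x]"] path_pl[of q] path_image_pl_sub[of q] \<open>q \<noteq> []\<close>
    by (simp add: subset_path_image_join pathfinish_def)
next
  case (3 x y zs)
  have w: "R x y" "walk (y # zs)" using walk_Cons[of x "y # zs"] 3 by auto
  have nq: "q \<noteq> []" using 3 walk_not_Nil by blast
  have "homotopic_paths U (seg x y +++ pl ((y # zs) @ q)) (seg x y +++ (pl (y # zs) +++ pl q))"
    using 3(1)[OF w(2)] 3 w path_image_seg path_seg by (intro homotopic_paths_join) auto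
  also have "homotopic_paths U (seg x y +++ (pl (y # zs) +++ pl q)) ((seg x y +++ pl (y # zs)) +++ pl q)"
    using w 3 nq path_image_seg path_seg path_pl[of "y # zs"] path_pl[of q] path_image_pl_sub
    by (intro homotopic_paths_assoc) auto
  finally show ?case by simp
qed (simp add: walk_def)

lemma square_from_rectangle:
  assumes w: "walk S" "walk Q" "walk P" "walk T" and e: "last S = hd Q" "last P = hd T"
    and h: "hmt (S @ Q) (P @ T)"
  obtains \<Psi> where "continuous_on ({0..1} \<times> {0..1}) \<Psi>" "\<Psi> \<in> {0..1::real} \<times> {0..1::real} \<rightarrow> U"
    "\<And>t. t \<in> {0..1} \<Longrightarrow> \<Psi> (t, 0) \<in> path_image (pl S)" "\<And>t. t \<in> {0..1} \<Longrightarrow> \<Psi> (1, t) \<in> path_image (pl Q)"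
    "\<And>t. t \<in> {0..1} \<Longrightarrow> \<Psi> (0, t) \<in> path_image (pl P)" "\<And>t. t \<in> {0..1} \<Longrightarrow> \<Psi> (t, 1) \<in> path_image (pl T)"
proof -
  have ne: "S \<noteq> []" "Q \<noteq> []" "P \<noteq> []" "T \<noteq> []" using w walk_not_Nil by auto
  have "homotopic_paths U (pl S +++ pl Q) (pl (S @ Q))"
    using pl_append[OF w(1,2) e(1)] homotopic_paths_sym by blast
  also have "homotopic_paths U (pl (S @ Q)) (pl (P @ T))"
    using pl_hmt[OF h] walk_append[OF w(1,2) e(1)] by blast
  also have "homotopic_paths U (pl (P @ T)) (pl P +++ pl T)" using pl_append[OF w(3,4) e(2)] .
  finally have H: "homotopic_paths U (pl S +++ pl Q) (pl P +++ pl T)" .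
  then obtain H :: "real \<times> real \<Rightarrow> nat \<Rightarrow> real" where H0: "continuous_on ({0..1} \<times> {0..1}) H" "H \<in> ({0..1} \<times> {0..1}) \<rightarrow> U"
    "\<forall>x\<in>{0..1}. H (0, x) = (pl S +++ pl Q) x" "\<forall>x\<in>{0..1}. H (1, x) = (pl P +++ pl T) x"
    "\<forall>t\<in>{0..1}. pathstart (H \<circ> Pair t) = pathstart (pl S +++ pl Q) \<and>
      pathfinish (H \<circ> Pair t) = pathfinish (pl S +++ pl Q)"
    unfolding homotopic_paths by blast
  have H5: "H (t, 0) = pathstart (pl S +++ pl Q)" "H (t, 1) = pathfinish (pl S +++ pl Q)" if "t \<in> {0..1}" for t
    using bspec[OF H0(5) that] by (simp_all add: pathstart_def pathfinish_def)
  note H = H0(1,2) bspec[OF H0(3)] bspec[OF H0(4)] H5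
  have ends: "hd S = hd P" "last Q = last T"
    using homotopic_paths_imp_pathstart[OF \<open>homotopic_paths U (pl S +++ pl Q) (pl P +++ pl T)\<close>]
      homotopic_paths_imp_pathfinish[OF \<open>homotopic_paths U (pl S +++ pl Q) (pl P +++ pl T)\<close>] ne by auto
  \<comment> \<open>\<open>H\<close> is constant along the edges where its path parameter
    \<open>B\<close> is 0 or 1. Near the corner (0, 0) of the square \<open>B\<close> is 0 while
    \<open>A\<close> sweeps from 1 on the left side to 0 on the bottom, and likewise near (1, 1)
    with \<open>B = 1\<close>. At the corners (1, 0) and (0, 1) \<open>B\<close> is 1/2, where the
    joined paths meet.\<close>
  define A where "A z = max 0 (min 1 (1/2 + 2 * (snd z - fst z)))" for z :: "real \<times> real"
  define B where "B z = max 0 (min 1 ((fst z + snd z - 1/4) / (3/2)))" for z :: "real \<times> real"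
  have AB: "A z \<in> {0..1}" "B z \<in> {0..1}" for z by (auto simp: A_def B_def)
  have first: "(p +++ q) t \<in> path_image p" if "0 \<le> t" "t \<le> 1/2" for p q :: "real \<Rightarrow> nat \<Rightarrow> real" and t
    using that by (auto simp: joinpaths_def path_image_def)
  have second: "(p +++ q) t \<in> path_image q" if "1/2 \<le> t" "t \<le> 1" "pathfinish p = pathstart q"
    for p q :: "real \<Rightarrow> nat \<Rightarrow> real" and t
  proof (cases "t = 1/2")
    case True
    then have "(p +++ q) t = pathstart q" using that(3) unfolding True by (simp add: joinpaths_def pathfinish_def)
    then show ?thesis by (simp add: pathstart_in_path_image)
  next
    case False
    then show ?thesis using that by (auto simp: joinpaths_def path_image_def)
  qed
  have endpts: "hd S \<in> path_image (pl S)" "hd P \<in> path_image (pl P)" "last Q \<in> path_image (pl Q)" "last T \<in> path_image (pl T)"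
    using pathstart_in_path_image[of "pl S"] pathstart_in_path_image[of "pl P"]
      pathfinish_in_path_image[of "pl Q"] pathfinish_in_path_image[of "pl T"] ne by auto
  have lo: "H (a, 0) = hd S" if "a \<in> {0..1}" for a using H(5)[OF that] ne by simp
  have hi: "H (a, 1) = last Q" if "a \<in> {0..1}" for a using H(6)[OF that] ne by simp
  show thesis
  proof
    let ?\<Psi> = "\<lambda>z. H (A z, B z)"
    show "continuous_on ({0..1} \<times> {0..1}) ?\<Psi>"
      using AB unfolding A_def B_def
      by (intro continuous_on_compose2[OF H(1)] continuous_intros) auto
    show "?\<Psi> \<in> {0..1} \<times> {0..1} \<rightarrow> U" using H(2) AB by blast
    fix t :: real assume t: "t \<in> {0..1}"
    show "?\<Psi> (t, 0) \<in> path_image (pl S)"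
    proof (cases "t \<le> 1/4")
      case True
      then have "B (t, 0) = 0" by (simp add: B_def)
      then show ?thesis using lo AB endpts by simp
    next
      case False
      then have "A (t, 0) = 0" "B (t, 0) \<le> 1/2" using t by (auto simp: A_def B_def)
      then show ?thesis using first[of "B (t, 0)"] H(3) AB by simp
    qed
    show "?\<Psi> (1, t) \<in> path_image (pl Q)"
    proof (cases "t \<ge> 3/4")
      case True
      then have "B (1, t) = 1" by (simp add: B_def)
      then show ?thesis using hi AB endpts by simp
    next
      case False
      then have "A (1, t) = 0" "B (1, t) \<ge> 1/2" using t by (auto simp: A_def B_def)
      then show ?thesis using second[of "B (1, t)" "pl S" "pl Q"] H(3) AB e ne by simp
    qed
    show "?\<Psi> (0, t) \<in> path_image (pl P)"
    proof (cases "t \<le> 1/4")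
      case True
      then have "B (0, t) = 0" by (simp add: B_def)
      then show ?thesis using lo AB endpts ends by simp
    next
      case False
      then have "A (0, t) = 1" "B (0, t) \<le> 1/2" using t by (auto simp: A_def B_def)
      then show ?thesis using first[of "B (0, t)"] H(4) AB by simp
    qed
    show "?\<Psi> (t, 1) \<in> path_image (pl T)"
    proof (cases "t \<ge> 3/4")
      case True
      then have "B (t, 1) = 1" by (simp add: B_def)
      then show ?thesis using hi AB endpts ends by simp
    next
      case False
      then have "A (t, 1) = 1" "B (t, 1) \<ge> 1/2" using t by (auto simp: A_def B_def)
      then show ?thesis using second[of "B (t, 1)" "pl P" "pl T"] H(4) AB e ne by simp
    qed
  qed
qed

end

section \<open>Discretised segments\<close>

lemma seg_lipschitz:
  assumes "a \<in> hcube" "b \<in> hcube" shows "\<bar>seg a b t k - seg a b t' k\<bar> \<le> \<bar>t - t'\<bar>"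
proof -
  have "\<bar>b k - a k\<bar> \<le> 1" using assms unfolding hcube_def by (smt (verit) mem_Collect_eq)
  moreover have "seg a b t k - seg a b t' k = (t - t') * (b k - a k)" by (simp add: seg_def algebra_simps)
  ultimately show ?thesis by (simp add: abs_mult mult_left_le)
qed

lemma seg_lipschitz_ends:
  assumes "0 \<le> t" "t \<le> 1" "\<bar>x k - x' k\<bar> \<le> d" "\<bar>y k - y' k\<bar> \<le> d"
  shows "\<bar>seg x y t k - seg x' y' t k\<bar> \<le> d"
proof -
  have "seg x y t k - seg x' y' t k = (1 - t) * (x k - x' k) + t * (y k - y' k)"
    by (simp add: seg_def algebra_simps)
  then have "\<bar>seg x y t k - seg x' y' t k\<bar> \<le> (1 - t) * \<bar>x k - x' k\<bar> + t * \<bar>y k - y' k\<bar>"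
    using abs_triangle_ineq[of "(1 - t) * (x k - x' k)" "t * (y k - y' k)"] assms(1,2) by (simp add: abs_mult)
  also have "\<dots> \<le> d" using assms by (intro convex_bound_le) auto
  finally show ?thesis .
qed

definition seg_walk :: "nat \<Rightarrow> (nat \<Rightarrow> real) \<Rightarrow> (nat \<Rightarrow> real) \<Rightarrow> (nat \<Rightarrow> real) list" where
  "seg_walk n a b = map (\<lambda>i. seg a b (real i / real n)) [0..<Suc n]"

lemma length_seg_walk [simp]: "length (seg_walk n a b) = Suc n"
  by (simp add: seg_walk_def)

lemma nth_seg_walk: "i \<le> n \<Longrightarrow> seg_walk n a b ! i = seg a b (real i / real n)"
  by (simp add: seg_walk_def nth_append)

lemma hd_seg_walk: "hd (seg_walk n a b) = a"
  using nth_seg_walk[of 0 n a b] hd_conv_nth[of "seg_walk n a b"] by (simp add: seg_walk_def)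

lemma last_seg_walk: "0 < n \<Longrightarrow> last (seg_walk n a b) = b"
  by (simp add: seg_walk_def)

lemma set_seg_walk:
  assumes "x \<in> set (seg_walk n a b)" shows "\<exists>t. 0 \<le> t \<and> t \<le> 1 \<and> x = seg a b t"
proof -
  obtain i where "i \<le> n" "x = seg a b (real i / real n)"
    using assms nth_seg_walk by (metis in_set_conv_nth length_seg_walk less_Suc_eq_le)
  then show ?thesis by (intro exI[of _ "real i / real n"]) (auto simp: divide_le_eq_1)
qed

context cube_complex
begin

lemma hmt_replicate: "walk p \<Longrightarrow> hmt (p @ replicate k (last p)) p"
proof (induction k)
  case (Suc k)
  have "hmt ((p @ [last p]) @ replicate k (last p)) (p @ replicate k (last p))"
    using hmt_append[OF hmt_dup_last[OF Suc.prems] hmt_refl] .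
  then show ?case using Suc hmt_trans by fastforce
qed simp

lemma walk_of_small_steps:
  assumes "p \<noteq> []" "set p \<subseteq> W" "\<And>i. Suc i < length p \<Longrightarrow> dist (p ! i) (p ! Suc i) < s"
  shows "walk p"
  using assms unfolding walk_def successively_conv_nth R_def by (auto simp: subset_iff)

lemma walk_seg_walk:
  assumes n: "0 < n" "4 < s * real n" and ab: "a \<in> hcube" "b \<in> hcube" "dist b a < \<rho>"
    and W: "\<And>z. z \<in> hcube \<Longrightarrow> dist z a < \<rho> \<Longrightarrow> z \<in> W"
  shows "walk (seg_walk n a b)"
proof (rule walk_of_small_steps)
  show "seg_walk n a b \<noteq> []" by (simp add: seg_walk_def)
  have \<rho>: "dist a a < \<rho>" using ab(3) zero_le_dist[of b a] unfolding dist_self by linarith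
  show "set (seg_walk n a b) \<subseteq> W"
    using set_seg_walk seg_in_hcube[OF ab(1,2)] dist_seg_less[OF ab(1,2,1)] \<rho> ab W by blast
  fix i assume i: "Suc i < length (seg_walk n a b)"
  have "dist (seg a b (real i / real n)) (seg a b (real (Suc i) / real n)) \<le> 2 * (1 / real n)"
  proof (rule dist_fun_le)
    fix k
    have "\<bar>real i / real n - real (Suc i) / real n\<bar> = 1 / real n"
      using n by (simp add: diff_divide_distrib[symmetric])
    then show "\<bar>seg a b (real i / real n) k - seg a b (real (Suc i) / real n) k\<bar> \<le> 1 / real n"
      using seg_lipschitz[OF ab(1,2)] by metis
  qed
  also have "\<dots> < s" using n by (simp add: field_simps)
  finally show "dist (seg_walk n a b ! i) (seg_walk n a b ! Suc i) < s"
    using i by (simp add: nth_seg_walk)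
qed

text \<open>The walks \<open>M j\<close> interpolate between the broken walk \<open>P\<close> and
  the direct walk \<open>Q\<close> within a convex ball about \<open>a\<close>, hence in
  \<open>W\<close>. One stage moves a point by at most \<open>1 / n\<close> per coordinate and a
  diagonal step by \<open>2 / n\<close>; with the factor of \<open>dist_fun_le\<close> this explains
  the bound \<open>4 < s * real n\<close>.\<close>

lemma seg_walk_triangle:
  assumes n: "0 < n" "4 < s * real n" and cube: "a \<in> hcube" "b \<in> hcube" "d \<in> hcube"
    and near: "dist b a < \<rho>" "dist d a < \<rho>"
    and W: "\<And>z. z \<in> hcube \<Longrightarrow> dist z a < \<rho> \<Longrightarrow> z \<in> W"
  shows "hmt (seg_walk n a b @ seg_walk n b d) (seg_walk n a d)"
proof -
  define P where "P = seg_walk n a b @ seg_walk n b d"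
  \<comment> \<open>Waiting at \<open>d\<close> gives both walks the same length, as pointwise
    interpolation requires.\<close>
  define Q where "Q = seg_walk n a d @ replicate (Suc n) d"
  define L where "L = 2 * Suc n"
  have len: "length P = L" "length Q = L" by (auto simp: P_def Q_def L_def)
  have \<rho>: "dist a a < \<rho>" using near(1) zero_le_dist[of b a] unfolding dist_self by linarith
  define N where "N = {z \<in> hcube. dist z a < \<rho>}"
  have Nseg: "seg x y t \<in> N" if "x \<in> N" "y \<in> N" "0 \<le> t" "t \<le> 1" for x y t
    using that seg_in_hcube dist_seg_less cube(1) by (auto simp: N_def)
  have N: "a \<in> N" "b \<in> N" "d \<in> N" using \<rho> near cube by (auto simp: N_def)
  have sN: "set (seg_walk n x y) \<subseteq> N" if "x \<in> N" "y \<in> N" for x y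
    using set_seg_walk Nseg that by blast
  have PN: "set P \<subseteq> N" "set Q \<subseteq> N" using sN N by (auto simp: P_def Q_def)
  have hP: "P ! 0 = a" "Q ! 0 = a" "P ! (L - 1) = d" "Q ! (L - 1) = d"
    using n by (auto simp: P_def Q_def L_def nth_append nth_seg_walk)
  have one: "\<bar>seg x y (real i / real n) k - seg x y (real (Suc i) / real n) k\<bar> \<le> 1 / real n"
    if "x \<in> N" "y \<in> N" for x y i k
  proof -
    have "\<bar>real i / real n - real (Suc i) / real n\<bar> = 1 / real n"
      using n by (simp add: diff_divide_distrib[symmetric])
    then show ?thesis using seg_lipschitz[of x y "real i / real n" k "real (Suc i) / real n"] that
      by (simp add: N_def)
  qed
  have stepP: "\<bar>(P ! i) k - (P ! Suc i) k\<bar> \<le> 1 / real n" if "Suc i < L" for i k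
  proof -
    consider "Suc i \<le> n" | "i = n" | "i > n" by linarith
    then show ?thesis
    proof cases
      case 1
      then show ?thesis using one[OF N(1,2), of i k] by (simp add: P_def nth_append nth_seg_walk)
    next
      case 2
      then show ?thesis using n by (simp add: P_def nth_append nth_seg_walk)
    next
      case 3
      define j where "j = i - Suc n"
      have j: "i = Suc n + j" "Suc j \<le> n" using 3 that by (auto simp: j_def L_def)
      then show ?thesis using one[OF N(2,3), of j k] by (simp add: P_def nth_append nth_seg_walk)
    qed
  qed
  have stepQ: "\<bar>(Q ! i) k - (Q ! Suc i) k\<bar> \<le> 1 / real n" if "Suc i < L" for i k
  proof -
    consider "Suc i \<le> n" | "i = n" | "i > n" by linarith
    then show ?thesis
    proof cases
      case 1
      then show ?thesis using one[OF N(1,3), of i k] by (simp add: Q_def nth_append nth_seg_walk)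
    next
      case 2
      then show ?thesis using n by (simp add: Q_def nth_append nth_seg_walk)
    next
      case 3
      then have "i - Suc n < Suc n" "Suc i - Suc n < Suc n" using that by (auto simp: L_def)
      then show ?thesis using 3 n by (simp add: Q_def nth_append del: replicate.simps)
    qed
  qed
  define M where "M j = map (\<lambda>i. seg (P ! i) (Q ! i) (real j / real n)) [0..<L]" for j
  have lenM: "length (M j) = L" for j by (simp add: M_def)
  have nthM: "M j ! i = seg (P ! i) (Q ! i) (real j / real n)" if "i < L" for i j using that by (simp add: M_def)
  have Lpos: "0 < L" by (simp add: L_def)
  have PQi: "P ! i \<in> N" "Q ! i \<in> N" if "i < L" for i
    using nth_mem[of i P] nth_mem[of i Q] PN len that by (simp_all add: subset_iff)
  have MN: "M j ! i \<in> N" if "i < L" "j \<le> n" for i j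
    using Nseg[of "P ! i" "Q ! i" "real j / real n"] PQi[OF that(1)] that n by (simp add: nthM)
  have MW: "M j ! i \<in> W" if "i < L" "j \<le> n" for i j using MN[OF that] W by (simp add: N_def)
  have R: "R x y" if "x \<in> W" "y \<in> W" "\<And>k. \<bar>x k - y k\<bar> \<le> 2 / real n" for x y
  proof -
    have "dist x y \<le> 2 * (2 / real n)" using that(3) by (rule dist_fun_le)
    also have "\<dots> < s" using n by (simp add: field_simps)
    finally show ?thesis using that by (simp add: R_def)
  qed
  have le2: "1 / real n \<le> 2 / real n" by (simp add: divide_right_mono)
  have Mi: "\<bar>(M j ! i) k - (M j ! Suc i) k\<bar> \<le> 1 / real n" if "Suc i < L" "j \<le> n" for i j k
    using seg_lipschitz_ends[of "real j / real n" "P ! i" k "P ! Suc i" "1 / real n" "Q ! i" "Q ! Suc i"]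
      stepP[OF that(1), of k] stepQ[OF that(1), of k] that n by (simp add: nthM)
  have Mj: "\<bar>(M j ! i) k - (M (Suc j) ! i) k\<bar> \<le> 1 / real n" if "i < L" for i j k
    using one[OF PQi[OF that], of j k] that by (simp add: nthM)
  have hM: "hd (M j) = a" "last (M j) = d" for j
    using Lpos lenM[of j] nthM[of 0 j] nthM[of "L - 1" j] hP
    by (auto simp: hd_conv_nth last_conv_nth simp flip: length_greater_0_conv)
  have "hmt P (M j)" if "j \<le> n" for j
    using that
  proof (induction j)
    case 0
    have "M 0 = P" by (rule nth_equalityI) (auto simp: lenM len nthM)
    then show ?case by simp
  next
    case (Suc j)
    have "hmt (M j) (M (Suc j))"
    proof (rule fellow_travellers_same_ends)
      show "M j \<noteq> []" using Lpos lenM[of j] by auto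
      show "R (M j ! i) (M (Suc j) ! i)" if "i < length (M j)" for i
        using that Suc.prems Mj[of i j] le2 MW by (intro R) (auto simp: lenM intro: order_trans)
      fix i assume i: "Suc i < length (M j)"
      have 1: "\<bar>(M j ! i) k - (M (Suc j) ! Suc i) k\<bar> \<le> 2 / real n" for k
        using Mj[of i j k] Mi[of i "Suc j" k] i Suc.prems by (simp add: lenM)
      show "R (M j ! i) (M j ! Suc i) \<and> R (M (Suc j) ! i) (M (Suc j) ! Suc i) \<and> R (M j ! i) (M (Suc j) ! Suc i)"
        using i Suc.prems Mi[of i j] Mi[of i "Suc j"] le2 MW 1
        by (intro conjI R) (auto simp: lenM intro: order_trans)
    qed (use hM lenM in auto)
    then show ?case using hmt_trans[of P "M j"] Suc by simp
  qed
  then have "hmt P (M n)" by simp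
  moreover have "M n = Q" using n by (intro nth_equalityI) (auto simp: lenM len nthM)
  moreover have "hmt Q (seg_walk n a d)"
    using hmt_replicate[OF walk_seg_walk[OF n cube(1,3) near(2) W], of "Suc n"] n
    unfolding Q_def by (simp add: last_seg_walk)
  ultimately show ?thesis unfolding P_def using hmt_trans by metis
qed

end

section \<open>Circle-valued maps from integer cocycles\<close>

lemma convex_sum_bounds:
  fixes l f :: "'a \<Rightarrow> real"
  assumes "finite V" "\<And>b. b \<in> V \<Longrightarrow> 0 \<le> l b" "0 < sum l V" "\<And>b. b \<in> V \<Longrightarrow> 0 < l b \<Longrightarrow> lo \<le> f b \<and> f b \<le> hi"
  shows "lo \<le> (\<Sum>b\<in>V. l b * f b) / sum l V" "(\<Sum>b\<in>V. l b * f b) / sum l V \<le> hi"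
proof -
  have "l b * lo \<le> l b * f b \<and> l b * f b \<le> l b * hi" if "b \<in> V" for b
    using assms(2,4)[OF that] by (cases "l b = 0") (auto simp: less_le mult_left_mono)
  then have "sum l V * lo \<le> (\<Sum>b\<in>V. l b * f b)" "(\<Sum>b\<in>V. l b * f b) \<le> sum l V * hi"
    by (auto simp: sum_distrib_right intro!: sum_mono)
  then show "lo \<le> (\<Sum>b\<in>V. l b * f b) / sum l V" "(\<Sum>b\<in>V. l b * f b) / sum l V \<le> hi"
    using assms(3) by (auto simp: field_simps)
qed

text \<open>Seen from a vertex \<open>a\<close>, the angle is a weighted mean of
  \<open>\<theta> b + 2 * pi * n a b\<close> over the nearby vertices \<open>b\<close>. Another
  vertex shifts all these values by the same multiple of \<open>2 * pi\<close>, so cosine and sine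
  are well defined. The clause with \<open>lo\<close> and \<open>hi\<close> records that the mean
  lies in every interval containing the values; signs are read off from it.\<close>

lemma circle_map_from_cocycle:
  fixes K :: "'b::metric_space set" and n :: "'b \<Rightarrow> 'b \<Rightarrow> int" and \<theta> :: "'b \<Rightarrow> real"
  assumes V: "finite V" and cover: "\<And>x. x \<in> K \<Longrightarrow> \<exists>a\<in>V. dist x a < \<rho>"
    and n: "\<And>a b d. a \<in> V \<Longrightarrow> b \<in> V \<Longrightarrow> d \<in> V \<Longrightarrow> dist a b < 2 * \<rho> \<Longrightarrow> dist b d < 2 * \<rho> \<Longrightarrow> dist a d < 2 * \<rho> \<Longrightarrow>
      n a b + n b d = n a d"
  obtains u' v' where "continuous_on K u'" "continuous_on K v'"
    "\<forall>x\<in>K. \<exists>a\<in>V. dist x a < \<rho> \<and> (\<forall>lo hi. (\<forall>b\<in>V. dist x b < \<rho> \<longrightarrow>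
       lo \<le> \<theta> b + 2 * pi * n a b \<and> \<theta> b + 2 * pi * n a b \<le> hi) \<longrightarrow>
       (\<exists>t. lo \<le> t \<and> t \<le> hi \<and> u' x = cos t \<and> v' x = sin t))"
proof -
  define l where "l b x = max 0 (\<rho> - dist x b)" for b x :: 'b
  define L where "L x = (\<Sum>b\<in>V. l b x)" for x
  define \<Theta> where "\<Theta> a x = (\<Sum>b\<in>V. l b x * (\<theta> b + 2 * pi * n a b)) / L x" for a x
  have l0: "0 \<le> l b x" "0 < l b x \<longleftrightarrow> dist x b < \<rho>" for b x by (auto simp: l_def)
  have L0: "0 < L x" if x: "x \<in> K" for x
  proof -
    obtain a where "a \<in> V" "dist x a < \<rho>" using cover[OF x] by blast
    then show ?thesis unfolding L_def using V l0 by (intro sum_pos2[of _ a]) auto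
  qed
  have cont\<Theta>: "continuous_on K (\<Theta> a)" for a
  proof -
    have "L x \<noteq> 0" if "x \<in> K" for x using L0[OF that] by simp
    then show ?thesis unfolding \<Theta>_def[abs_def] L_def l_def
      by (intro continuous_intros) auto
  qed
  have change: "\<Theta> a x = \<Theta> a' x + of_int (n a a') * (2 * pi)"
    if "x \<in> K" "a \<in> V" "a' \<in> V" "dist x a < \<rho>" "dist x a' < \<rho>" for a a' x
  proof -
    have near: "dist p q < 2 * \<rho>" if "dist x p < \<rho>" "dist x q < \<rho>" for p q
      using that dist_triangle2[of p q x] by (simp add: dist_commute)
    have "l b x * (\<theta> b + 2 * pi * n a b) = l b x * (\<theta> b + 2 * pi * n a' b) + l b x * (of_int (n a a') * (2 * pi))"
      if b: "b \<in> V" for b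
    proof (cases "dist x b < \<rho>")
      case True
      then have "n a b = n a a' + n a' b"
        using n[of a a' b] near \<open>a \<in> V\<close> \<open>a' \<in> V\<close> \<open>dist x a < \<rho>\<close> \<open>dist x a' < \<rho>\<close> b by simp
      then show ?thesis by (simp add: algebra_simps)
    qed (simp add: l_def)
    then have "(\<Sum>b\<in>V. l b x * (\<theta> b + 2 * pi * n a b)) =
      (\<Sum>b\<in>V. l b x * (\<theta> b + 2 * pi * n a' b)) + L x * (of_int (n a a') * (2 * pi))"
      by (simp add: sum.distrib L_def sum_distrib_right)
    then show ?thesis using L0[OF \<open>x \<in> K\<close>] by (simp add: \<Theta>_def add_divide_distrib)
  qed
  \<comment> \<open>An arbitrary nearby vertex. Around a given point it can be frozen without
    changing periodic functions of the angle, which yields continuity although the choice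
    jumps.\<close>
  define pick where "pick x = (SOME a. a \<in> V \<and> dist x a < \<rho>)" for x
  have pick: "pick x \<in> V \<and> dist x (pick x) < \<rho>" if "x \<in> K" for x
    unfolding pick_def by (rule someI_ex) (use cover[OF that] in blast)
  have glue: "continuous_on K (\<lambda>x. f (\<Theta> (pick x) x))"
    if f: "continuous_on UNIV f" "\<And>t i. f (t + of_int i * (2 * pi)) = f t" for f :: "real \<Rightarrow> real"
    unfolding continuous_on_eq_continuous_within
  proof
    fix x assume x: "x \<in> K"
    let ?a = "pick x"
    have "continuous_on K (\<lambda>y. f (\<Theta> ?a y))"
      using continuous_on_compose2[OF f(1) cont\<Theta>] by blast
    then have "continuous (at x within K) (\<lambda>y. f (\<Theta> ?a y))"
      using x by (simp add: continuous_on_eq_continuous_within)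
    then show "continuous (at x within K) (\<lambda>x. f (\<Theta> (pick x) x))"
    proof (rule continuous_transform_within[where \<delta> = "\<rho> - dist x ?a"])
      show "0 < \<rho> - dist x ?a" using pick[OF x] by simp
      fix y assume y: "y \<in> K" "dist y x < \<rho> - dist x ?a"
      then have "dist y ?a < \<rho>" using dist_triangle[of y ?a x] by linarith
      then show "f (\<Theta> ?a y) = f (\<Theta> (pick y) y)"
        using change[OF y(1), of ?a "pick y"] pick[OF x] pick[OF y(1)] f(2) by simp
    qed (use x in auto)
  qed
  have per: "cos (t + real_of_int i * (2 * pi)) = cos t" "sin (t + real_of_int i * (2 * pi)) = sin t" for t i
    using sin_cos_eq_iff[of "t + real_of_int i * (2 * pi)" t] by (auto simp: mult.commute)
  show thesis
  proof (rule that)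
    show "continuous_on K (\<lambda>x. cos (\<Theta> (pick x) x))"
      by (rule glue) (auto intro!: continuous_intros simp: per)
    show "continuous_on K (\<lambda>x. sin (\<Theta> (pick x) x))"
      by (rule glue) (auto intro!: continuous_intros simp: per)
    show "\<forall>x\<in>K. \<exists>a\<in>V. dist x a < \<rho> \<and> (\<forall>lo hi. (\<forall>b\<in>V. dist x b < \<rho> \<longrightarrow>
       lo \<le> \<theta> b + 2 * pi * n a b \<and> \<theta> b + 2 * pi * n a b \<le> hi) \<longrightarrow>
       (\<exists>t. lo \<le> t \<and> t \<le> hi \<and> cos (\<Theta> (pick x) x) = cos t \<and> sin (\<Theta> (pick x) x) = sin t))"
    proof
    fix x assume x: "x \<in> K"
    have "lo \<le> \<Theta> (pick x) x \<and> \<Theta> (pick x) x \<le> hi"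
      if "\<forall>b\<in>V. dist x b < \<rho> \<longrightarrow> lo \<le> \<theta> b + 2 * pi * n (pick x) b \<and> \<theta> b + 2 * pi * n (pick x) b \<le> hi" for lo hi
      using convex_sum_bounds[OF V, of "\<lambda>b. l b x" lo "\<lambda>b. \<theta> b + 2 * pi * n (pick x) b" hi] l0 that L0[OF x]
      unfolding \<Theta>_def L_def by blast
    then show "\<exists>a\<in>V. dist x a < \<rho> \<and> (\<forall>lo hi. (\<forall>b\<in>V. dist x b < \<rho> \<longrightarrow>
       lo \<le> \<theta> b + 2 * pi * n a b \<and> \<theta> b + 2 * pi * n a b \<le> hi) \<longrightarrow>
       (\<exists>t. lo \<le> t \<and> t \<le> hi \<and> cos (\<Theta> (pick x) x) = cos t \<and> sin (\<Theta> (pick x) x) = sin t))"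
      using pick[OF x] by blast
    qed
  qed
qed

section \<open>Squares in compact subsets of the Hilbert cube\<close>

definition has_square :: "'b::topological_space set \<Rightarrow> bool" where
  "has_square K \<longleftrightarrow> (\<exists>\<Psi> u v \<alpha> \<beta> \<gamma> \<delta>. continuous_on ({0..1} \<times> {0..1}) \<Psi> \<and>
     \<Psi> \<in> {0..1::real} \<times> {0..1::real} \<rightarrow> K \<and> continuous_on K u \<and> continuous_on K v \<and> \<alpha> < (\<beta>::real) \<and> \<gamma> < (\<delta>::real) \<and>
     (\<forall>t\<in>{0..1}. u (\<Psi> (0, t)) \<le> \<alpha> \<and> \<beta> \<le> u (\<Psi> (1, t)) \<and> v (\<Psi> (t, 0)) \<le> \<gamma> \<and> \<delta> \<le> v (\<Psi> (t, 1))))"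

lemma compact_common_modulus:
  fixes f g :: "'b::metric_space \<Rightarrow> real"
  assumes "compact S" "continuous_on S f" "continuous_on S g" "0 < d"
  obtains s where "0 < s" "\<And>x y. x \<in> S \<Longrightarrow> y \<in> S \<Longrightarrow> dist x y < s \<Longrightarrow> \<bar>f x - f y\<bar> < d \<and> \<bar>g x - g y\<bar> < d"
proof -
  have "uniformly_continuous_on S f" "uniformly_continuous_on S g"
    using assms compact_uniformly_continuous by auto
  then obtain s1 s2 where s: "0 < s1" "0 < s2"
    "\<And>x y. x \<in> S \<Longrightarrow> y \<in> S \<Longrightarrow> dist x y < s1 \<Longrightarrow> dist (f x) (f y) < d"
    "\<And>x y. x \<in> S \<Longrightarrow> y \<in> S \<Longrightarrow> dist x y < s2 \<Longrightarrow> dist (g x) (g y) < d"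
    using assms(4) unfolding uniformly_continuous_on_def by (metis dist_commute)
  show thesis by (rule that[of "min s1 s2"]) (use s in \<open>auto simp: dist_real_def\<close>)
qed

theorem square_or_unstable:
  fixes K :: "(nat \<Rightarrow> real) set"
  assumes K: "compact K" "K \<subseteq> hcube"
    and ret: "\<And>\<epsilon>. 0 < \<epsilon> \<Longrightarrow> \<exists>U r \<eta>. compact U \<and> 0 < \<eta> \<and> (\<forall>k\<in>K. \<forall>y\<in>hcube. dist y k < \<eta> \<longrightarrow> y \<in> U) \<and>
      continuous_on U r \<and> r \<in> U \<rightarrow> K \<and> (\<forall>k\<in>K. dist k (r k) < \<epsilon>)"
    and nosq: "\<not> has_square K"
  shows "unstable_pairs K"
  unfolding unstable_pairs_def
proof (intro allI impI, elim conjE)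
  fix u v :: "(nat \<Rightarrow> real) \<Rightarrow> real" and e :: real
  assume u: "continuous_on K u" and v: "continuous_on K v" and e: "0 < e"
  obtain \<epsilon> where \<epsilon>: "0 < \<epsilon>" "\<And>x y. x \<in> K \<Longrightarrow> y \<in> K \<Longrightarrow> dist x y < \<epsilon> \<Longrightarrow> \<bar>u x - u y\<bar> < e/4 \<and> \<bar>v x - v y\<bar> < e/4"
    using compact_common_modulus[OF K(1) u v, of "e/4"] e by auto
  obtain U r \<eta> where U: "compact U" "0 < \<eta>" "\<And>k y. k \<in> K \<Longrightarrow> y \<in> hcube \<Longrightarrow> dist y k < \<eta> \<Longrightarrow> y \<in> U"
    and r: "continuous_on U r" "r \<in> U \<rightarrow> K" "\<And>k. k \<in> K \<Longrightarrow> dist k (r k) < \<epsilon>"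
    using ret[OF \<epsilon>(1)] by blast
  define fu where "fu y = u (r y)" for y
  define fv where "fv y = v (r y)" for y
  have cf: "continuous_on U fu" "continuous_on U fv"
    unfolding fu_def fv_def using continuous_on_compose2[OF u r(1)] continuous_on_compose2[OF v r(1)] r(2) by auto
  have KU: "K \<subseteq> U" using U(2,3) K(2) by fastforce
  obtain s1 where s1: "0 < s1" "\<And>x y. x \<in> U \<Longrightarrow> y \<in> U \<Longrightarrow> dist x y < s1 \<Longrightarrow> \<bar>fu x - fu y\<bar> < e/4 \<and> \<bar>fv x - fv y\<bar> < e/4"
    using compact_common_modulus[OF U(1) cf, of "e/4"] e by auto
  \<comment> \<open>Edges of the net are shorter than \<open>2 * \<rho>\<close>: at most
    \<open>s1\<close>, so that \<open>fu\<close> and \<open>fv\<close> vary by less than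
    \<open>e/4\<close> from the start of an edge, and at most \<open>\<eta> / 2\<close>, so that
    edges run in \<open>W\<close>.\<close>
  define \<rho> where "\<rho> = min (\<eta> / 2) s1 / 2"
  have \<rho>: "0 < \<rho>" "2 * \<rho> \<le> \<eta> / 2" "2 * \<rho> \<le> s1" using U(2) s1(1) by (auto simp: \<rho>_def)
  obtain V where V: "V \<subseteq> K" "finite V" "K \<subseteq> (\<Union>a\<in>V. ball a \<rho>)"
    using compactE_image[OF K(1), of K "\<lambda>a. ball a \<rho>"] \<rho>(1) by (metis UN_I centre_in_ball open_ball subsetI)
  define M where "M = real (card V ^ 3 + card V + 1)"
  have M: "0 < M" by (simp add: M_def add_pos_nonneg)
  \<comment> \<open>Makes the room \<open>7 * \<kappa> * M\<close> required by the pigeonhole equal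
    to the length \<open>e/2\<close> of the interval from \<open>- (e/4)\<close> to
    \<open>e/4\<close>.\<close>
  define \<kappa> where "\<kappa> = e / (14 * M)"
  have \<kappa>: "0 < \<kappa>" using M e by (simp add: \<kappa>_def)
  have \<kappa>M: "7 * \<kappa> * M \<le> 2 * (e/4)" using M by (simp add: \<kappa>_def)
  \<comment> \<open>Variation allowed at distance below \<open>s\<close>: \<open>\<kappa>\<close>
    for the oscillation of steps and for the gap between the layers, \<open>e/8\<close> to keep the
    other two sides of the square apart.\<close>
  define \<tau> where "\<tau> = min \<kappa> (e/8)"
  have \<tau>: "0 < \<tau>" "\<tau> \<le> \<kappa>" "\<tau> \<le> e/8" using \<kappa> e by (auto simp: \<tau>_def)
  obtain s2 where s2: "0 < s2" "\<And>x y. x \<in> U \<Longrightarrow> y \<in> U \<Longrightarrow> dist x y < s2 \<Longrightarrow> \<bar>fu x - fu y\<bar> < \<tau> \<and> \<bar>fv x - fv y\<bar> < \<tau>"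
    using compact_common_modulus[OF U(1) cf \<tau>(1)] by auto
  define s where "s = min s2 (\<eta> / 2)"
  have s: "0 < s" "s \<le> s2" "s \<le> \<eta> / 2" using s2(1) U(2) by (auto simp: s_def)
  \<comment> \<open>Half of \<open>\<eta>\<close> is spent on the vertices, the other half on the
    simplices and paths around them.\<close>
  define W where "W = {y \<in> hcube. \<exists>k\<in>K. dist y k < \<eta> / 2}"
  interpret cube_complex W U s
  proof
    fix x z assume "x \<in> W" and z: "z \<in> hcube" "dist z x < s"
    then obtain k where k: "k \<in> K" "dist x k < \<eta> / 2" by (auto simp: W_def)
    have "dist z k < \<eta>" using dist_triangle[of z k x] z(2) k(2) s(3) by simp
    then show "z \<in> U" using U(3) k(1) z(1) by blast
  qed (use s in \<open>auto simp: W_def\<close>)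
  obtain n where n: "4 / s < real n" using reals_Archimedean2 by blast
  have n0: "0 < n" using n s(1) by (metis divide_pos_pos gr0I of_nat_0 order_less_asym zero_less_numeral)
  have n4: "4 < s * real n" using n s(1) by (simp add: field_simps)
  define E where "E a b \<longleftrightarrow> a \<in> V \<and> b \<in> V \<and> dist a b < 2 * \<rho>" for a b
  have Ecube: "a \<in> hcube" "b \<in> hcube" "dist b a < 2 * \<rho>" if "E a b" for a b
    using that V(1) K(2) by (auto simp: E_def dist_commute)
  have nearW: "z \<in> W" if "a \<in> V" "z \<in> hcube" "dist z a < 2 * \<rho>" for a z
    using that V(1) \<rho>(2) by (auto simp: W_def intro!: bexI[of _ a])
  define Rt where "Rt a \<longleftrightarrow> e/2 \<le> fu a" for a
  define Lf where "Lf a \<longleftrightarrow> fu a \<le> - (e/2)" for a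
  interpret coarse_complex W R fv \<kappa> V E "seg_walk n" Rt Lf
  proof
    show "\<bar>fv x - fv y\<bar> < \<kappa>" if "R x y" for x y
    proof -
      have "x \<in> U" "y \<in> U" "dist x y < s2" using that W_sub_U s(2) by (auto simp: R_def)
      then show ?thesis using s2(2)[of x y] \<tau>(2) by linarith
    qed
    show "hmt (seg_walk n a a) [a]" if "a \<in> V" for a
    proof -
      have "seg_walk n a a = [a] @ replicate n a"
        by (intro nth_equalityI) (auto simp: nth_seg_walk nth_append nth_Cons split: nat.splits)
      moreover have "a \<in> W" using nearW[OF that] that V(1) K(2) \<rho>(1) by auto
      ultimately show ?thesis using hmt_replicate[of "[a]" n] walk_single by simp
    qed
    show "walk (seg_walk n a b)" if "E a b" for a b
      using that Ecube[OF that] nearW by (intro walk_seg_walk[OF n0 n4, where \<rho> = "2 * \<rho>"]) (auto simp: E_def)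
    show "hmt (seg_walk n a b @ seg_walk n b d) (seg_walk n a d)" if "E a b" "E b d" "E a d" for a b d
      using that Ecube[OF that(1)] Ecube[OF that(3)] nearW
      by (intro seg_walk_triangle[OF n0 n4, where \<rho> = "2 * \<rho>"]) (auto simp: E_def)
  qed (use V \<kappa> \<rho> n0 in \<open>auto simp: E_def dist_commute hd_seg_walk last_seg_walk\<close>)
  have onedge: "x \<in> U \<and> \<bar>fu x - fu a\<bar> < e/4 \<and> \<bar>fv x - fv a\<bar> < e/4" if ab: "E a b" and x: "x \<in> set (seg_walk n a b)" for a b x
  proof -
    obtain t where t: "0 \<le> t" "t \<le> 1" "x = seg a b t" using set_seg_walk[OF x] by blast
    have "dist x a < 2 * \<rho>"
      using dist_seg_less[of a b a t "2 * \<rho>"] Ecube[OF ab] t \<rho>(1) by simp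
    moreover have "x \<in> U" "a \<in> U"
      using x walk_def w_walk[OF ab] W_sub_U ab V(1) KU by (auto simp: E_def)
    ultimately show ?thesis using s1(2)[of x a] \<rho>(3) by simp
  qed
  obtain c where c: "- (e/4) \<le> c" "c + 7 * \<kappa> \<le> e/4"
    and alt: "rectangle c \<or> (\<forall>a b. E a b \<longrightarrow> Lf a \<longrightarrow> Lf b \<longrightarrow> flow c a b = 0)"
    using flow_or_rectangle[of "e/4"] \<kappa>M unfolding M_def by blast
  have "\<not> rectangle c"
  proof
    assume "rectangle c"
    then obtain a b a' b' S P Q T where E: "E a b" "Rt a" "E a' b'" "Lf a'"
      and ST: "slab_walk c (c + 2 * \<kappa>) S" "slab_walk (c + 5 * \<kappa>) (c + 7 * \<kappa>) T" and PQ: "walk P" "walk Q"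
      "set P \<subseteq> set (seg_walk n a b)" "set Q \<subseteq> set (seg_walk n a' b')"
      and ends: "last S = hd Q" "last P = hd T" and h: "hmt (S @ Q) (P @ T)"
      unfolding rectangle_def by blast
    have wST: "walk S" "walk T" using ST by (auto simp: slab_walk_def)
    obtain \<Psi> where \<Psi>: "continuous_on ({0..1} \<times> {0..1}) \<Psi>" "\<Psi> \<in> {0..1::real} \<times> {0..1::real} \<rightarrow> U"
      "\<And>t. t \<in> {0..1} \<Longrightarrow> \<Psi> (t, 0) \<in> path_image (pl S)" "\<And>t. t \<in> {0..1} \<Longrightarrow> \<Psi> (1, t) \<in> path_image (pl Q)"
      "\<And>t. t \<in> {0..1} \<Longrightarrow> \<Psi> (0, t) \<in> path_image (pl P)" "\<And>t. t \<in> {0..1} \<Longrightarrow> \<Psi> (t, 1) \<in> path_image (pl T)"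
      using square_from_rectangle[OF wST(1) PQ(2,1) wST(2) ends h] by blast
    have near: "\<exists>x\<in>set p. \<bar>fu z - fu x\<bar> < \<tau> \<and> \<bar>fv z - fv x\<bar> < \<tau>" if p: "walk p" "z \<in> path_image (pl p)" for p z
    proof -
      obtain x where x: "x \<in> set p" "dist z x < s" "z \<in> U" using path_image_pl[OF p] by blast
      then have "x \<in> U" using p(1) W_sub_U by (auto simp: walk_def)
      then show ?thesis using s2(2)[of z x] x s(2) by (intro bexI[of _ x]) auto
    qed
    have S: "fv z \<le> c + 3 * \<kappa>" if "z \<in> path_image (pl S)" for z
      using near[OF wST(1) that] ST(1) \<tau>(2) by (force simp: slab_walk_def)
    have T: "c + 4 * \<kappa> \<le> fv z" if "z \<in> path_image (pl T)" for z
      using near[OF wST(2) that] ST(2) \<tau>(2) by (force simp: slab_walk_def)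
    \<comment> \<open>From \<open>e/2\<close> at the right vertex, \<open>e/4\<close> is lost along
      the edge and \<open>e/8\<close> on the piecewise linear path.\<close>
    have P: "e/8 \<le> fu z" if z: "z \<in> path_image (pl P)" for z
    proof -
      obtain x where x: "x \<in> set P" "\<bar>fu z - fu x\<bar> < \<tau>" using near[OF PQ(1) z] by blast
      then have "\<bar>fu x - fu a\<bar> < e/4" using onedge[OF E(1)] PQ(3) by blast
      then show ?thesis using x(2) E(2) \<tau>(3) unfolding Rt_def by linarith
    qed
    have Q: "fu z \<le> - (e/8)" if z: "z \<in> path_image (pl Q)" for z
    proof -
      obtain x where x: "x \<in> set Q" "\<bar>fu z - fu x\<bar> < \<tau>" using near[OF PQ(2) z] by blast
      then have "\<bar>fu x - fu a'\<bar> < e/4" using onedge[OF E(3)] PQ(4) by blast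
      then show ?thesis using x(2) E(4) \<tau>(3) unfolding Lf_def by linarith
    qed
    have "has_square K"
      unfolding has_square_def
    proof (intro exI conjI ballI)
      show "continuous_on ({0..1} \<times> {0..1}) (\<lambda>z. r (\<Psi> z))"
        using continuous_on_compose2[OF r(1) \<Psi>(1)] \<Psi>(2) by blast
      show "(\<lambda>z. r (\<Psi> z)) \<in> {0..1} \<times> {0..1} \<rightarrow> K" using \<Psi>(2) r(2) by blast
      \<comment> \<open>The sign is reversed because the left side of the square runs along
        \<open>P\<close>, a piece of the right edge.\<close>
      show "continuous_on K (\<lambda>x. - u x)" "continuous_on K v" using u v by (auto intro: continuous_intros)
      show "- (e/8) < e/8" "c + 3 * \<kappa> < c + 4 * \<kappa>" using e \<kappa> by auto
      fix t :: real assume t: "t \<in> {0..1}"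
      show "- u (r (\<Psi> (0, t))) \<le> - (e/8)" "e/8 \<le> - u (r (\<Psi> (1, t)))"
        "v (r (\<Psi> (t, 0))) \<le> c + 3 * \<kappa>" "c + 4 * \<kappa> \<le> v (r (\<Psi> (t, 1)))"
        using P[OF \<Psi>(5)[OF t]] Q[OF \<Psi>(4)[OF t]] S[OF \<Psi>(3)[OF t]] T[OF \<Psi>(6)[OF t]]
        by (auto simp: fu_def fv_def)
    qed
    then show False using nosq by simp
  qed
  then have left: "flow c a b = 0" if "E a b" "Lf a" "Lf b" for a b using alt that by blast
  define m where "m = c + 3 * \<kappa>"
  \<comment> \<open>Diagonal directions of the quadrants around \<open>(0, m)\<close>, with the
    branch cut on the right. There an upward crossing jumps from \<open>7*pi/4\<close> to
    \<open>pi/4\<close>, and flow 1 turns the jump into a rotation by \<open>pi/2\<close>; on the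
    left \<open>5*pi/4\<close> and \<open>3*pi/4\<close> are adjacent already and the flow is
    0.\<close>
  define \<theta> where "\<theta> a = (if 0 < fu a then if m < fv a then pi/4 else 7*pi/4 else if m < fv a then 3*pi/4 else 5*pi/4)" for a
  have m: "- (e/4) < m" "m < e/4" using c \<kappa> by (auto simp: m_def)
  have cover: "\<exists>a\<in>V. dist x a < \<rho>" if "x \<in> K" for x
  proof -
    have "x \<in> (\<Union>a\<in>V. ball a \<rho>)" using V(3) that by blast
    then show ?thesis by (auto simp: dist_commute)
  qed
  have add: "flow c a b + flow c b d = flow c a d"
    if "a \<in> V" "b \<in> V" "d \<in> V" "dist a b < 2 * \<rho>" "dist b d < 2 * \<rho>" "dist a d < 2 * \<rho>" for a b d
    using that by (intro flow_additive) (auto simp: E_def)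
  obtain u' v' :: "(nat \<Rightarrow> real) \<Rightarrow> real" where uv': "continuous_on K u'" "continuous_on K v'"
    "\<forall>x\<in>K. \<exists>a\<in>V. dist x a < \<rho> \<and> (\<forall>lo hi. (\<forall>b\<in>V. dist x b < \<rho> \<longrightarrow>
       lo \<le> \<theta> b + 2 * pi * flow c a b \<and> \<theta> b + 2 * pi * flow c a b \<le> hi) \<longrightarrow>
       (\<exists>t. lo \<le> t \<and> t \<le> hi \<and> u' x = cos t \<and> v' x = sin t))"
    using circle_map_from_cocycle[of V K \<rho> "flow c" \<theta>, OF V(2) cover add] .
  have "(u' x \<noteq> 0 \<or> v' x \<noteq> 0) \<and> (e \<le> u x \<longrightarrow> 0 < u' x) \<and> (u x \<le> - e \<longrightarrow> u' x < 0) \<and>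
      (e \<le> v x \<longrightarrow> 0 < v' x) \<and> (v x \<le> - e \<longrightarrow> v' x < 0)" if x: "x \<in> K" for x
  proof -
    obtain a where a: "a \<in> V" "dist x a < \<rho>" and ang0: "\<forall>lo hi. (\<forall>b\<in>V. dist x b < \<rho> \<longrightarrow>
       lo \<le> \<theta> b + 2 * pi * flow c a b \<and> \<theta> b + 2 * pi * flow c a b \<le> hi) \<longrightarrow>
       (\<exists>t. lo \<le> t \<and> t \<le> hi \<and> u' x = cos t \<and> v' x = sin t)"
      using bspec[OF uv'(3) x] by (elim bexE conjE)
    have ang: "\<exists>t. lo \<le> t \<and> t \<le> hi \<and> u' x = cos t \<and> v' x = sin t"
      if "\<And>b. b \<in> V \<Longrightarrow> dist x b < \<rho> \<Longrightarrow>
        lo \<le> \<theta> b + 2 * pi * flow c a b \<and> \<theta> b + 2 * pi * flow c a b \<le> hi" for lo hi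
      using that by (intro ang0[rule_format]) auto
    have near: "\<bar>u x - fu b\<bar> < e/2 \<and> \<bar>v x - fv b\<bar> < e/2" if b: "b \<in> V" "dist x b < \<rho>" for b
    proof -
      have xU: "x \<in> U" "b \<in> U" using x b(1) V(1) KU by auto
      have "\<bar>fu x - fu b\<bar> < e/4 \<and> \<bar>fv x - fv b\<bar> < e/4" using s1(2)[OF xU] b(2) \<rho> by simp
      moreover have "\<bar>u x - fu x\<bar> < e/4 \<and> \<bar>v x - fv x\<bar> < e/4"
        unfolding fu_def fv_def using \<epsilon>(2)[OF x _ r(3)[OF x]] r(2) xU by blast
      ultimately show ?thesis by linarith
    qed
    have Eab: "E a b" if "b \<in> V" "dist x b < \<rho>" for b
      using that a dist_triangle2[of a b x] by (simp add: E_def dist_commute)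
    \<comment> \<open>Heights on the edge stay within \<open>e/4\<close> of one of absolute value at
      least \<open>e/2\<close>, whereas the slab lies between \<open>- (e/4)\<close> and
      \<open>e/4\<close>.\<close>
    have avoid: "flow c a b = 0" if b: "b \<in> V" "dist x b < \<rho>" and far: "e/2 \<le> fv a \<or> fv a \<le> - (e/2)" for b
    proof (rule flow_avoid)
      fix y assume "y \<in> set (seg_walk n a b)"
      then have "\<bar>fv y - fv a\<bar> < e/4" using onedge[OF Eab[OF b]] by blast
      then show "\<not> (c < fv y \<and> fv y < c + 7 * \<kappa>)" using far c by linarith
    qed
    \<comment> \<open>Any bounds serve here, as cosine and sine have no common zero; those chosen
      exist because the net is finite.\<close>
    have "u' x \<noteq> 0 \<or> v' x \<noteq> 0"
    proof -
      let ?D = "{b \<in> V. dist x b < \<rho>}"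
      let ?h = "\<lambda>b. \<theta> b + 2 * pi * flow c a b"
      have fin: "finite ?D" using V(2) by simp
      obtain t where "u' x = cos t" "v' x = sin t"
        using ang[of "Min (?h ` ?D)" "Max (?h ` ?D)"] fin by fastforce
      then show ?thesis using sin_zero_abs_cos_one[of t] by fastforce
    qed
    moreover have "0 < u' x" if ux: "e \<le> u x"
    proof -
      have pos: "e/2 < fu b" if "b \<in> V" "dist x b < \<rho>" for b using near[OF that] ux by linarith
      have fl: "flow c a b = above m b - above m a" if "b \<in> V" "dist x b < \<rho>" for b
        unfolding m_def using pos[OF that] pos[OF a] by (intro flow_right[OF Eab[OF that]]) (auto simp: Rt_def)
      \<comment> \<open>The lift of the angle depends on the side of the level on which
        \<open>a\<close> lies: it is centred at 0 or at \<open>2 * pi\<close>.\<close>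
      show ?thesis
      proof (cases "m < fv a")
        case True
        have "- pi/4 \<le> \<theta> b + 2 * pi * flow c a b \<and> \<theta> b + 2 * pi * flow c a b \<le> pi/4"
          if b: "b \<in> V" "dist x b < \<rho>" for b
          using pos[OF b] e True unfolding fl[OF b] by (auto simp: \<theta>_def above_def)
        then obtain t where "- pi/4 \<le> t" "t \<le> pi/4" "u' x = cos t" using ang by blast
        then show ?thesis using cos_gt_zero_pi[of t] pi_gt_zero by simp
      next
        case False
        have "7*pi/4 \<le> \<theta> b + 2 * pi * flow c a b \<and> \<theta> b + 2 * pi * flow c a b \<le> 9*pi/4"
          if b: "b \<in> V" "dist x b < \<rho>" for b
          using pos[OF b] e False unfolding fl[OF b] by (auto simp: \<theta>_def above_def)
        then obtain t where t: "7*pi/4 \<le> t" "t \<le> 9*pi/4" "u' x = cos t" using ang by blast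
        have "0 < cos (t - 2 * pi)" using cos_gt_zero_pi[of "t - 2 * pi"] pi_gt_zero t by simp
        then show ?thesis using t(3) by (simp add: cos_diff)
      qed
    qed
    moreover have "u' x < 0" if ux: "u x \<le> - e"
    proof -
      have neg: "fu b < - (e/2)" if "b \<in> V" "dist x b < \<rho>" for b using near[OF that] ux by linarith
      have "3*pi/4 \<le> \<theta> b + 2 * pi * flow c a b \<and> \<theta> b + 2 * pi * flow c a b \<le> 5*pi/4"
        if b: "b \<in> V" "dist x b < \<rho>" for b
      proof -
        have "flow c a b = 0" using neg[OF b] neg[OF a] by (intro left Eab[OF b]) (auto simp: Lf_def)
        then show ?thesis using neg[OF b] e by (auto simp: \<theta>_def)
      qed
      then obtain t where t: "3*pi/4 \<le> t" "t \<le> 5*pi/4" "u' x = cos t" using ang by blast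
      have "0 < cos (t - pi)" using cos_gt_zero_pi[of "t - pi"] pi_gt_zero t by simp
      then show ?thesis using t(3) by (simp add: cos_diff)
    qed
    moreover have "0 < v' x" if vx: "e \<le> v x"
    proof -
      have pos: "e/2 < fv b" if "b \<in> V" "dist x b < \<rho>" for b using near[OF that] vx by linarith
      have "pi/4 \<le> \<theta> b + 2 * pi * flow c a b \<and> \<theta> b + 2 * pi * flow c a b \<le> 3*pi/4"
        if b: "b \<in> V" "dist x b < \<rho>" for b
      proof -
        have "flow c a b = 0" using avoid[OF b] pos[OF a] by simp
        moreover have "m < fv b" using pos[OF b] m e by linarith
        ultimately show ?thesis by (auto simp: \<theta>_def)
      qed
      then obtain t where t: "pi/4 \<le> t" "t \<le> 3*pi/4" "v' x = sin t" using ang by blast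
      then show ?thesis using sin_gt_zero[of t] pi_gt_zero by simp
    qed
    moreover have "v' x < 0" if vx: "v x \<le> - e"
    proof -
      have neg: "fv b < - (e/2)" if "b \<in> V" "dist x b < \<rho>" for b using near[OF that] vx by linarith
      have "5*pi/4 \<le> \<theta> b + 2 * pi * flow c a b \<and> \<theta> b + 2 * pi * flow c a b \<le> 7*pi/4"
        if b: "b \<in> V" "dist x b < \<rho>" for b
      proof -
        have "flow c a b = 0" using avoid[OF b] neg[OF a] by simp
        moreover have "\<not> m < fv b" using neg[OF b] m e by linarith
        ultimately show ?thesis by (auto simp: \<theta>_def)
      qed
      then obtain t where t: "5*pi/4 \<le> t" "t \<le> 7*pi/4" "v' x = sin t" using ang by blast
      have "0 < sin (t - pi)" using sin_gt_zero[of "t - pi"] pi_gt_zero t by simp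
      then show ?thesis using t(3) by (simp add: sin_diff)
    qed
    ultimately show ?thesis by blast
  qed
  then show "\<exists>u' v'. continuous_on K u' \<and> continuous_on K v' \<and> (\<forall>x\<in>K. u' x \<noteq> (0::real) \<or> v' x \<noteq> (0::real)) \<and>
       (\<forall>x\<in>K. (u x \<ge> e \<longrightarrow> u' x > 0) \<and> (u x \<le> - e \<longrightarrow> u' x < 0) \<and>
               (v x \<ge> e \<longrightarrow> v' x > 0) \<and> (v x \<le> - e \<longrightarrow> v' x < 0))"
    using uv'(1,2) by (intro exI[of _ u'] exI[of _ v']) simp
qed

section \<open>Comparison of the square with the disc\<close>

lemma square_imp_disc:
  fixes X :: "'a topology" and u v :: "'a \<Rightarrow> real" and \<Psi> :: "real \<times> real \<Rightarrow> 'a"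
  assumes \<Psi>: "continuous_map (top_of_set ({0..1} \<times> {0..1})) X \<Psi>"
    and u: "continuous_map X euclideanreal u" and v: "continuous_map X euclideanreal v"
    and lt: "\<alpha> < \<beta>" "\<gamma> < \<delta>"
    and side: "\<And>t. t \<in> {0..1} \<Longrightarrow> u (\<Psi> (0, t)) \<le> \<alpha> \<and> \<beta> \<le> u (\<Psi> (1, t)) \<and> v (\<Psi> (t, 0)) \<le> \<gamma> \<and> \<delta> \<le> v (\<Psi> (t, 1))"
  shows "\<exists>f g. continuous_map (top_of_set (cball (0::complex) 1)) X f \<and>
               continuous_map X (top_of_set (cball (0::complex) 1)) g \<and>
               (SUP z\<in>cball (0::complex) 1. norm (g (f z) - z)) < 1"
proof -
  define k where "k t = max 0 (min 1 t)" for t :: real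
  \<comment> \<open>The factor 5 puts every point with a coordinate of absolute value at least
    \<open>1/10\<close> on the corresponding side of the square.\<close>
  define F where "F z = (k (1/2 + 5 * Re z), k (1/2 + 5 * Im z))" for z
  \<comment> \<open>Values centred between \<open>- 1/2\<close> and \<open>1/2\<close>, so that
    \<open>g\<close> lands in the unit disc.\<close>
  define p where "p x = k ((u x - \<alpha>) / (\<beta> - \<alpha>)) - 1/2" for x
  define q where "q x = k ((v x - \<gamma>) / (\<delta> - \<gamma>)) - 1/2" for x
  define g where "g x = Complex (p x) (q x)" for x
  have k01: "0 \<le> k t" "k t \<le> 1" for t by (auto simp: k_def)
  have khalf: "\<bar>k t - 1/2\<bar> \<le> 1/2" for t using k01[of t] by linarith
  have pq: "\<bar>p x\<bar> \<le> 1/2" "\<bar>q x\<bar> \<le> 1/2" for x unfolding p_def q_def by (rule khalf)+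
  have ck: "continuous_on UNIV k" unfolding k_def by (intro continuous_intros)
  have cF: "continuous_on UNIV F"
    unfolding F_def k_def by (intro continuous_intros)
  have "F \<in> cball 0 1 \<rightarrow> {0..1} \<times> {0..1}" using k01 by (auto simp: F_def)
  then have "continuous_map (top_of_set (cball 0 1)) (top_of_set ({0..1} \<times> {0..1})) F"
    using continuous_on_subset[OF cF] by auto
  then have f: "continuous_map (top_of_set (cball 0 1)) X (\<Psi> \<circ> F)"
    using \<Psi> by (rule continuous_map_compose)
  have kc: "continuous_map X euclideanreal (\<lambda>x. k (h x))" if "continuous_map X euclideanreal h" for h
    using continuous_map_compose[OF that, of euclideanreal k] ck by (simp add: o_def)
  have ph: "continuous_map X euclideanreal p" "continuous_map X euclideanreal q"
    unfolding p_def q_def using lt by (intro continuous_intros kc u v; simp)+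
  have co: "continuous_map X euclidean (\<lambda>x. h (w x))"
    if "continuous_map X euclideanreal w" "continuous_on UNIV h" for w and h :: "real \<Rightarrow> complex"
    using continuous_map_compose[OF that(1), of euclidean h] that(2) by (simp add: o_def)
  have "continuous_map X euclidean (\<lambda>x. of_real (p x) + \<i> * of_real (q x))"
    by (intro continuous_map_add co[OF ph(1), of of_real] co[OF ph(2), of "\<lambda>t. \<i> * of_real t"] continuous_intros)
  then have "continuous_map X euclidean g" by (simp add: g_def[abs_def] Complex_eq)
  moreover have "g x \<in> cball 0 1" for x
  proof -
    have "norm (g x) \<le> 1/2 + 1/2"
      using cmod_le[of "g x"] pq[of x] unfolding g_def complex.sel by linarith
    then show ?thesis by simp
  qed
  ultimately have cg: "continuous_map X (top_of_set (cball 0 1)) g"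
    by (auto simp: continuous_map_in_subtopology)
  \<comment> \<open>A coordinate of \<open>z\<close> of absolute value at least \<open>1/10\<close>
    is compared with \<open>1/2\<close> of the same sign, with error at most \<open>1/2\<close>;
    otherwise the error is at most \<open>1/2 + 1/10\<close>. Now
    \<open>2 * (6/10)^2 < (9/10)^2\<close>, and the uniform bound keeps the supremum below
    1.\<close>
  have est: "norm (g (\<Psi> (F z)) - z) \<le> 9/10" if z: "z \<in> cball 0 1" for z
  proof -
    have z1: "\<bar>Re z\<bar> \<le> 1" "\<bar>Im z\<bar> \<le> 1"
      using z abs_Re_le_cmod[of z] abs_Im_le_cmod[of z] by auto
    have kk: "k t = 1" if "1 \<le> t" for t using that by (simp add: k_def)
    have k0: "k t = 0" if "t \<le> 0" for t using that by (simp add: k_def)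
    have P: "\<bar>p (\<Psi> (F z)) - Re z\<bar> \<le> 6/10"
    proof -
      consider "1/10 \<le> Re z" | "Re z \<le> - (1/10)" | "\<bar>Re z\<bar> < 1/10" by linarith
      then show ?thesis
      proof cases
        case 1
        then have "\<beta> \<le> u (\<Psi> (F z))" using side k01 by (simp add: F_def kk)
        then have "p (\<Psi> (F z)) = 1/2" using lt by (simp add: p_def kk field_simps)
        then show ?thesis using 1 z1 by (simp add: abs_if)
      next
        case 2
        then have "u (\<Psi> (F z)) \<le> \<alpha>" using side k01 by (simp add: F_def k0)
        then have "p (\<Psi> (F z)) = - 1/2" using lt by (simp add: p_def k0 divide_le_0_iff)
        then show ?thesis using 2 z1 by (simp add: abs_if)
      next
        case 3
        then show ?thesis using pq(1)[of "\<Psi> (F z)"] by linarith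
      qed
    qed
    have Q: "\<bar>q (\<Psi> (F z)) - Im z\<bar> \<le> 6/10"
    proof -
      consider "1/10 \<le> Im z" | "Im z \<le> - (1/10)" | "\<bar>Im z\<bar> < 1/10" by linarith
      then show ?thesis
      proof cases
        case 1
        then have "\<delta> \<le> v (\<Psi> (F z))" using side k01 by (simp add: F_def kk)
        then have "q (\<Psi> (F z)) = 1/2" using lt by (simp add: q_def kk field_simps)
        then show ?thesis using 1 z1 by (simp add: abs_if)
      next
        case 2
        then have "v (\<Psi> (F z)) \<le> \<gamma>" using side k01 by (simp add: F_def k0)
        then have "q (\<Psi> (F z)) = - 1/2" using lt by (simp add: q_def k0 divide_le_0_iff)
        then show ?thesis using 2 z1 by (simp add: abs_if)
      next
        case 3
        then show ?thesis using pq(2)[of "\<Psi> (F z)"] by linarith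
      qed
    qed
    have "(p (\<Psi> (F z)) - Re z)\<^sup>2 \<le> (6/10)\<^sup>2" "(q (\<Psi> (F z)) - Im z)\<^sup>2 \<le> (6/10)\<^sup>2"
      using P Q abs_le_square_iff[of _ "6/10::real"] by auto
    then have "(norm (g (\<Psi> (F z)) - z))\<^sup>2 \<le> (9/10)\<^sup>2"
      unfolding cmod_power2 by (simp add: g_def power2_eq_square)
    then show ?thesis by (rule power2_le_imp_le) simp
  qed
  have "(SUP z\<in>cball (0::complex) 1. norm (g ((\<Psi> \<circ> F) z) - z)) \<le> 9/10"
    using est by (intro cSUP_least) auto
  then show ?thesis using f cg by (intro exI[of _ "\<Psi> \<circ> F"] exI[of _ g]) auto
qed

section \<open>Embedding into the Hilbert cube\<close>

lemma compact_hcube: "compact hcube"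
proof -
  have "compactin (product_topology (\<lambda>i. euclideanreal) (UNIV::nat set)) (PiE UNIV (\<lambda>i. {0..1}))"
    by (subst compactin_PiE) auto
  moreover have "PiE UNIV (\<lambda>i::nat. {0..1::real}) = hcube" by (auto simp: hcube_def PiE_def Pi_def)
  ultimately show ?thesis by (simp add: euclidean_product_topology)
qed

lemma compact_metric_dense_sequence:
  fixes X :: "'a metric"
  assumes "compact_space (mtopology_of X)" "mspace X \<noteq> {}"
  obtains xs :: "nat \<Rightarrow> 'a" where "range xs \<subseteq> mspace X"
    "\<And>x \<epsilon>. x \<in> mspace X \<Longrightarrow> 0 < \<epsilon> \<Longrightarrow> \<exists>n. mdist X x (xs n) < \<epsilon>"
proof -
  interpret Metric_space "mspace X" "mdist X" by simp
  have "mtotally_bounded (mspace X)"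
    using assms(1) compact_space_eq_mcomplete_mtotally_bounded by (simp add: mtopology_of_def)
  then have "\<exists>F. finite F \<and> F \<subseteq> mspace X \<and> mspace X \<subseteq> (\<Union>x\<in>F. mball x (inverse (real (Suc n))))" for n
    unfolding mtotally_bounded_def by simp
  then obtain F where F: "\<And>n. finite (F n)" "\<And>n. F n \<subseteq> mspace X"
    "\<And>n. mspace X \<subseteq> (\<Union>x\<in>F n. mball x (inverse (real (Suc n))))" by metis
  define D where "D = (\<Union>n. F n)"
  have D: "countable D" "D \<subseteq> mspace X" using F by (auto simp: D_def intro: countable_finite)
  have "D \<noteq> {}" using F(3)[of 0] assms(2) by (auto simp: D_def)
  show thesis
  proof (rule that[of "from_nat_into D"])
    show "range (from_nat_into D) \<subseteq> mspace X" using D(2) \<open>D \<noteq> {}\<close> by (simp add: range_from_nat_into D(1))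
    fix x and \<epsilon> :: real assume x: "x \<in> mspace X" "0 < \<epsilon>"
    obtain n where n: "inverse (real (Suc n)) < \<epsilon>" using reals_Archimedean[OF x(2)] by auto
    obtain y where y: "y \<in> F n" "x \<in> mball y (inverse (real (Suc n)))" using F(3)[of n] x(1) by blast
    then have "mdist X x y < \<epsilon>" using n by (simp add: commute)
    moreover have "y \<in> range (from_nat_into D)"
      using y(1) D(1) \<open>D \<noteq> {}\<close> by (auto simp: range_from_nat_into D_def)
    ultimately show "\<exists>n. mdist X x (from_nat_into D n) < \<epsilon>" by blast
  qed
qed

text \<open>Truncated distances to a dense sequence. One Lipschitz bound is enough to record, as
  compactness makes a continuous injection an embedding.\<close>

lemma compact_metric_embeds_hcube:
  fixes X :: "'a metric"
  assumes "compact_space (mtopology_of X)"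
  obtains \<iota> :: "'a \<Rightarrow> nat \<Rightarrow> real" where "\<iota> \<in> mspace X \<rightarrow> hcube" "inj_on \<iota> (mspace X)"
    "\<And>x y. x \<in> mspace X \<Longrightarrow> y \<in> mspace X \<Longrightarrow> dist (\<iota> x) (\<iota> y) \<le> 2 * mdist X x y"
proof (cases "mspace X = {}")
  case True
  then show thesis using that[of undefined] by simp
next
  case False
  interpret Metric_space "mspace X" "mdist X" by simp
  obtain xs :: "nat \<Rightarrow> 'a" where xs: "range xs \<subseteq> mspace X"
    "\<And>x \<epsilon>. x \<in> mspace X \<Longrightarrow> 0 < \<epsilon> \<Longrightarrow> \<exists>n. mdist X x (xs n) < \<epsilon>"
    using compact_metric_dense_sequence[OF assms False] by blast
  have xsn: "xs n \<in> mspace X" for n using xs(1) by auto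
  define \<iota> where "\<iota> x = (\<lambda>n. min 1 (mdist X x (xs n)))" for x
  show thesis
  proof (rule that[of \<iota>])
    show "\<iota> \<in> mspace X \<rightarrow> hcube" by (auto simp: \<iota>_def hcube_def)
    fix x y assume xy: "x \<in> mspace X" "y \<in> mspace X"
    show "dist (\<iota> x) (\<iota> y) \<le> 2 * mdist X x y"
    proof (rule dist_fun_le)
      fix n
      have "mdist X x (xs n) \<le> mdist X x y + mdist X y (xs n)" "mdist X y (xs n) \<le> mdist X y x + mdist X x (xs n)"
        using triangle xy xsn by blast+
      then show "\<bar>\<iota> x n - \<iota> y n\<bar> \<le> mdist X x y"
        using commute[of y x] nonneg[of x y] by (simp add: \<iota>_def min_def abs_if)
    qed
  next
    show "inj_on \<iota> (mspace X)"
    proof (rule inj_onI, rule ccontr)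
      fix x y assume xy: "x \<in> mspace X" "y \<in> mspace X" "\<iota> x = \<iota> y" "x \<noteq> y"
      \<comment> \<open>Below 1 the truncation is invisible, and half the distance lets a point near
        \<open>x\<close> separate \<open>x\<close> from \<open>y\<close>.\<close>
      define \<epsilon> where "\<epsilon> = min 1 (mdist X x y) / 2"
      have \<epsilon>: "0 < \<epsilon>" "\<epsilon> < 1" "2 * \<epsilon> \<le> mdist X x y" using mdist_pos_eq[OF xy(1,2)] xy(4) by (auto simp: \<epsilon>_def)
      obtain n where n: "mdist X x (xs n) < \<epsilon>" using xs(2)[OF xy(1) \<epsilon>(1)] by blast
      have "min 1 (mdist X x (xs n)) = min 1 (mdist X y (xs n))" using xy(3) by (metis \<iota>_def)
      then have "mdist X y (xs n) < \<epsilon>" using n \<epsilon>(2) by (auto simp: min_def split: if_splits)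
      moreover have "mdist X x y \<le> mdist X x (xs n) + mdist X y (xs n)"
        using triangle[OF xy(1) xsn xy(2), of n] commute[of y "xs n"] by simp
      ultimately show False using n \<epsilon>(3) by linarith
    qed
  qed
qed

theorem theorem3:
  fixes X :: "'a metric"
  assumes "compact_space (mtopology_of X)"
    and "AANR X"
    and "covering_dim (mtopology_of X) > 1"
  shows "\<exists>f g. continuous_map (top_of_set (cball (0::complex) 1)) (mtopology_of X) f \<and>
               continuous_map (mtopology_of X) (top_of_set (cball (0::complex) 1)) g \<and>
               (SUP z\<in>cball (0::complex) 1. norm (g (f z) - z)) < 1"
proof -
  let ?T = "mtopology_of X"
  have dim: "\<not> covering_dim_le ?T 1"
  proof
    assume "covering_dim_le ?T 1"
    then have "covering_dim ?T \<le> enat 1" unfolding covering_dim_def by (intro INF_lower) simp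
    then show False using assms(3) by (simp add: one_enat_def)
  qed
  obtain \<iota> :: "'a \<Rightarrow> nat \<Rightarrow> real" where \<iota>: "\<iota> \<in> mspace X \<rightarrow> hcube" "inj_on \<iota> (mspace X)"
    "\<And>x y. x \<in> mspace X \<Longrightarrow> y \<in> mspace X \<Longrightarrow> dist (\<iota> x) (\<iota> y) \<le> 2 * mdist X x y"
    using compact_metric_embeds_hcube[OF assms(1)] by blast
  define K where "K = \<iota> ` mspace X"
  \<comment> \<open>The cube itself is the test space for \<open>AANR\<close>: it has the required
    type, and its balls are convex.\<close>
  define Y where "Y = submetric euclidean_metric hcube"
  have Y: "mtopology_of Y = top_of_set hcube" by (simp add: Y_def mtopology_of_submetric)
  have "Lipschitz_continuous_map X euclidean_metric \<iota>"
    unfolding Lipschitz_continuous_map_def using \<iota>(3) by (auto intro!: exI[of _ 2])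
  then have cont: "continuous_map ?T euclidean \<iota>"
    using Lipschitz_continuous_imp_continuous_map by fastforce
  have K: "compact K" "K \<subseteq> hcube"
    using image_compactin[OF _ cont, of "mspace X"] assms(1) \<iota>(1) by (auto simp: K_def compact_space_def)
  have contK: "continuous_map ?T (top_of_set K) \<iota>"
    using cont by (auto simp: continuous_map_in_subtopology K_def)
  have "homeomorphic_map ?T (top_of_set K) \<iota>"
    using \<iota>(2) by (intro continuous_imp_homeomorphic_map[OF contK assms(1)])
      (auto simp: K_def Hausdorff_space_subtopology)
  then obtain j where j: "homeomorphic_maps ?T (top_of_set K) \<iota> j"
    using homeomorphic_map_maps by blast
  have j_inv: "\<iota> (j y) = y" if "y \<in> K" for y using j that by (simp add: homeomorphic_maps_def)
  have contj: "continuous_map (top_of_set K) ?T j" using j by (simp add: homeomorphic_maps_def)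
  have "compact_space (mtopology_of Y)" using compact_hcube by (simp add: Y compact_space_subtopology)
  moreover have "embedding_map ?T (mtopology_of Y) \<iota>"
    unfolding Y using cont \<iota>(1,2) assms(1)
    by (intro continuous_imp_embedding_map) (auto simp: continuous_map_in_subtopology Hausdorff_space_subtopology)
  ultimately have aanr: "\<exists>U r. closedin (top_of_set hcube) U \<and> \<iota> ` mspace X \<subseteq> (top_of_set hcube) interior_of U \<and>
      continuous_map (subtopology (top_of_set hcube) U) ?T r \<and> (\<forall>x\<in>mspace X. mdist X x (r (\<iota> x)) < \<epsilon>)"
    if "0 < \<epsilon>" for \<epsilon>
    using assms(2)[unfolded AANR_def, THEN spec, THEN spec, THEN spec, of Y \<iota> \<epsilon>] that unfolding Y by simp
  have ret: "\<exists>U r \<eta>. compact U \<and> 0 < \<eta> \<and> (\<forall>k\<in>K. \<forall>y\<in>hcube. dist y k < \<eta> \<longrightarrow> y \<in> U) \<and>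
      continuous_on U r \<and> r \<in> U \<rightarrow> K \<and> (\<forall>k\<in>K. dist k (r k) < \<epsilon>)" if \<epsilon>: "0 < \<epsilon>" for \<epsilon>
  proof -
    \<comment> \<open>\<open>\<iota>\<close> at most doubles distances, hence
      \<open>\<epsilon> / 2\<close>.\<close>
    obtain U r where U: "closedin (top_of_set hcube) U" "K \<subseteq> (top_of_set hcube) interior_of U"
      and r: "continuous_map (subtopology (top_of_set hcube) U) ?T r" "\<forall>x\<in>mspace X. mdist X x (r (\<iota> x)) < \<epsilon> / 2"
      using aanr[of "\<epsilon> / 2"] \<epsilon> unfolding K_def by auto
    have Uh: "U \<subseteq> hcube" using U(1) closedin_imp_subset by blast
    have cU: "compact U" using U(1) compact_hcube closedin_compact by blast
    have KU: "K \<subseteq> U" by (rule subset_trans[OF U(2) interior_of_subset])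
    have "openin (top_of_set hcube) ((top_of_set hcube) interior_of U)" by (rule openin_interior_of)
    then obtain G where G: "open G" "(top_of_set hcube) interior_of U = hcube \<inter> G"
      unfolding openin_open by blast
    \<comment> \<open>Compactness of \<open>K\<close> turns the neighbourhood into a uniform
      one.\<close>
    obtain \<eta> where \<eta>: "0 < \<eta>" "(\<Union>k\<in>K. ball k \<eta>) \<subseteq> G"
      using compact_subset_open_imp_ball_epsilon_subset[OF K(1) G(1)] U(2) G(2) by blast
    have sub: "subtopology (top_of_set hcube) U = top_of_set U"
      using Uh by (simp add: subtopology_subtopology inf_absorb2)
    have rU: "r y \<in> mspace X" if "y \<in> U" for y
      using r(1) that unfolding sub by (auto simp: continuous_map_def)
    have "continuous_map (top_of_set U) euclidean (\<iota> \<circ> r)"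
      using continuous_map_compose[OF r(1)[unfolded sub] cont] .
    then have "continuous_on U (\<iota> \<circ> r)" by simp
    moreover have "\<iota> \<circ> r \<in> U \<rightarrow> K" using rU by (auto simp: K_def)
    moreover have "dist k ((\<iota> \<circ> r) k) < \<epsilon>" if k: "k \<in> K" for k
    proof -
      obtain x where x: "x \<in> mspace X" "k = \<iota> x" using k by (auto simp: K_def)
      have "dist (\<iota> x) (\<iota> (r (\<iota> x))) \<le> 2 * mdist X x (r (\<iota> x))"
        using \<iota>(3) x rU KU k by blast
      then show ?thesis using r(2) x by fastforce
    qed
    moreover have "y \<in> U" if "k \<in> K" "y \<in> hcube" "dist y k < \<eta>" for k y
    proof -
      have "y \<in> ball k \<eta>" using that(3) by (simp add: dist_commute)
      then have "y \<in> G" using \<eta>(2) that(1) by blast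
      then have "y \<in> (top_of_set hcube) interior_of U" using G(2) that(2) by blast
      then show ?thesis by (rule subsetD[OF interior_of_subset])
    qed
    ultimately show ?thesis using cU \<eta>(1) by blast
  qed
  have "has_square K"
  proof (rule ccontr)
    assume "\<not> has_square K"
    then have "covering_dim_le (top_of_set K) 1"
      using square_or_unstable[OF K ret] unstable_pairs_imp_dim_le_1[OF K(1)] by blast
    then show False using covering_dim_le_homeomorphic[OF j] dim by blast
  qed
  then obtain \<Psi> u v \<alpha> \<beta> \<gamma> \<delta> where \<Psi>: "continuous_on ({0..1} \<times> {0..1}) \<Psi>" "\<Psi> \<in> {0..1::real} \<times> {0..1::real} \<rightarrow> K"
    and uv: "continuous_on K u" "continuous_on K v" "\<alpha> < (\<beta>::real)" "\<gamma> < (\<delta>::real)"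
    and side: "\<forall>t\<in>{0..1}. u (\<Psi> (0, t)) \<le> \<alpha> \<and> \<beta> \<le> u (\<Psi> (1, t)) \<and> v (\<Psi> (t, 0)) \<le> \<gamma> \<and> \<delta> \<le> v (\<Psi> (t, 1))"
    unfolding has_square_def by (elim exE conjE)
  show ?thesis
  proof (rule square_imp_disc[of ?T "j \<circ> \<Psi>" "u \<circ> \<iota>" "v \<circ> \<iota>" \<alpha> \<beta> \<gamma> \<delta>])
    have "continuous_map (top_of_set ({0..1} \<times> {0..1})) (top_of_set K) \<Psi>" using \<Psi> by auto
    then show "continuous_map (top_of_set ({0..1} \<times> {0..1})) ?T (j \<circ> \<Psi>)"
      using contj by (rule continuous_map_compose)
    show "continuous_map ?T euclideanreal (u \<circ> \<iota>)" "continuous_map ?T euclideanreal (v \<circ> \<iota>)"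
      using uv by (auto intro!: continuous_map_compose[OF contK])
    fix t :: real assume t: "t \<in> {0..1}"
    have "\<iota> (j (\<Psi> z)) = \<Psi> z" if "z \<in> {0..1} \<times> {0..1}" for z using \<Psi>(2) that j_inv by blast
    then show "(u \<circ> \<iota>) ((j \<circ> \<Psi>) (0, t)) \<le> \<alpha> \<and> \<beta> \<le> (u \<circ> \<iota>) ((j \<circ> \<Psi>) (1, t)) \<and>
        (v \<circ> \<iota>) ((j \<circ> \<Psi>) (t, 0)) \<le> \<gamma> \<and> \<delta> \<le> (v \<circ> \<iota>) ((j \<circ> \<Psi>) (t, 1))"
      using side t by simp
  qed (use uv in auto)
qed

end
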